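(* Let $n\ge1$, $\lambda\in\mathbb R$, $\varepsilon\in\{0,1\}$, $\mu=\frac{n+1}2+i\lambda$. Let $a,b\in\mathbb C^{n+1}$ satisfy $\langle a,b\rangle=0$ and let $\phi_{a,b}(s,\sigma)=\frac{(a_{n+1}+\langle a_*,s\rangle)(b_{n+1}+\langle b_*,\sigma\rangle)}{1+\langle s,\sigma\rangle}$. Let $p\in\mathbb N$ and let $\delta\in\{0,1\}$ with $\delta\equiv p$ mod $2$. Then $$\mathrm{Op}^\vee_{i\lambda,\varepsilon}(\phi_{a,b}^p)=G_{i\lambda,\varepsilon}(p,\delta)\;\mathrm{Op}_{i\lambda,\varepsilon}(\phi_{a,b}^p),$$ where $$G_{i\lambda,\varepsilon}(\rho,\delta)=(-1)^\delta\,\frac{\Gamma(\frac{n+1-\mu+\varepsilon}2)}{\Gamma(\frac{-n+\mu+\varepsilon}2)}\,\frac{\Gamma(\frac{-n+\mu-\rho+|\varepsilon-\delta|}2)}{\Gamma(\frac{n+1-\mu+\rho+|\varepsilon-\delta|}2)}\,\frac{\Gamma(\frac{1-\mu+\varepsilon}2)}{\Gamma(\frac{\mu+\varepsilon}2)}\,\frac{\Gamma(\frac{\mu+\rho+|\varepsilon-\delta|}2)}{\Gamma(\frac{1-\mu-\rho+|\varepsilon-\delta|}2)} .$$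
   Context: $\langle\cdot,\cdot\rangle$ is the bilinear product; $a=(a_*,a_{n+1})$ with $a_*\in\mathbb C^n$, likewise $b$; $s,\sigma\in\mathbb R^n$; $|t|_\varepsilon^\alpha=|t|^\alpha(\mathrm{sign}\,t)^\varepsilon$. $C_{i\lambda,\varepsilon}=(-i)^\varepsilon\pi^{-\frac n2+i\lambda}\frac{\Gamma(\frac{1+n}4-\frac{i\lambda}2+\frac\varepsilon2)}{\Gamma(\frac{1-n}4+\frac{i\lambda}2+\frac\varepsilon2)}$; $\theta_{i\lambda,\varepsilon}$ is the unitary operator on $L^2(\mathbb R^n)$ formally given by $(\theta_{i\lambda,\varepsilon}u)(\sigma)=C_{i\lambda,\varepsilon}\int_{\mathbb R^n}|1+\langle s,\sigma\rangle|_\varepsilon^{-\frac{n+1}2+i\lambda}u(s)ds$. The standard and antistandard calculi are $$(\mathrm{Op}_{i\lambda,\varepsilon}(f)u)(s)=(-1)^\varepsilon C_{-i\lambda,\varepsilon}\int_{\mathbb R^n}f(s,\sigma)|1+\langle s,\sigma\rangle|_\varepsilon^{-\frac{n+1}2-i\lambda}(\theta_{i\lambda,\varepsilon}u)(\sigma)d\sigma,$$ $$(\theta_{i\lambda,\varepsilon}\mathrm{Op}^\vee_{i\lambda,\varepsilon}(h)u)(\sigma)=C_{i\lambda,\varepsilon}\int_{\mathbb R^n}h(s,\sigma)|1+\langle s,\sigma\rangle|_\varepsilon^{-\frac{n+1}2+i\lambda}u(s)ds;$$ the adjoint of $\mathrm{Op}_{i\lambda,\varepsilon}(f)$ is $\mathrm{Op}^\vee_{i\lambda,\varepsilon}(\bar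 f)$. For the present symbols, which are not square-integrable, these definitions are extended formally (operators acting on smooth functions, integrals in the distribution sense), so that: a symbol depending only on $s$ gives the corresponding multiplication operator in the $\mathrm{Op}_{i\lambda,\varepsilon}$-calculus; $\mathrm{Op}_{i\lambda,\varepsilon}(f_1f_2)=\mathrm{Op}_{i\lambda,\varepsilon}(f_1)\mathrm{Op}_{i\lambda,\varepsilon}(f_2)$ whenever $f_1$ depends only on $s$ or $f_2$ depends only on $\sigma$; the relation between $\mathrm{Op}^\vee$ and adjoints (formal) is maintained. *)

theory Defs
  imports "HOL-Complex_Analysis.Complex_Analysis"
begin

definition spow :: "complex \<Rightarrow> nat \<Rightarrow> real \<Rightarrow> complex" where
  "spow \<alpha> \<epsilon> t = of_real \<bar>t\<bar> powr \<alpha> * of_real (sgn t) ^ \<epsilon>"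

(* <s,\<sigma>> below is the inner product of real vectors; lin c s is the complex bilinear
   (not Hermitian) product c_{n+1} + <c_*, s> of c = (c_*, c_{n+1}) with the vector (s, 1). *)
definition lin :: "(complex^'n) \<times> complex \<Rightarrow> real^'n \<Rightarrow> complex" where
  "lin c s = snd c + (\<Sum>i\<in>UNIV. fst c $ i * of_real (s $ i))"

definition bilin :: "(complex^'n) \<times> complex \<Rightarrow> (complex^'n) \<times> complex \<Rightarrow> complex" where
  "bilin a b = (\<Sum>i\<in>UNIV. fst a $ i * fst b $ i) + snd a * snd b"

definition phi :: "(complex^'n) \<times> complex \<Rightarrow> (complex^'n) \<times> complex \<Rightarrow>
    real^'n \<Rightarrow> real^'n \<Rightarrow> complex" where
  "phi a b s \<sigma> = lin a s * lin b \<sigma> / of_real (1 + s \<bullet> \<sigma>)"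


text \<open>Smooth functions on an open set, and the smooth vectors of the representation on which
  the operators act: the functions on \<open>\<real>\<^sup>n\<close>, seen as the affine chart \<open>s \<mapsto> (s, 1)\<close> of projective
  space, whose extension to \<open>\<real>\<^sup>n\<^sup>+\<^sup>1 - {0}\<close> as a homogeneous function of degree
  \<open>- (n + 1) / 2 - \<nu>\<close> and parity \<open>\<epsilon>\<close> is smooth. The operator \<open>theta\<close> with parameter \<open>i lam\<close> below
  acts on the space with \<open>\<nu> = i lam\<close>, and its values belong to the one with \<open>\<nu> = - i lam\<close>.\<close>

fun Ck_on :: "nat \<Rightarrow> ('a::real_normed_vector \<Rightarrow> 'b::real_normed_vector) \<Rightarrow> 'a set \<Rightarrow> bool" where
  "Ck_on 0 f S \<longleftrightarrow> continuous_on S f"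
| "Ck_on (Suc k) f S \<longleftrightarrow> (\<forall>x\<in>S. f differentiable (at x)) \<and>
     (\<forall>v. Ck_on k (\<lambda>x. frechet_derivative f (at x) v) S)"

definition smooth_vectors :: "complex \<Rightarrow> nat \<Rightarrow> (real^'n \<Rightarrow> complex) set" where
  "smooth_vectors \<nu> \<epsilon> = {u. \<exists>U :: (real^'n) \<times> real \<Rightarrow> complex.
     (\<forall>k. Ck_on k U (- {0})) \<and>
     (\<forall>r S. r \<noteq> 0 \<longrightarrow> S \<noteq> 0 \<longrightarrow>
        U (r *\<^sub>R S) = spow (- (of_nat (CARD('n) + 1) / 2) - \<nu>) \<epsilon> r * U S) \<and>
     (\<forall>s. u s = U (s, 1))}"


text \<open>Integrals in the distribution sense. The value is unique, by the identity theorem.\<close>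

definition mero_cont :: "(complex \<Rightarrow> complex) \<Rightarrow> complex \<Rightarrow> complex" where
  "mero_cont f = (THE F. F nicely_meromorphic_on UNIV \<and> (\<exists>c. \<forall>z. Re z > c \<longrightarrow> F z = f z))"

definition Cnorm :: "nat \<Rightarrow> complex \<Rightarrow> nat \<Rightarrow> complex" where
  "Cnorm n \<nu> \<epsilon> = (- \<i>) ^ \<epsilon> * of_real pi powr (- (of_nat n / 2) + \<nu>) *
     Gamma (of_nat (1 + n) / 4 - \<nu> / 2 + of_nat \<epsilon> / 2) /
     Gamma ((1 - of_nat n) / 4 + \<nu> / 2 + of_nat \<epsilon> / 2)"

text \<open>\<open>kernel_op \<nu> \<epsilon> h u\<close> is the function
  \<open>y \<mapsto> C\<^sub>\<nu>\<^sub>,\<^sub>\<epsilon> \<integral> h x y |1 + \<langle>x, y\<rangle>|\<^sub>\<epsilon> ^ (- (n+1)/2 + \<nu>) u x dx\<close>, where the singularity along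
  \<open>1 + \<langle>x, y\<rangle> = 0\<close>, including its points at infinity, is regularized in the usual way:
  \<open>\<nu>\<close> is shifted to \<open>\<nu> + z\<close> with \<open>Re z\<close> large, and one continues back to \<open>z = 0\<close>. The factor
  \<open>(1 + |x|\<^sup>2) ^ (- z/2)\<close> keeps the integrand homogeneous of degree \<open>- n - 1\<close> in \<open>(x, 1)\<close>, i.e.
  a density on projective space (so that, for \<open>h\<close> homogeneous of degree \<open>0\<close> like \<open>phi\<close>, the
  continuation is that of the integral over the unit sphere of a fixed smooth function against
  \<open>|\<langle>X, Y\<rangle>| ^ \<alpha>\<close> with varying exponent). The constant is shifted along with the exponent, since at
  \<open>\<nu> = 0\<close> it may vanish while the integral has a pole, the product having a limit (this makes
  \<open>theta\<close> with \<open>lam = 0\<close> the limit of the operators with \<open>lam \<noteq> 0\<close>).\<close>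

definition kernel_op :: "complex \<Rightarrow> nat \<Rightarrow> (real^'n \<Rightarrow> real^'n \<Rightarrow> complex) \<Rightarrow>
    (real^'n \<Rightarrow> complex) \<Rightarrow> real^'n \<Rightarrow> complex" where
  "kernel_op \<nu> \<epsilon> h u y = Lim (at 0) (\<lambda>z. Cnorm CARD('n) (\<nu> + z) \<epsilon> *
     mero_cont (\<lambda>z. \<integral>x. h x y * spow (- (of_nat (CARD('n) + 1) / 2) + \<nu> + z) \<epsilon> (1 + x \<bullet> y) *
       of_real (1 + x \<bullet> x) powr (- z / 2) * u x \<partial>lborel) z)"

definition theta :: "real \<Rightarrow> nat \<Rightarrow> (real^'n \<Rightarrow> complex) \<Rightarrow> real^'n \<Rightarrow> complex" where
  "theta lam \<epsilon> = kernel_op (\<i> * of_real lam) \<epsilon> (\<lambda>s \<sigma>. 1)"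

definition Op :: "real \<Rightarrow> nat \<Rightarrow> (real^'n \<Rightarrow> real^'n \<Rightarrow> complex) \<Rightarrow>
    (real^'n \<Rightarrow> complex) \<Rightarrow> real^'n \<Rightarrow> complex" where
  "Op lam \<epsilon> f u s = (-1) ^ \<epsilon> *
     kernel_op (- (\<i> * of_real lam)) \<epsilon> (\<lambda>\<sigma> s. f s \<sigma>) (theta lam \<epsilon> u) s"

text \<open>The antistandard calculus is defined through \<open>theta (Op_vee h u)\<close>; \<open>theta\<close> is injective
  on the smooth vectors.\<close>

definition Op_vee :: "real \<Rightarrow> nat \<Rightarrow> (real^'n \<Rightarrow> real^'n \<Rightarrow> complex) \<Rightarrow>
    (real^'n \<Rightarrow> complex) \<Rightarrow> real^'n \<Rightarrow> complex" where
  "Op_vee lam \<epsilon> h u = inv_into (smooth_vectors (\<i> * of_real lam) \<epsilon>) (theta lam \<epsilon>)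
     (kernel_op (\<i> * of_real lam) \<epsilon> h u)"


definition G_gamma :: "nat \<Rightarrow> complex \<Rightarrow> nat \<Rightarrow> complex \<Rightarrow> nat \<Rightarrow> complex" where
  "G_gamma n \<mu> \<epsilon> \<rho> \<delta> = (let \<eta> = of_int \<bar>int \<epsilon> - int \<delta>\<bar> in (-1) ^ \<delta>
     * (Gamma ((of_nat n + 1 - \<mu> + of_nat \<epsilon>) / 2) / Gamma ((- of_nat n + \<mu> + of_nat \<epsilon>) / 2))
     * (Gamma ((- of_nat n + \<mu> - \<rho> + \<eta>) / 2) / Gamma ((of_nat n + 1 - \<mu> + \<rho> + \<eta>) / 2))
     * (Gamma ((1 - \<mu> + of_nat \<epsilon>) / 2) / Gamma ((\<mu> + of_nat \<epsilon>) / 2))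
     * (Gamma ((\<mu> + \<rho> + \<eta>) / 2) / Gamma ((1 - \<mu> - \<rho> + \<eta>) / 2)))"

text \<open>For \<open>lam = 0\<close>, odd \<open>n\<close> and \<open>\<epsilon> \<equiv> (n - 1) / 2 (mod 2)\<close>, poles of \<open>Gamma\<close> occur simultaneously
  in the numerator and in the denominator when \<open>\<rho>\<close> is a natural number with \<open>\<rho> \<equiv> \<delta> (mod 2)\<close>; the
  quotient is then understood as its limit (\<open>Gamma\<close> is \<open>0\<close> at its poles by convention). In all
  other cases the limit is just the value of the formula, for such \<open>\<rho>\<close>.\<close>

definition G :: "nat \<Rightarrow> real \<Rightarrow> nat \<Rightarrow> complex \<Rightarrow> nat \<Rightarrow> complex" where
  "G n lam \<epsilon> \<rho> \<delta> =
     Lim (at lam) (\<lambda>t. G_gamma n (of_nat (n + 1) / 2 + \<i> * of_real t) \<epsilon> \<rho> \<delta>)"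

end

theory Submission imports Defs begin

text \<open>Everything is expressed through homogeneous functions on punctured \<open>\<real>\<^sup>n\<^sup>+\<^sup>1\<close>. There, \<open>theta\<close> is the
  normalized transform \<open>U \<mapsto> \<integral> |\<langle>X, Y\<rangle>|\<^sup>\<alpha> U(X)\<close> over projective space, with \<open>\<alpha> = - (n + 1) / 2 + \<nu>\<close>. It is
  continued analytically by integration by parts, and it turns \<open>\<langle>a, X\<rangle> \<partial>\<^sub>b\<close> into \<open>- \<langle>b, Y\<rangle> \<partial>\<^sub>a\<close> if
  \<open>\<langle>a, b\<rangle> = 0\<close>. Differentiating the kernel \<open>p\<close> times shows that the operator with the additional
  symbol \<open>phi\<^sup>p\<close> is, up to the factor \<open>\<alpha> (\<alpha> - 1) \<dots> (\<alpha> - p + 1)\<close>, the operator \<open>\<langle>b, Y\<rangle>\<^sup>p \<partial>\<^sub>a\<^sup>p\<close> after \<open>theta\<close>. So both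
  calculi give a multiple of \<open>\<langle>a, X\<rangle>\<^sup>p \<partial>\<^sub>b\<^sup>p\<close>, and the quotient of the two constants is \<open>G\<close> by the
  functional equation of \<open>Gamma\<close>.

  The inversion formula needed for the standard calculus is obtained without Fourier analysis: the
  transform commutes with rotations, hence maps the zonal functions \<open>\<langle>v, X\<rangle>\<^sup>k |X|\<^sup>\<kappa>\<^sup>-\<^sup>k\<close> to explicit
  multiples of zonal functions. As it is symmetric and zonal functions separate points, by Laplace's
  method, this determines its composition with the transform of parameter \<open>- \<nu>\<close>.\<close>

text \<open>At \<open>z = 0\<close> the kernel has an exponent of real part - (n + 1) / 2, where the
  integral need not converge. So identities are proved for large \<open>Re z\<close>, as statements
  about absolutely convergent integrals, and carried over by the identity theorem. This is why the
  transform is first made entire by a reciprocal Gamma factor, and why the constant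
  \<open>Cnorm\<close> is split into that factor and one that is regular on the imaginary axis. The
  obstacle that shapes the middle of the proof is regularity in \<open>Y\<close>. The continued
  transform is itself transformed again and paired with other functions, so it has to be smooth in
  \<open>Y\<close> and bounded locally uniformly in \<open>z\<close>; but outside the region of
  convergence nothing can be differentiated under the integral sign. A quadratic bound for the first
  Taylor remainder is continued to the left instead. In the algebra, \<langle>a, b\<rangle> = 0
  makes the linear form of \<open>a\<close> constant along \<open>b\<close>. Therefore the powers of
  the first order operators collapse and no term of lower order survives the transform.\<close>

section \<open>Signed powers of a real variable\<close>

lemma spow_0 [simp]: "spow \<alpha> e 0 = 0"
  by (simp add: spow_def)

lemma spow_1 [simp]: "spow \<alpha> e 1 = 1"
  by (simp add: spow_def)

lemma norm_spow: "norm (spow \<alpha> e t) = \<bar>t\<bar> powr Re \<alpha>"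
  by (cases "t = 0") (auto simp: spow_def norm_mult norm_power norm_powr_real_powr abs_sgn_eq)

text \<open>True at 0 without side conditions, since \<open>0 powr \<alpha> = 0\<close> for every
  exponent, even 0; the same convention serves in \<open>norm_spow\<close> and
  \<open>spow_add\<close>.\<close>

lemma spow_mult: "spow \<alpha> e (r * t) = spow \<alpha> e r * spow \<alpha> e t"
  by (simp add: spow_def abs_mult sgn_mult powr_times_real power_mult_distrib)

lemma spow_add: "spow (\<alpha> + \<beta>) (e + f) t = spow \<alpha> e t * spow \<beta> f t"
  by (simp add: spow_def powr_add power_add)

lemma spow_Suc_Suc [simp]: "spow \<alpha> (Suc (Suc e)) t = spow \<alpha> e t"
  by (cases "t = 0") (auto simp: spow_def sgn_if)

lemma spow_parity: "even e = even f \<Longrightarrow> spow \<alpha> e t = spow \<alpha> f t"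
  by (cases "t = 0") (auto simp: spow_def sgn_if)

lemma spow_one: "spow 1 (Suc 0) t = of_real t"
  by (auto simp: spow_def sgn_if)

lemma spow_Suc_times: "spow (\<alpha> - 1) (Suc e) t * of_real t = spow \<alpha> e t"
  using spow_add[of "\<alpha> - 1" 1 "Suc e" "Suc 0" t] by (simp add: spow_one)

lemma spow_measurable [measurable]: "spow \<alpha> e \<in> borel_measurable borel"
proof -
  have "spow \<alpha> e t = (if t = 0 then 0 else exp (\<alpha> * of_real (ln \<bar>t\<bar>)) * of_real (sgn t) ^ e)" for t
    by (auto simp: spow_def powr_def Ln_of_real)
  then have *: "spow \<alpha> e = (\<lambda>t. if t = 0 then 0 else exp (\<alpha> * of_real (ln \<bar>t\<bar>)) * of_real (sgn t) ^ e)"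
    by blast
  show ?thesis unfolding * sgn_if by measurable
qed

text \<open>Near a nonzero \<open>t\<close> the sign is constant, and the signed power is a constant
  times an exponential of \<open>\<alpha> * ln \<bar>t\<bar>\<close>. The derivative of
  \<open>\<bar>t\<bar>\<close> contributes one more sign, hence the parity
  \<open>Suc e\<close>.\<close>

lemma spow_has_derivative_nonzero:
  assumes "t \<noteq> 0"
  shows "(spow \<alpha> e has_vector_derivative \<alpha> * spow (\<alpha> - 1) (Suc e) t) (at t)"
proof -
  define c :: complex where "c = of_real (sgn t) ^ e"
  have sg: "sgn s = sgn t" if "s * t > 0" for s
    using that by (auto simp: sgn_if zero_less_mult_iff)
  have D: "((\<lambda>s. exp (\<alpha> * of_real (ln (sgn t * s))) * c) has_vector_derivative
      \<alpha> * spow (\<alpha> - 1) (Suc e) t) (at t)"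
  proof -
    have "((\<lambda>s. ln (sgn t * s)) has_field_derivative sgn t / (sgn t * t)) (at t)"
      using assms by (auto intro!: derivative_eq_intros simp: sgn_if)
    then have "((\<lambda>s. complex_of_real (ln (sgn t * s))) has_vector_derivative
        of_real (sgn t / (sgn t * t))) (at t)"
      by (intro has_vector_derivative_of_real) (simp add: has_real_derivative_iff_has_vector_derivative)
    from has_vector_derivative_mult_right[OF this, of \<alpha>]
    have 2: "((\<lambda>s. \<alpha> * complex_of_real (ln (sgn t * s))) has_vector_derivative
        \<alpha> * of_real (sgn t / (sgn t * t))) (at t)" .
    have "((\<lambda>s. exp (\<alpha> * complex_of_real (ln (sgn t * s)))) has_vector_derivative
        \<alpha> * of_real (sgn t / (sgn t * t)) * exp (\<alpha> * of_real (ln (sgn t * t)))) (at t)"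
      using field_vector_diff_chain_at[OF 2 DERIV_exp] by (simp add: o_def)
    from has_vector_derivative_mult_left[OF this, of c]
    have 3: "((\<lambda>s. exp (\<alpha> * of_real (ln (sgn t * s))) * c) has_vector_derivative
        \<alpha> * of_real (sgn t / (sgn t * t)) * exp (\<alpha> * of_real (ln (sgn t * t))) * c) (at t)" .
    have "sgn t * t = \<bar>t\<bar>" by (simp add: abs_sgn mult.commute)
    then have "exp (\<alpha> * of_real (ln (sgn t * t))) * c = spow \<alpha> e t"
      using assms by (simp add: spow_def powr_def Ln_of_real c_def)
    also have "\<dots> = spow (\<alpha> - 1) (Suc e) t * of_real t"
      by (simp add: spow_Suc_times)
    finally have "\<alpha> * of_real (sgn t / (sgn t * t)) * exp (\<alpha> * of_real (ln (sgn t * t))) * c =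
        \<alpha> * spow (\<alpha> - 1) (Suc e) t"
      using assms by (auto simp: sgn_if field_simps split: if_splits)
    with 3 show ?thesis by (simp only:)
  qed
  have ev: "eventually (\<lambda>s. s * t > 0) (at t)"
  proof -
    have "((\<lambda>s. s * t) \<longlongrightarrow> t * t) (at t)" by (intro tendsto_intros)
    moreover have "t * t > 0" using assms by (auto simp: zero_less_mult_iff)
    ultimately show ?thesis by (rule order_tendstoD)
  qed
  have eq: "exp (\<alpha> * of_real (ln (sgn t * s))) * c = spow \<alpha> e s" if "s * t > 0" for s
  proof -
    have "\<bar>s\<bar> = sgn t * s" "s \<noteq> 0" using sg[OF that] that by (auto simp: abs_sgn mult.commute)
    then have "ln (sgn t * s) = ln \<bar>s\<bar>" by (simp only:)
    then show ?thesis using \<open>s \<noteq> 0\<close> assms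
      by (simp add: spow_def c_def powr_def Ln_of_real[of "\<bar>s\<bar>"] sg[OF that] mult.commute)
  qed
  show ?thesis
    by (rule has_vector_derivative_transform_within_open[OF D, of "{s. s * t > 0}"])
      (use assms eq in \<open>auto intro!: open_Collect_less continuous_intros simp: zero_less_mult_iff[of t t]\<close>)
qed

text \<open>Only \<open>t = 0\<close> is new: there the difference quotient has modulus
  \<open>\<bar>h\<bar> powr (Re \<alpha> - 1)\<close>, which tends to 0 because
  \<open>Re \<alpha> > 1\<close>.\<close>

lemma spow_has_derivative:
  assumes "Re \<alpha> > 1"
  shows "(spow \<alpha> e has_vector_derivative \<alpha> * spow (\<alpha> - 1) (Suc e) t) (at t)"
proof (cases "t = 0")
  case True
  have "((\<lambda>h. \<bar>h\<bar> powr (Re \<alpha> - 1)) \<longlongrightarrow> 0) (at (0::real))"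
    using assms by (auto intro!: tendsto_eq_intros)
  moreover have "norm (norm (spow \<alpha> e h) / norm h) \<le> \<bar>h\<bar> powr (Re \<alpha> - 1)" for h
    by (cases "h = 0") (auto simp: norm_spow powr_diff)
  ultimately have "((\<lambda>h. norm (spow \<alpha> e h) / norm h) \<longlongrightarrow> 0) (at 0)"
    by (intro Lim_null_comparison[of "\<lambda>h. norm (spow \<alpha> e h) / norm h"] always_eventually allI)
  then have "(spow \<alpha> e has_derivative (\<lambda>h. 0)) (at 0)"
    unfolding has_derivative_at by simp
  then show ?thesis
    using True by (simp add: has_vector_derivative_def)
next
  case False
  then show ?thesis by (rule spow_has_derivative_nonzero)
qed

lemma continuous_spow [continuous_intros]:
  assumes "Re \<alpha> > 0"
  shows "continuous_on S (spow \<alpha> e)"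
proof -
  have "isCont (spow \<alpha> e) t" for t
  proof (cases "t = 0")
    case True
    have "((\<lambda>h. \<bar>h\<bar> powr Re \<alpha>) \<longlongrightarrow> 0) (at (0::real))"
      using assms by (auto intro!: tendsto_eq_intros)
    then have "((\<lambda>h. spow \<alpha> e h) \<longlongrightarrow> 0) (at 0)"
      by (rule Lim_null_comparison[rotated]) (simp add: norm_spow)
    then show ?thesis using True by (simp add: isCont_def)
  next
    case False
    then show ?thesis
      using has_vector_derivative_continuous spow_has_derivative_nonzero by blast
  qed
  then show ?thesis by (simp add: continuous_at_imp_continuous_on)
qed

text \<open>The mean value inequality is applied twice along the segment from \<open>t\<close> to
  \<open>t + h\<close>. The majorant is explicit and homogeneous, so that it can be integrated over
  projective space in \<open>J_taylor\<close>.\<close>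

lemma spow_taylor:
  assumes "Re \<alpha> > 2"
  shows "norm (spow \<alpha> e (t + h) - spow \<alpha> e t - \<alpha> * spow (\<alpha> - 1) (Suc e) t * of_real h)
    \<le> norm \<alpha> * norm (\<alpha> - 1) * (\<bar>t\<bar> + \<bar>h\<bar>) powr (Re \<alpha> - 2) * h\<^sup>2"
proof -
  let ?S = "closed_segment t (t + h)"
  let ?M = "norm \<alpha> * norm (\<alpha> - 1) * (\<bar>t\<bar> + \<bar>h\<bar>) powr (Re \<alpha> - 2)"
  have seg: "\<bar>s\<bar> \<le> \<bar>t\<bar> + \<bar>h\<bar>" "\<bar>s - t\<bar> \<le> \<bar>h\<bar>" if "s \<in> ?S" for s
    using that by (auto simp: closed_segment_eq_real_ivl split: if_splits)
  have d2: "norm (spow (\<alpha> - 1) (Suc e) s - spow (\<alpha> - 1) (Suc e) t)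
      \<le> norm (\<alpha> - 1) * (\<bar>t\<bar> + \<bar>h\<bar>) powr (Re \<alpha> - 2) * \<bar>h\<bar>" if s: "s \<in> ?S" for s
  proof -
    have "norm (spow (\<alpha> - 1) (Suc e) s - spow (\<alpha> - 1) (Suc e) t)
      \<le> norm (\<alpha> - 1) * (\<bar>t\<bar> + \<bar>h\<bar>) powr (Re \<alpha> - 2) * norm (s - t)"
    proof (rule differentiable_bound[where S = ?S])
      fix x assume x: "x \<in> ?S"
      show "(spow (\<alpha> - 1) (Suc e) has_derivative
          (\<lambda>y. y *\<^sub>R ((\<alpha> - 1) * spow (\<alpha> - 1 - 1) (Suc (Suc e)) x))) (at x within ?S)"
        using spow_has_derivative[of "\<alpha> - 1" "Suc e" x] assms
        by (auto simp: has_vector_derivative_def intro: has_derivative_at_withinI)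
      show "onorm (\<lambda>y. y *\<^sub>R ((\<alpha> - 1) * spow (\<alpha> - 1 - 1) (Suc (Suc e)) x))
          \<le> norm (\<alpha> - 1) * (\<bar>t\<bar> + \<bar>h\<bar>) powr (Re \<alpha> - 2)"
      proof (rule onorm_le)
        fix y
        have "\<bar>x\<bar> powr (Re \<alpha> - 2) \<le> (\<bar>t\<bar> + \<bar>h\<bar>) powr (Re \<alpha> - 2)"
          using seg[OF x] assms by (intro powr_mono2) auto
        then show "norm (y *\<^sub>R ((\<alpha> - 1) * spow (\<alpha> - 1 - 1) (Suc (Suc e)) x))
          \<le> norm (\<alpha> - 1) * (\<bar>t\<bar> + \<bar>h\<bar>) powr (Re \<alpha> - 2) * norm y"
          by (simp add: norm_mult norm_spow mult_left_mono mult.commute)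
      qed
    qed (use s in auto)
    also have "\<dots> \<le> norm (\<alpha> - 1) * (\<bar>t\<bar> + \<bar>h\<bar>) powr (Re \<alpha> - 2) * \<bar>h\<bar>"
      using seg[OF s] by (intro mult_left_mono) auto
    finally show ?thesis .
  qed
  \<comment> \<open>With the linear part subtracted, the derivative of the function is
    \<open>\<alpha>\<close> times the increment bounded in \<open>d2\<close>.\<close>
  have "norm ((spow \<alpha> e (t + h) - \<alpha> * spow (\<alpha> - 1) (Suc e) t * of_real (t + h))
      - (spow \<alpha> e t - \<alpha> * spow (\<alpha> - 1) (Suc e) t * of_real t)) \<le> ?M * \<bar>h\<bar> * norm ((t + h) - t)"
  proof (rule differentiable_bound[where S = ?S and f = "\<lambda>s. spow \<alpha> e s - \<alpha> * spow (\<alpha> - 1) (Suc e) t * of_real s"])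
    fix x assume x: "x \<in> ?S"
    show "((\<lambda>s. spow \<alpha> e s - \<alpha> * spow (\<alpha> - 1) (Suc e) t * of_real s) has_derivative
        (\<lambda>y. y *\<^sub>R (\<alpha> * (spow (\<alpha> - 1) (Suc e) x - spow (\<alpha> - 1) (Suc e) t)))) (at x within ?S)"
    proof -
      have "((\<lambda>s. spow \<alpha> e s - \<alpha> * spow (\<alpha> - 1) (Suc e) t * of_real s) has_vector_derivative
        (\<alpha> * spow (\<alpha> - 1) (Suc e) x - \<alpha> * spow (\<alpha> - 1) (Suc e) t * of_real 1)) (at x within ?S)"
        using spow_has_derivative[of \<alpha> e x] assms
        by (intro derivative_intros has_vector_derivative_mult_right has_vector_derivative_of_real)
          (auto intro: has_vector_derivative_at_within)
      then show ?thesis by (simp add: has_vector_derivative_def algebra_simps)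
    qed
    show "onorm (\<lambda>y. y *\<^sub>R (\<alpha> * (spow (\<alpha> - 1) (Suc e) x - spow (\<alpha> - 1) (Suc e) t))) \<le> ?M * \<bar>h\<bar>"
    proof (rule onorm_le)
      fix y :: real
      have "\<bar>y\<bar> * (norm \<alpha> * norm (spow (\<alpha> - 1) (Suc e) x - spow (\<alpha> - 1) (Suc e) t))
        \<le> \<bar>y\<bar> * (norm \<alpha> * (norm (\<alpha> - 1) * (\<bar>t\<bar> + \<bar>h\<bar>) powr (Re \<alpha> - 2) * \<bar>h\<bar>))"
        using d2[OF x] by (intro mult_left_mono) auto
      then show "norm (y *\<^sub>R (\<alpha> * (spow (\<alpha> - 1) (Suc e) x - spow (\<alpha> - 1) (Suc e) t))) \<le> ?M * \<bar>h\<bar> * norm y"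
        by (simp add: norm_mult mult_ac)
    qed
  qed auto
  then have "norm (spow \<alpha> e (t + h) - spow \<alpha> e t - \<alpha> * spow (\<alpha> - 1) (Suc e) t * of_real h) \<le> ?M * \<bar>h\<bar> * \<bar>h\<bar>"
    by (simp add: algebra_simps)
  then show ?thesis by (simp only: mult.assoc abs_mult_self_eq power2_eq_square)
qed

section \<open>Homogeneous functions\<close>

text \<open>The origin is left out because homogeneous functions of negative degree are singular
  there. For the same reason the congruence rules below ignore the value at 0.\<close>

definition smooth_off0 :: "('a::euclidean_space \<Rightarrow> complex) \<Rightarrow> bool" where
  "smooth_off0 V \<longleftrightarrow> (\<forall>k. Ck_on k V (- {0}))"

text \<open>The direction precedes the point, so that \<open>ddir V b\<close> is a function of the
  point and can be differentiated again.\<close>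

definition ddir :: "('a::real_normed_vector \<Rightarrow> 'b::real_normed_vector) \<Rightarrow> 'a \<Rightarrow> 'a \<Rightarrow> 'b" where
  "ddir V b X = frechet_derivative V (at X) b"

lemma frechet_derivative_cong_open:
  assumes "open S" "x \<in> S" "\<And>y. y \<in> S \<Longrightarrow> f y = g y"
  shows "frechet_derivative f (at x) = frechet_derivative g (at x)"
proof -
  have "(f has_derivative D) (at x) \<longleftrightarrow> (g has_derivative D) (at x)" for D
    using assms by (auto intro: has_derivative_transform_within_open)
  then show ?thesis by (simp add: frechet_derivative_def)
qed

text \<open>Derivatives in \<open>Ck_on\<close> are taken at points and not within the set; openness
  of \<open>S\<close> makes them depend only on the values on \<open>S\<close>.\<close>

lemma Ck_on_cong:
  assumes "open S" "\<And>x. x \<in> S \<Longrightarrow> f x = g x" "Ck_on k f S"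
  shows "Ck_on k g S"
  using assms(2,3)
proof (induction k arbitrary: f g)
  case 0
  then show ?case using continuous_on_cong[of S S f g] by auto
next
  case (Suc k)
  have "g differentiable (at x)" if "x \<in> S" for x
  proof -
    obtain D where "(f has_derivative D) (at x)"
      using Suc.prems(2) \<open>x \<in> S\<close> unfolding differentiable_def Ck_on.simps by blast
    then have "(g has_derivative D) (at x)"
      by (rule has_derivative_transform_within_open[OF _ assms(1) \<open>x \<in> S\<close>]) (rule Suc.prems(1))
    then show ?thesis unfolding differentiable_def by blast
  qed
  moreover have "Ck_on k (\<lambda>x. frechet_derivative g (at x) v) S" for v
  proof (rule Suc.IH[of "\<lambda>x. frechet_derivative f (at x) v"])
    show "frechet_derivative f (at x) v = frechet_derivative g (at x) v" if "x \<in> S" for x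
      by (rule fun_cong[OF frechet_derivative_cong_open[OF assms(1) that]]) (rule Suc.prems(1))
  qed (use Suc.prems(2) in simp)
  ultimately show ?case by auto
qed

lemma Ck_on_Suc_imp: "Ck_on (Suc k) f S \<Longrightarrow> Ck_on k f S"
proof (induction k arbitrary: f)
  case 0
  then show ?case
    by (auto intro!: continuous_at_imp_continuous_on differentiable_imp_continuous_within)
next
  case (Suc k)
  then show ?case by (metis Ck_on.simps(2))
qed

lemma Ck_on_add:
  assumes "open S" "Ck_on k f S" "Ck_on k g S"
  shows "Ck_on k (\<lambda>x. f x + g x) S"
  using assms(2,3)
proof (induction k arbitrary: f g)
  case 0
  then show ?case by (auto intro: continuous_intros)
next
  case (Suc k)
  have "Ck_on k (\<lambda>x. frechet_derivative (\<lambda>x. f x + g x) (at x) v) S" for v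
  proof (rule Ck_on_cong[OF assms(1)])
    show "Ck_on k (\<lambda>x. frechet_derivative f (at x) v + frechet_derivative g (at x) v) S"
      using Suc by auto
    show "frechet_derivative f (at x) v + frechet_derivative g (at x) v =
        frechet_derivative (\<lambda>x. f x + g x) (at x) v" if "x \<in> S" for x
    proof -
      have "(f has_derivative frechet_derivative f (at x)) (at x)" "(g has_derivative frechet_derivative g (at x)) (at x)"
        using that Suc.prems by (auto simp flip: frechet_derivative_works)
      from fun_cong[OF frechet_derivative_at[OF has_derivative_add[OF this]], of v] show ?thesis by simp
    qed
  qed
  then show ?case using Suc.prems by auto
qed

lemma Ck_on_mult:
  fixes f g :: "'a::real_normed_vector \<Rightarrow> complex"
  assumes "open S" "Ck_on k f S" "Ck_on k g S"
  shows "Ck_on k (\<lambda>x. f x * g x) S"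
  using assms(2,3)
proof (induction k arbitrary: f g)
  case 0
  then show ?case by (auto intro: continuous_intros)
next
  case (Suc k)
  have "Ck_on k (\<lambda>x. frechet_derivative (\<lambda>x. f x * g x) (at x) v) S" for v
  proof (rule Ck_on_cong[OF assms(1)])
    show "Ck_on k (\<lambda>x. f x * frechet_derivative g (at x) v + frechet_derivative f (at x) v * g x) S"
      using Suc Ck_on_Suc_imp[of k f S] Ck_on_Suc_imp[of k g S]
      by (intro Ck_on_add[OF assms(1)] Suc.IH) auto
    show "f x * frechet_derivative g (at x) v + frechet_derivative f (at x) v * g x =
        frechet_derivative (\<lambda>x. f x * g x) (at x) v" if "x \<in> S" for x
    proof -
      have "(f has_derivative frechet_derivative f (at x)) (at x)" "(g has_derivative frechet_derivative g (at x)) (at x)"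
        using that Suc.prems by (auto simp flip: frechet_derivative_works)
      from fun_cong[OF frechet_derivative_at[OF has_derivative_mult[OF this]], of v] show ?thesis by simp
    qed
  qed
  then show ?case using Suc.prems by (auto intro: differentiable_mult)
qed

lemma Ck_on_const: "Ck_on k (\<lambda>x. c) S"
  by (induction k arbitrary: c) (auto simp: frechet_derivative_const)

lemma Ck_on_bounded_linear:
  assumes "bounded_linear f"
  shows "Ck_on k f S"
proof (cases k)
  case 0
  then show ?thesis using assms by (simp add: linear_continuous_on)
next
  case (Suc l)
  have "(f has_derivative f) (at x)" for x
    by (rule bounded_linear_imp_has_derivative[OF assms])
  then have "frechet_derivative f (at x) = f" for x
    by (metis frechet_derivative_at)
  then show ?thesis
    using Suc bounded_linear_imp_differentiable[OF assms] by (auto intro: Ck_on_const)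
qed

lemma smooth_off0_cong: "smooth_off0 f \<Longrightarrow> (\<And>X. X \<noteq> 0 \<Longrightarrow> f X = g X) \<Longrightarrow> smooth_off0 g"
  unfolding smooth_off0_def using Ck_on_cong[of "- {0}" f g] by auto

lemma smooth_off0_add: "smooth_off0 f \<Longrightarrow> smooth_off0 g \<Longrightarrow> smooth_off0 (\<lambda>X. f X + g X)"
  unfolding smooth_off0_def by (auto intro: Ck_on_add)

lemma smooth_off0_mult: "smooth_off0 f \<Longrightarrow> smooth_off0 g \<Longrightarrow> smooth_off0 (\<lambda>X. f X * g X)"
  unfolding smooth_off0_def by (auto intro: Ck_on_mult)

lemma smooth_off0_const: "smooth_off0 (\<lambda>X. c)"
  unfolding smooth_off0_def by (auto intro: Ck_on_const)

lemma smooth_off0_cmult: "smooth_off0 f \<Longrightarrow> smooth_off0 (\<lambda>X. c * f X)"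
  by (intro smooth_off0_mult smooth_off0_const)

lemma smooth_off0_power: "smooth_off0 f \<Longrightarrow> smooth_off0 (\<lambda>X. f X ^ k)"
  by (induction k) (auto intro: smooth_off0_const smooth_off0_mult)

lemma smooth_off0_inner: "smooth_off0 (\<lambda>X. of_real (b \<bullet> X))"
  unfolding smooth_off0_def
  by (auto intro!: Ck_on_bounded_linear bounded_linear_compose[OF bounded_linear_of_real] bounded_linear_inner_right)

lemma smooth_off0_differentiable: "smooth_off0 V \<Longrightarrow> X \<noteq> 0 \<Longrightarrow> V differentiable (at X)"
  unfolding smooth_off0_def using Ck_on.simps(2)[of 0 V "- {0}"] by blast

lemma smooth_off0_has_derivative:
  "smooth_off0 V \<Longrightarrow> X \<noteq> 0 \<Longrightarrow> (V has_derivative (\<lambda>b. ddir V b X)) (at X)"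
  unfolding ddir_def using smooth_off0_differentiable frechet_derivative_works by fastforce

lemma smooth_off0_ddir: "smooth_off0 V \<Longrightarrow> smooth_off0 (ddir V b)"
  unfolding smooth_off0_def ddir_def[abs_def] using Ck_on.simps(2)[of _ V "- {0}"] by blast

lemma smooth_off0_continuous: "smooth_off0 V \<Longrightarrow> continuous_on (- {0}) V"
  unfolding smooth_off0_def using Ck_on.simps(1) by blast

lemma ddir_eqI: "(V has_derivative D) (at X) \<Longrightarrow> ddir V b X = D b"
  unfolding ddir_def using frechet_derivative_at by metis

lemma ddir_cong: "(\<And>X. X \<noteq> 0 \<Longrightarrow> V X = W X) \<Longrightarrow> X \<noteq> 0 \<Longrightarrow> ddir V b X = ddir W b X"
  unfolding ddir_def by (rule fun_cong[OF frechet_derivative_cong_open[of "- {0}"]]) (auto simp: open_Compl)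

lemma ddir_mult:
  fixes V W :: "'a::euclidean_space \<Rightarrow> complex"
  assumes "smooth_off0 V" "smooth_off0 W" "X \<noteq> 0"
  shows "ddir (\<lambda>X. V X * W X) b X = V X * ddir W b X + ddir V b X * W X"
  by (rule ddir_eqI[OF has_derivative_mult[OF smooth_off0_has_derivative[OF assms(1,3)] smooth_off0_has_derivative[OF assms(2,3)]]])

lemma ddir_add:
  assumes "smooth_off0 V" "smooth_off0 W" "X \<noteq> 0"
  shows "ddir (\<lambda>X. V X + W X) b X = ddir V b X + ddir W b X"
  by (rule ddir_eqI[OF has_derivative_add[OF smooth_off0_has_derivative[OF assms(1,3)] smooth_off0_has_derivative[OF assms(2,3)]]])

lemma ddir_const: "ddir (\<lambda>X. c) b X = 0"
  by (rule ddir_eqI) (rule has_derivative_const)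

lemma ddir_cmult:
  assumes "smooth_off0 V" "X \<noteq> 0"
  shows "ddir (\<lambda>X. c * V X) b X = c * ddir V b X"
  using ddir_mult[OF smooth_off0_const assms] by (simp add: ddir_const)

lemma ddir_inner: "ddir (\<lambda>X. of_real (a \<bullet> X) :: complex) b X = of_real (a \<bullet> b)"
  by (rule ddir_eqI) (auto intro!: derivative_eq_intros)

lemma ddir_scale_arg:
  assumes "smooth_off0 V" "X \<noteq> 0"
  shows "ddir V (r *\<^sub>R b) X = of_real r * ddir V b X" "ddir V (b + c) X = ddir V b X + ddir V c X"
proof -
  have L: "linear (\<lambda>b. ddir V b X)"
    using smooth_off0_has_derivative[OF assms] has_derivative_linear by blast
  show "ddir V (r *\<^sub>R b) X = of_real r * ddir V b X" "ddir V (b + c) X = ddir V b X + ddir V c X"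
    using linear_cmul[OF L] linear_add[OF L] by (auto simp: scaleR_conv_of_real)
qed

section \<open>Complex powers of the norm\<close>

definition npow :: "complex \<Rightarrow> 'a::real_normed_vector \<Rightarrow> complex" where
  "npow s X = of_real (norm X) powr s"

lemma npow_add: "npow (s + t) X = npow s X * npow t X"
  by (simp add: npow_def powr_add)

lemma norm_npow: "norm (npow s X) = norm X powr Re s"
  by (cases "X = 0") (auto simp: npow_def norm_powr_real_powr)

lemma npow_0: "X \<noteq> 0 \<Longrightarrow> npow 0 X = 1"
  by (simp add: npow_def)

lemma npow_of_nat: "X \<noteq> 0 \<Longrightarrow> npow (of_nat k) X = of_real (norm X) ^ k"
  by (simp add: npow_def powr_complexpow)

lemma npow_2: "X \<noteq> 0 \<Longrightarrow> npow 2 X = of_real (X \<bullet> X)"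
  using npow_of_nat[of X 2] by (simp add: power2_norm_eq_inner flip: of_real_power)

text \<open>The power is written as \<open>exp (s * ln (X \<bullet> X) / 2)\<close>: the inner
  product is differentiable at every point, and the logarithm of a positive real raises no question
  of branches.\<close>

lemma npow_has_derivative:
  fixes X :: "'a::euclidean_space"
  assumes "X \<noteq> 0"
  shows "(npow s has_derivative (\<lambda>H. s * of_real (H \<bullet> X) * npow (s - 2) X)) (at X)"
proof -
  have 1: "((\<lambda>X. ln (X \<bullet> X) / 2) has_derivative (\<lambda>H. (H \<bullet> X) / (X \<bullet> X))) (at X)"
    using assms by (auto intro!: derivative_eq_intros simp: inner_commute field_simps)
  have 2: "((\<lambda>X. s * complex_of_real (ln (X \<bullet> X) / 2)) has_derivative (\<lambda>H. s * of_real ((H \<bullet> X) / (X \<bullet> X)))) (at X)"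
    by (intro derivative_intros 1)
  have 3: "((\<lambda>X. exp (s * complex_of_real (ln (X \<bullet> X) / 2))) has_derivative
     (\<lambda>H. exp (s * complex_of_real (ln (X \<bullet> X) / 2)) * (s * of_real ((H \<bullet> X) / (X \<bullet> X))))) (at X)"
    by (rule has_derivative_compose[OF 2 DERIV_exp[unfolded has_field_derivative_def]])
  have eq: "exp (s * complex_of_real (ln (Y \<bullet> Y) / 2)) = npow s Y" if "Y \<noteq> 0" for Y :: 'a and s
  proof -
    have "ln (Y \<bullet> Y) / 2 = ln (norm Y)"
      using that ln_realpow[of "norm Y" 2] by (simp add: power2_norm_eq_inner)
    then show ?thesis using that by (simp add: npow_def powr_def Ln_of_real)
  qed
  have 4: "npow s X / of_real (X \<bullet> X) = npow (s - 2) X"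
    using npow_add[of "s - 2" 2 X] npow_2[OF assms] assms by simp
  show ?thesis
  proof (rule has_derivative_transform_within_open[of _ _ _ _ "- {0}"])
    show "((\<lambda>X. exp (s * complex_of_real (ln (X \<bullet> X) / 2))) has_derivative
       (\<lambda>H. s * of_real (H \<bullet> X) * npow (s - 2) X)) (at X)"
      using 3 unfolding eq[OF assms] 4[symmetric] by (simp add: mult_ac)
  qed (use assms eq in auto)
qed

lemma ddir_npow: fixes X :: "'a::euclidean_space" shows "X \<noteq> 0 \<Longrightarrow> ddir (npow s) b X = s * of_real (b \<bullet> X) * npow (s - 2) X"
  using ddir_eqI[OF npow_has_derivative[of X s], of b] by simp

lemma smooth_off0_npow: "smooth_off0 (npow s :: 'a::euclidean_space \<Rightarrow> complex)"
proof -
  have "Ck_on k (npow s :: 'a \<Rightarrow> complex) (- {0})" for k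
  proof (induction k arbitrary: s)
    case 0
    show ?case
      by (auto intro!: continuous_at_imp_continuous_on has_derivative_continuous[OF npow_has_derivative])
  next
    case (Suc k)
    have "Ck_on k (\<lambda>X::'a. frechet_derivative (npow s) (at X) b) (- {0})" for b
    proof (rule Ck_on_cong)
      show "Ck_on k (\<lambda>X::'a. (s * of_real (b \<bullet> X)) * npow (s - 2) X) (- {0})"
      proof (rule Ck_on_mult)
        show "Ck_on k (\<lambda>X::'a. s * of_real (b \<bullet> X)) (- {0})"
          using smooth_off0_cmult[OF smooth_off0_inner, of s b] by (simp add: smooth_off0_def)
      qed (use Suc in auto)
    qed (auto simp: ddir_npow simp flip: ddir_def)
    then show ?case using npow_has_derivative by (auto simp: differentiable_def)
  qed
  then show ?thesis by (simp add: smooth_off0_def)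
qed

section \<open>Homogeneity with parity\<close>

text \<open>Negative factors are included, so that \<open>hom\<close> describes sections of a line
  bundle over real projective space; \<open>e\<close> matters only mod 2
  (\<open>hom_parity\<close>).\<close>

definition hom :: "complex \<Rightarrow> nat \<Rightarrow> ('a::euclidean_space \<Rightarrow> complex) \<Rightarrow> bool" where
  "hom \<kappa> e V \<longleftrightarrow> (\<forall>r X. r \<noteq> 0 \<longrightarrow> X \<noteq> 0 \<longrightarrow> V (r *\<^sub>R X) = spow \<kappa> e r * V X)"

lemma homD: "hom \<kappa> e V \<Longrightarrow> r \<noteq> 0 \<Longrightarrow> X \<noteq> 0 \<Longrightarrow> V (r *\<^sub>R X) = spow \<kappa> e r * V X"
  by (simp add: hom_def)

lemma hom_add: "hom \<kappa> e V \<Longrightarrow> hom \<kappa> e W \<Longrightarrow> hom \<kappa> e (\<lambda>X. V X + W X)"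
  by (simp add: hom_def algebra_simps)

lemma hom_mult: "hom \<kappa> e V \<Longrightarrow> hom \<kappa>' e' W \<Longrightarrow> hom (\<kappa> + \<kappa>') (e + e') (\<lambda>X. V X * W X)"
  by (simp add: hom_def spow_add)

lemma hom_cmult: "hom \<kappa> e V \<Longrightarrow> hom \<kappa> e (\<lambda>X. c * V X)"
  by (simp add: hom_def)

lemma hom_cong: "hom \<kappa> e V \<Longrightarrow> (\<And>X. X \<noteq> 0 \<Longrightarrow> V X = W X) \<Longrightarrow> hom \<kappa> e W"
  by (simp add: hom_def)

lemma hom_parity: "hom \<kappa> e V \<Longrightarrow> even e = even f \<Longrightarrow> hom \<kappa> f V"
  unfolding hom_def using spow_parity[of e f] by metis

lemma hom_inner: "hom 1 (Suc 0) (\<lambda>X. of_real (b \<bullet> X))"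
  by (simp add: hom_def spow_one)

lemma hom_npow: "hom s 0 (npow s)"
  by (simp add: hom_def npow_def spow_def powr_times_real)

text \<open>The scaling law is differentiated in \<open>X\<close>. The factor \<open>r\<close> from
  the chain rule is divided off by \<open>spow_Suc_times\<close>, which lowers the degree and
  changes the parity.\<close>

lemma hom_ddir:
  assumes "smooth_off0 V" "hom \<kappa> e V"
  shows "hom (\<kappa> - 1) (Suc e) (ddir V b)"
  unfolding hom_def
proof (intro allI impI)
  fix r :: real and X :: 'a assume r: "r \<noteq> 0" and X: "X \<noteq> 0"
  have D: "((\<lambda>X. V (r *\<^sub>R X)) has_derivative (\<lambda>b. ddir V (r *\<^sub>R b) (r *\<^sub>R X))) (at X)"
  proof -
    have 1: "((\<lambda>X. r *\<^sub>R X) has_derivative (\<lambda>b. r *\<^sub>R b)) (at X)"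
      by (auto intro!: derivative_eq_intros)
    have 2: "(V has_derivative (\<lambda>b. ddir V b (r *\<^sub>R X))) (at (r *\<^sub>R X))"
      using r X by (intro smooth_off0_has_derivative assms) auto
    show ?thesis by (rule has_derivative_compose[OF 1 2])
  qed
  have "ddir V (r *\<^sub>R b) (r *\<^sub>R X) = ddir (\<lambda>X. V (r *\<^sub>R X)) b X"
    by (rule ddir_eqI[OF D, symmetric])
  also have "\<dots> = ddir (\<lambda>X. spow \<kappa> e r * V X) b X"
    using assms(2) r X by (intro ddir_cong) (auto simp: hom_def)
  also have "\<dots> = spow \<kappa> e r * ddir V b X"
    by (rule ddir_cmult[OF assms(1) X])
  finally have "of_real r * ddir V b (r *\<^sub>R X) = spow (\<kappa> - 1) (Suc e) r * of_real r * ddir V b X"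
    using r X ddir_scale_arg(1)[OF assms(1)] by (simp add: spow_Suc_times)
  then show "ddir V b (r *\<^sub>R X) = spow (\<kappa> - 1) (Suc e) r * ddir V b X"
    using r by simp
qed

lemma hom_Euler:
  assumes "smooth_off0 V" "hom \<kappa> e V" "X \<noteq> 0"
  shows "ddir V X X = \<kappa> * V X"
proof -
  have "((\<lambda>r. V (r *\<^sub>R X)) has_derivative (\<lambda>h. ddir V (h *\<^sub>R X) (1 *\<^sub>R X))) (at (1::real))"
  proof -
    have 1: "((\<lambda>r. r *\<^sub>R X) has_derivative (\<lambda>h. h *\<^sub>R X)) (at (1::real))"
      by (auto intro!: derivative_eq_intros)
    have 2: "(V has_derivative (\<lambda>b. ddir V b (1 *\<^sub>R X))) (at (1 *\<^sub>R X))"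
      using assms by (auto intro: smooth_off0_has_derivative)
    show ?thesis by (rule has_derivative_compose[OF 1 2])
  qed
  moreover have "((\<lambda>r. V (r *\<^sub>R X)) has_derivative (\<lambda>h. h *\<^sub>R (\<kappa> * V X))) (at (1::real))"
  proof (rule has_derivative_transform_within_open[of _ _ _ _ "- {0}"])
    have "((\<lambda>r. spow \<kappa> e r * V X) has_vector_derivative (\<kappa> * spow (\<kappa> - 1) (Suc e) 1) * V X) (at 1)"
      by (intro has_vector_derivative_mult_left spow_has_derivative_nonzero) auto
    then show "((\<lambda>r. spow \<kappa> e r * V X) has_derivative (\<lambda>h. h *\<^sub>R (\<kappa> * V X))) (at 1)"
      by (simp add: has_vector_derivative_def)
  qed (use assms in \<open>auto simp: hom_def\<close>)
  ultimately have "ddir V (1 *\<^sub>R X) (1 *\<^sub>R X) = 1 *\<^sub>R (\<kappa> * V X)"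
    using has_derivative_unique by (metis (no_types, lifting))
  then show ?thesis by simp
qed

text \<open>The unit sphere is compact, and scaling carries the bound there to all of punctured
  space.\<close>

lemma hom_bound:
  fixes V :: "'a::euclidean_space \<Rightarrow> complex"
  assumes "continuous_on (- {0}) V" "hom \<kappa> e V"
  shows "\<exists>M\<ge>0. \<forall>X. X \<noteq> 0 \<longrightarrow> norm (V X) \<le> M * norm X powr Re \<kappa>"
proof -
  have "compact (V ` sphere 0 1)"
    by (intro compact_continuous_image continuous_on_subset[OF assms(1)]) auto
  then have "bounded (V ` sphere 0 1)" by (rule compact_imp_bounded)
  then obtain M where "\<forall>X\<in>sphere 0 1. norm (V X) \<le> M"
    unfolding bounded_iff by blast
  then have M: "\<And>X. norm X = 1 \<Longrightarrow> norm (V X) \<le> M" by simp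
  obtain b :: 'a where "b \<in> Basis" using nonempty_Basis by blast
  then have "norm b = 1" by simp
  then have M0: "M \<ge> 0" using M norm_ge_zero order_trans by blast
  have "norm (V X) \<le> M * norm X powr Re \<kappa>" if "X \<noteq> 0" for X
  proof -
    have "V X = spow \<kappa> e (norm X) * V ((1 / norm X) *\<^sub>R X)"
      using homD[OF assms(2), of "norm X" "(1 / norm X) *\<^sub>R X"] that by simp
    then show ?thesis using M[of "(1 / norm X) *\<^sub>R X"] that
      by (simp add: norm_mult norm_spow mult.commute mult_right_mono)
  qed
  then show ?thesis using M0 by blast
qed

text \<open>The families \<open>V z X\<close>, entire in \<open>z\<close>, of smooth homogeneous functions of degree \<open>\<kappa> - z\<close>;
  unlike the functions \<open>|X| powr (- z) * V X\<close> alone, they are stable under differentiation.\<close>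

inductive fam :: "complex \<Rightarrow> nat \<Rightarrow> (complex \<Rightarrow> 'a::euclidean_space \<Rightarrow> complex) \<Rightarrow> bool" for \<kappa> e where
  fam_base: "smooth_off0 V \<Longrightarrow> hom \<kappa> e V \<Longrightarrow> fam \<kappa> e (\<lambda>z X. npow (- z) X * V X)"
| fam_add: "fam \<kappa> e V \<Longrightarrow> fam \<kappa> e W \<Longrightarrow> fam \<kappa> e (\<lambda>z X. V z X + W z X)"
| fam_mult: "fam \<kappa> e V \<Longrightarrow> g holomorphic_on UNIV \<Longrightarrow> fam \<kappa> e (\<lambda>z X. g z * V z X)"
| fam_cong: "fam \<kappa> e V \<Longrightarrow> (\<And>z X. X \<noteq> 0 \<Longrightarrow> V z X = W z X) \<Longrightarrow> fam \<kappa> e W"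

lemma fam_cmult: "fam \<kappa> e V \<Longrightarrow> fam \<kappa> e (\<lambda>z X. c * V z X)"
  by (rule fam_mult) auto

lemma fam_parity: "fam \<kappa> e V \<Longrightarrow> even e = even f \<Longrightarrow> fam \<kappa> f V"
  by (induction rule: fam.induct) (auto intro: fam.intros hom_parity)

lemma fam_smooth: "fam \<kappa> e V \<Longrightarrow> smooth_off0 (V z)"
proof (induction rule: fam.induct)
  case (fam_cong V W)
  then show ?case using smooth_off0_cong by blast
qed (auto intro: smooth_off0_mult smooth_off0_npow smooth_off0_add smooth_off0_cmult)

lemma fam_hom: "fam \<kappa> e V \<Longrightarrow> hom (\<kappa> - z) e (V z)"
proof (induction rule: fam.induct)
  case (fam_base V)
  then show ?case using hom_mult[OF hom_npow[of "- z"] fam_base(2)] by simp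
next
  case (fam_cong V W)
  then show ?case using hom_cong by blast
qed (auto intro: hom_add hom_cmult)

lemma fam_holomorphic: "fam \<kappa> e V \<Longrightarrow> X \<noteq> 0 \<Longrightarrow> (\<lambda>z. V z X) holomorphic_on UNIV"
proof (induction rule: fam.induct)
  case (fam_base V)
  then show ?case by (auto simp: npow_def intro!: holomorphic_intros)
next
  case (fam_cong V W)
  then have "(\<lambda>z. V z X) = (\<lambda>z. W z X)" by auto
  then show ?case using fam_cong by simp
qed (auto intro!: holomorphic_intros)

text \<open>The bound is uniform in \<open>z\<close> on compact sets; this provides the integrable
  majorants that holomorphic dependence on \<open>z\<close> requires.\<close>

lemma fam_bound:
  assumes "fam \<kappa> e V" "compact K"
  shows "\<exists>M\<ge>0. \<forall>z\<in>K. \<forall>X. X \<noteq> 0 \<longrightarrow> norm (V z X) \<le> M * norm X powr Re (\<kappa> - z)"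
  using assms(1)
proof (induction rule: fam.induct)
  case (fam_base V)
  obtain M where M: "M \<ge> 0" "\<And>X. X \<noteq> 0 \<Longrightarrow> norm (V X) \<le> M * norm X powr Re \<kappa>"
    using hom_bound[OF smooth_off0_continuous] fam_base by blast
  have "norm (npow (- z) X * V X) \<le> M * norm X powr Re (\<kappa> - z)" if "X \<noteq> 0" for z X
    using mult_left_mono[OF M(2)[OF that], of "norm X powr (- Re z)"]
    by (simp add: norm_mult norm_npow powr_diff powr_minus field_simps)
  then show ?case using M(1) by blast
next
  case (fam_add V W)
  then obtain M N where "M \<ge> 0" "\<forall>z\<in>K. \<forall>X. X \<noteq> 0 \<longrightarrow> norm (V z X) \<le> M * norm X powr Re (\<kappa> - z)"
    "N \<ge> 0" "\<forall>z\<in>K. \<forall>X. X \<noteq> 0 \<longrightarrow> norm (W z X) \<le> N * norm X powr Re (\<kappa> - z)" by blast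
  then have "norm (V z X + W z X) \<le> (M + N) * norm X powr Re (\<kappa> - z)" if "z \<in> K" "X \<noteq> 0" for z X
    using that by (metis (no_types, lifting) norm_triangle_le add_mono ring_distribs(2))
  then show ?case using \<open>M \<ge> 0\<close> \<open>N \<ge> 0\<close> by (intro exI[of _ "M + N"]) auto
next
  case (fam_mult V g)
  then obtain M where M: "M \<ge> 0" "\<And>z X. z\<in>K \<Longrightarrow> X \<noteq> 0 \<Longrightarrow> norm (V z X) \<le> M * norm X powr Re (\<kappa> - z)"
    by blast
  have "compact (g ` K)"
    using fam_mult(2) assms(2) by (intro compact_continuous_image holomorphic_on_imp_continuous_on holomorphic_on_subset[OF fam_mult(2)]) auto
  then have "bounded (g ` K)" by (rule compact_imp_bounded)
  then obtain N where N: "\<And>z. z \<in> K \<Longrightarrow> norm (g z) \<le> N"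
    unfolding bounded_iff by blast
  have "norm (g z * V z X) \<le> (\<bar>N\<bar> * M) * norm X powr Re (\<kappa> - z)" if "z \<in> K" "X \<noteq> 0" for z X
    using mult_mono[OF order_trans[OF N abs_ge_self] M(2), of z z X] that M(1)
    by (simp add: norm_mult mult.assoc)
  then show ?case using M(1) by (intro exI[of _ "\<bar>N\<bar> * M"]) auto
next
  case (fam_cong V W)
  then show ?case by auto
qed

lemma fam_ddir: "fam \<kappa> e V \<Longrightarrow> fam (\<kappa> - 1) (Suc e) (\<lambda>z. ddir (V z) b)"
proof (induction rule: fam.induct)
  case (fam_base V)
  let ?W = "\<lambda>X. of_real (b \<bullet> X) * (npow (- 2) X * V X)"
  have W: "smooth_off0 ?W"
    by (intro smooth_off0_mult smooth_off0_inner smooth_off0_npow fam_base)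
  have Wh: "hom (\<kappa> - 1) (Suc e) ?W"
    using hom_mult[OF hom_inner[of b] hom_mult[OF hom_npow[of "- 2"] fam_base(2)]] by simp
  have f: "fam (\<kappa> - 1) (Suc e) (\<lambda>z X. npow (- z) X * ddir V b X + (- z) * (npow (- z) X * ?W X))"
    by (intro fam_add fam_mult fam.fam_base W Wh smooth_off0_ddir hom_ddir fam_base holomorphic_intros)
  show ?case
  proof (rule fam_cong[OF f])
    fix z :: complex and X :: 'a assume X: "X \<noteq> 0"
    show "npow (- z) X * ddir V b X + (- z) * (npow (- z) X * ?W X) = ddir (\<lambda>X. npow (- z) X * V X) b X"
      using ddir_mult[OF smooth_off0_npow fam_base(1) X] npow_add[of "- z" "- 2" X]
      by (simp add: ddir_npow[OF X])
  qed
next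
  case (fam_add V W)
  show ?case
    using ddir_add[OF fam_smooth[OF fam_add(1)] fam_smooth[OF fam_add(2)]]
    by (intro fam_cong[OF fam.fam_add[OF fam_add.IH]]) auto
next
  case (fam_mult V g)
  show ?case
    using ddir_cmult[OF fam_smooth[OF fam_mult(1)]]
    by (intro fam_cong[OF fam.fam_mult[OF fam_mult.IH fam_mult(2)]]) auto
next
  case (fam_cong V W)
  show ?case
    using ddir_cong[of "V _" "W _"] fam_cong(2) by (intro fam.fam_cong[OF fam_cong.IH]) blast
qed

lemma fam_inner: "fam \<kappa> e V \<Longrightarrow> fam (\<kappa> + 1) (Suc e) (\<lambda>z X. of_real (b \<bullet> X) * V z X)"
proof (induction rule: fam.induct)
  case (fam_base V)
  have "hom (\<kappa> + 1) (Suc e) (\<lambda>X. of_real (b \<bullet> X) * V X)"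
    using hom_mult[OF hom_inner[of b] fam_base(2)] by (simp add: add.commute)
  then have "fam (\<kappa> + 1) (Suc e) (\<lambda>z X. npow (- z) X * (of_real (b \<bullet> X) * V X))"
    by (intro fam.fam_base smooth_off0_mult smooth_off0_inner fam_base)
  then show ?case by (rule fam_cong) simp
next
  case (fam_add V W)
  show ?case by (rule fam_cong[OF fam.fam_add[OF fam_add.IH]]) (simp add: algebra_simps)
next
  case (fam_mult V g)
  show ?case by (rule fam_cong[OF fam.fam_mult[OF fam_mult.IH fam_mult(2)]]) simp
next
  case (fam_cong V W)
  show ?case by (rule fam.fam_cong[OF fam_cong.IH]) (simp add: fam_cong(2))
qed

section \<open>Integration over projective space\<close>

lemma nn_integral_scale:
  fixes f :: "'a::euclidean_space \<Rightarrow> ennreal"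
  assumes [measurable]: "f \<in> borel_measurable borel" and c: "c \<noteq> 0"
  shows "(\<integral>\<^sup>+x. f x \<partial>lborel) = ennreal (\<bar>c\<bar> ^ DIM('a)) * (\<integral>\<^sup>+x. f (c *\<^sub>R x) \<partial>lborel)"
  by (subst lborel_affine[OF c, of 0]) (simp add: nn_integral_density nn_integral_distr nn_integral_cmult)

text \<open>The slice at height \<open>t\<close> is rescaled by \<open>t\<close>, which gives the
  Jacobian \<open>\<bar>t\<bar> ^ n\<close>; the hyperplane \<open>t = 0\<close> is a null set. As
  \<open>t\<close> has either sign, each chart point stands for a full line through the
  origin.\<close>

lemma nn_integral_polar:
  fixes f :: "(real^'n) \<times> real \<Rightarrow> ennreal"
  assumes [measurable]: "f \<in> borel_measurable borel"
  shows "(\<integral>\<^sup>+X. f X \<partial>lborel) =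
    (\<integral>\<^sup>+x. \<integral>\<^sup>+t. ennreal (\<bar>t\<bar> ^ CARD('n)) * f (t *\<^sub>R (x, 1)) \<partial>lborel \<partial>lborel)"
proof -
  have m: "f \<in> borel_measurable (lborel \<Otimes>\<^sub>M lborel)"
    by (simp add: lborel_prod)
  have "(\<integral>\<^sup>+X. f X \<partial>lborel) = (\<integral>\<^sup>+t. \<integral>\<^sup>+x. f (x, t) \<partial>lborel \<partial>lborel)"
    by (subst lborel_pair.nn_integral_snd[OF m]) (simp add: lborel_prod)
  also have "\<dots> = (\<integral>\<^sup>+t. \<integral>\<^sup>+x. ennreal (\<bar>t\<bar> ^ CARD('n)) * f (t *\<^sub>R x, t) \<partial>lborel \<partial>lborel)"
  proof (rule nn_integral_cong_AE)
    have "(\<integral>\<^sup>+x. f (x, t) \<partial>lborel) = (\<integral>\<^sup>+x. ennreal (\<bar>t\<bar> ^ CARD('n)) * f (t *\<^sub>R x, t) \<partial>lborel)"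
      if "t \<noteq> 0" for t
      using nn_integral_scale[of "\<lambda>x. f (x, t)" t] that by (simp add: nn_integral_cmult)
    then show "AE t in lborel. (\<integral>\<^sup>+x. f (x, t) \<partial>lborel) = (\<integral>\<^sup>+x. ennreal (\<bar>t\<bar> ^ CARD('n)) * f (t *\<^sub>R x, t) \<partial>lborel)"
      using AE_lborel_singleton[of "0::real"] by auto
  qed
  also have "\<dots> = (\<integral>\<^sup>+x. \<integral>\<^sup>+t. ennreal (\<bar>t\<bar> ^ CARD('n)) * f (t *\<^sub>R x, t) \<partial>lborel \<partial>lborel)"
    by (rule lborel_pair.Fubini') measurable
  finally show ?thesis by simp
qed

text \<open>As an identity of measures, polar coordinates also apply to Bochner integrals and to
  integrability.\<close>

lemma lborel_polar:
  "(lborel :: ((real^'n) \<times> real) measure) =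
    distr (density (lborel \<Otimes>\<^sub>M lborel) (\<lambda>(x, t). ennreal (\<bar>t\<bar> ^ CARD('n)))) borel (\<lambda>(x, t). t *\<^sub>R (x, 1))"
    (is "_ = distr ?D borel ?T")
proof (rule measure_eqI)
  fix A :: "((real^'n) \<times> real) set" assume "A \<in> sets lborel"
  then have A[measurable]: "A \<in> sets borel" by simp
  have T[measurable]: "?T \<in> borel_measurable ?D"
    by (simp add: case_prod_unfold) measurable
  have "emeasure (distr ?D borel ?T) A = (\<integral>\<^sup>+X. indicator A X \<partial>distr ?D borel ?T)"
    by simp
  also have "\<dots> = (\<integral>\<^sup>+y. indicator A (?T y) \<partial>?D)"
    by (rule nn_integral_distr) measurable
  also have "\<dots> = (\<integral>\<^sup>+y. (case y of (x, t) \<Rightarrow> ennreal (\<bar>t\<bar> ^ CARD('n))) * indicator A (?T y) \<partial>(lborel \<Otimes>\<^sub>M lborel))"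
    by (subst nn_integral_density) (simp_all add: case_prod_unfold)
  also have "\<dots> = (\<integral>\<^sup>+x. \<integral>\<^sup>+t. ennreal (\<bar>t\<bar> ^ CARD('n)) * indicator A (t *\<^sub>R (x, 1)) \<partial>lborel \<partial>lborel)"
    by (subst lborel.nn_integral_fst[symmetric]) (simp_all add: case_prod_unfold)
  also have "\<dots> = emeasure lborel A"
    by (subst nn_integral_polar[symmetric]) auto
  finally show "emeasure lborel A = emeasure (distr ?D borel ?T) A" ..
qed auto

section \<open>Gamma and Gaussian integrals\<close>

lemma nn_integral_Gamma_scaled:
  assumes "s > 0" "q > 0"
  shows "(\<integral>\<^sup>+u. ennreal (indicator {0..} u * u powr (s - 1) * exp (- (q * u))) \<partial>lborel) = ennreal (Gamma s * q powr (- s))"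
proof -
  have "ennreal (Gamma s) = ennreal q * (\<integral>\<^sup>+u. ennreal (indicator {0..} (q * u) * (q * u) powr (s - 1) / exp (q * u)) \<partial>lborel)"
    using assms nn_integral_real_affine[of "\<lambda>t. ennreal (indicator {0..} t * t powr (s - 1) / exp t)" q 0]
    by (simp add: Gamma_conv_nn_integral_real)
  also have "(\<integral>\<^sup>+u. ennreal (indicator {0..} (q * u) * (q * u) powr (s - 1) / exp (q * u)) \<partial>lborel) =
    (\<integral>\<^sup>+u. ennreal (q powr (s - 1)) * ennreal (indicator {0..} u * u powr (s - 1) * exp (- (q * u))) \<partial>lborel)"
    using assms by (intro nn_integral_cong)
      (auto simp: indicator_def powr_mult exp_minus zero_le_mult_iff field_simps simp flip: ennreal_mult split: if_splits)
  also have "\<dots> = ennreal (q powr (s - 1)) * (\<integral>\<^sup>+u. ennreal (indicator {0..} u * u powr (s - 1) * exp (- (q * u))) \<partial>lborel)"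
    by (rule nn_integral_cmult) measurable
  finally have "ennreal (q powr (- s)) * ennreal (Gamma s) = ennreal (q powr (- s)) * ennreal q * ennreal (q powr (s - 1)) *
     (\<integral>\<^sup>+u. ennreal (indicator {0..} u * u powr (s - 1) * exp (- (q * u))) \<partial>lborel)"
    by (simp add: mult.assoc)
  also have "ennreal (q powr (- s)) * ennreal q * ennreal (q powr (s - 1)) = 1"
    using assms by (simp add: powr_diff powr_minus field_simps flip: ennreal_mult)
  finally show ?thesis using assms by (simp add: mult.commute flip: ennreal_mult)
qed

lemma nn_integral_abs_powr_exp:
  assumes "k > 0" "r > 0"
  shows "(\<integral>\<^sup>+t. ennreal (\<bar>t\<bar> powr (k - 1) * exp (- (r * \<bar>t\<bar>))) \<partial>lborel) = ennreal (2 * Gamma k * r powr (- k))"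
proof -
  let ?h = "\<lambda>u. ennreal (indicator {0..} u * u powr (k - 1) * exp (- (r * u)))"
  have "(\<integral>\<^sup>+t. ennreal (\<bar>t\<bar> powr (k - 1) * exp (- (r * \<bar>t\<bar>))) \<partial>lborel) = (\<integral>\<^sup>+t. ?h t + ?h (- t) \<partial>lborel)"
    using AE_lborel_singleton[of "0::real"] by (intro nn_integral_cong_AE) (auto simp: indicator_def)
  also have "\<dots> = (\<integral>\<^sup>+t. ?h t \<partial>lborel) + (\<integral>\<^sup>+t. ?h (- t) \<partial>lborel)"
    by (rule nn_integral_add) measurable
  also have "(\<integral>\<^sup>+t. ?h (- t) \<partial>lborel) = (\<integral>\<^sup>+t. ?h t \<partial>lborel)"
    using nn_integral_real_affine[of ?h "-1" 0] by simp
  also have "(\<integral>\<^sup>+t. ?h t \<partial>lborel) = ennreal (Gamma k * r powr (- k))"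
    by (rule nn_integral_Gamma_scaled[OF assms])
  finally show ?thesis using Gamma_real_pos[OF assms(1)]
    by (simp add: mult.assoc ennreal_mult less_imp_le flip: mult_2)
qed

text \<open>The Gaussian integral over the line is carried along as an unknown constant;
  \<open>nn_integral_gauss\<close> determines it from a special case of the next lemma.\<close>

lemma nn_integral_gauss_aux:
  fixes u :: real
  assumes "u > 0"
  shows "(\<integral>\<^sup>+(x::'a::euclidean_space). ennreal (exp (- (u * (x \<bullet> x)))) \<partial>lborel) =
    (\<integral>\<^sup>+(x::real). ennreal (exp (- x\<^sup>2)) \<partial>lborel) ^ DIM('a) * ennreal (u powr (- (DIM('a) / 2)))"
proof -
  let ?G = "\<integral>\<^sup>+(x::real). ennreal (exp (- x\<^sup>2)) \<partial>lborel"
  have 1: "(\<integral>\<^sup>+(x::real). ennreal (exp (- (u * x\<^sup>2))) \<partial>lborel) = ?G * ennreal (u powr (- (1 / 2)))"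
  proof -
    have "?G = ennreal (sqrt u) * (\<integral>\<^sup>+(x::real). ennreal (exp (- (u * x\<^sup>2))) \<partial>lborel)"
      using nn_integral_real_affine[of "\<lambda>x. ennreal (exp (- x\<^sup>2))" "sqrt u" 0] assms
      by (simp add: power_mult_distrib)
    then have "?G * ennreal (u powr (- (1 / 2))) = ennreal (u powr (- (1 / 2))) * ennreal (sqrt u) * (\<integral>\<^sup>+(x::real). ennreal (exp (- (u * x\<^sup>2))) \<partial>lborel)"
      by (simp add: mult_ac)
    also have "ennreal (u powr (- (1 / 2))) * ennreal (sqrt u) = 1"
      using assms by (simp add: powr_half_sqrt powr_minus field_simps flip: ennreal_mult)
    finally show ?thesis by simp
  qed
  have "(\<integral>\<^sup>+(x::'a). ennreal (exp (- (u * (x \<bullet> x)))) \<partial>lborel) =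
      (\<integral>\<^sup>+(x::'a). (\<Prod>b\<in>Basis. ennreal (exp (- (u * (x \<bullet> b)\<^sup>2)))) \<partial>lborel)"
    by (subst euclidean_inner) (simp add: prod_ennreal exp_sum[symmetric] sum_distrib_left sum_negf[symmetric] power2_eq_square del: sum_negf)
  also have "\<dots> = (\<Prod>b\<in>(Basis::'a set). \<integral>\<^sup>+x. ennreal (exp (- (u * x\<^sup>2))) \<partial>lborel)"
    by (rule nn_integral_lborel_prod) auto
  also have "\<dots> = (?G * ennreal (u powr (- (1 / 2)))) ^ DIM('a)"
    unfolding 1 by simp
  also have "\<dots> = ?G ^ DIM('a) * ennreal (u powr (- (DIM('a) / 2)))"
    using assms by (simp add: power_mult_distrib ennreal_power powr_power)
  finally show ?thesis .
qed

text \<open>\<open>Gamma s * q powr (- s)\<close> with \<open>q = 1 + x \<bullet> x\<close> is an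
  integral over \<open>u\<close>. Exchanging it with the integral over \<open>x\<close> leaves a
  Gaussian in \<open>x\<close> and again a Gamma integral in \<open>u\<close>.\<close>

lemma nn_integral_Japanese_aux:
  assumes s: "s > DIM('a) / 2"
  shows "ennreal (Gamma s) * (\<integral>\<^sup>+(x::'a::euclidean_space). ennreal ((1 + x \<bullet> x) powr (- s)) \<partial>lborel) =
    (\<integral>\<^sup>+(x::real). ennreal (exp (- x\<^sup>2)) \<partial>lborel) ^ DIM('a) * ennreal (Gamma (s - DIM('a) / 2))"
proof -
  let ?G = "(\<integral>\<^sup>+(x::real). ennreal (exp (- x\<^sup>2)) \<partial>lborel) ^ DIM('a)"
  let ?n = "real DIM('a) / 2"
  let ?h = "\<lambda>(x::'a) u. ennreal (indicator {0..} u * u powr (s - 1) * exp (- ((1 + x \<bullet> x) * u)))"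
  have s0: "s > 0" using s by (smt (verit) divide_nonneg_nonneg of_nat_0_le_iff)
  have pos: "1 + x \<bullet> x > 0" for x :: 'a by (simp add: add_pos_nonneg)
  have "ennreal (Gamma s) * (\<integral>\<^sup>+(x::'a). ennreal ((1 + x \<bullet> x) powr (- s)) \<partial>lborel) =
    (\<integral>\<^sup>+(x::'a). ennreal (Gamma s) * ennreal ((1 + x \<bullet> x) powr (- s)) \<partial>lborel)"
    by (rule nn_integral_cmult[symmetric]) measurable
  also have "\<dots> = (\<integral>\<^sup>+x. \<integral>\<^sup>+u. ?h x u \<partial>lborel \<partial>lborel)"
    using nn_integral_Gamma_scaled[OF s0 pos] Gamma_real_pos[OF s0]
    by (intro nn_integral_cong) (simp flip: ennreal_mult)
  also have "\<dots> = (\<integral>\<^sup>+u. \<integral>\<^sup>+x. ?h x u \<partial>lborel \<partial>lborel)"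
    by (rule lborel_pair.Fubini'[symmetric]) measurable
  also have "\<dots> = (\<integral>\<^sup>+u. ?G * ennreal (indicator {0..} u * u powr (s - ?n - 1) * exp (- (1 * u))) \<partial>lborel)"
  proof (rule nn_integral_cong_AE)
    have "(\<integral>\<^sup>+x. ?h x u \<partial>lborel) = ?G * ennreal (indicator {0..} u * u powr (s - ?n - 1) * exp (- (1 * u)))"
      if "u \<noteq> 0" for u
    proof (cases "u > 0")
      case True
      have "(\<integral>\<^sup>+x. ?h x u \<partial>lborel) = (\<integral>\<^sup>+(x::'a). ennreal (u powr (s - 1) * exp (- u)) * ennreal (exp (- (u * (x \<bullet> x)))) \<partial>lborel)"
        using True by (intro nn_integral_cong) (simp add: algebra_simps exp_add[symmetric] mult.assoc flip: ennreal_mult)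
      also have "\<dots> = ennreal (u powr (s - 1) * exp (- u)) * (?G * ennreal (u powr (- ?n)))"
        by (subst nn_integral_cmult) (auto simp: nn_integral_gauss_aux[OF True])
      also have "\<dots> = ?G * ennreal ((u powr (s - 1) * exp (- u)) * u powr (- ?n))"
        by (subst ennreal_mult) (auto simp: mult_ac)
      also have "(u powr (s - 1) * exp (- u)) * u powr (- ?n) = indicator {0..} u * u powr (s - ?n - 1) * exp (- (1 * u))"
      proof -
        have e: "s - 1 + - ?n = s - ?n - 1" by simp
        have "u powr (s - 1) * u powr (- ?n) = u powr (s - ?n - 1)"
          unfolding powr_add[symmetric] e ..
        then show ?thesis using True by (simp add: mult_ac)
      qed
      finally show ?thesis .
    qed (use that in auto)
    then show "AE u in lborel. (\<integral>\<^sup>+x. ?h x u \<partial>lborel) = ?G * ennreal (indicator {0..} u * u powr (s - ?n - 1) * exp (- (1 * u)))"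
      using AE_lborel_singleton[of "0::real"] by auto
  qed
  also have "\<dots> = ?G * (\<integral>\<^sup>+u. ennreal (indicator {0..} u * u powr (s - ?n - 1) * exp (- (1 * u))) \<partial>lborel)"
    by (rule nn_integral_cmult) measurable
  also have "\<dots> = ?G * ennreal (Gamma (s - ?n))"
    using s by (subst nn_integral_Gamma_scaled) auto
  finally show ?thesis .
qed

text \<open>In dimension one with \<open>s = 1\<close>, the left side of the preceding lemma is
  \<open>pi\<close> by the arctangent, and the right side is the unknown constant times
  \<open>Gamma (1 / 2) = sqrt pi\<close>.\<close>

lemma nn_integral_gauss: "(\<integral>\<^sup>+(x::real). ennreal (exp (- x\<^sup>2)) \<partial>lborel) = ennreal (sqrt pi)"
proof -
  let ?G = "\<integral>\<^sup>+(x::real). ennreal (exp (- x\<^sup>2)) \<partial>lborel"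
  let ?g = "\<lambda>x::real. ennreal (1 / (1 + x\<^sup>2)) * indicator {0..} x"
  have pos: "0 < 1 + x * x" "1 + x * x \<noteq> 0" for x :: real
    using add_pos_nonneg[of 1 "x * x"] by (auto simp: add_eq_0_iff)
  have half: "(\<integral>\<^sup>+x. ?g x \<partial>lborel) = ennreal (pi / 2)"
  proof -
    have "(\<integral>\<^sup>+x. ?g x \<partial>lborel) = ennreal (pi / 2 - arctan 0)"
    proof (rule nn_integral_FTC_atLeast)
      show "(arctan has_real_derivative 1 / (1 + x\<^sup>2)) (at x)" for x
        using DERIV_arctan[of x] by (simp add: divide_inverse)
    qed (use tendsto_arctan_at_top in auto)
    then show ?thesis by simp
  qed
  have "(\<integral>\<^sup>+(x::real). ennreal ((1 + x \<bullet> x) powr (- 1)) \<partial>lborel) = (\<integral>\<^sup>+x. ?g x + ?g (- x) \<partial>lborel)"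
  proof (rule nn_integral_cong_AE)
    have "ennreal ((1 + x \<bullet> x) powr (- 1)) = ?g x + ?g (- x)" if "x \<noteq> 0" for x :: real
      using that pos[of x] by (cases "x > 0") (simp_all add: power2_eq_square powr_minus divide_inverse)
    then show "AE x in lborel. ennreal ((1 + x \<bullet> x) powr (- 1)) = ?g x + ?g (- x)"
      using AE_lborel_singleton[of "0::real"] by auto
  qed
  also have "\<dots> = (\<integral>\<^sup>+x. ?g x \<partial>lborel) + (\<integral>\<^sup>+x. ?g (- x) \<partial>lborel)"
    by (rule nn_integral_add) measurable
  also have "(\<integral>\<^sup>+x. ?g (- x) \<partial>lborel) = (\<integral>\<^sup>+x. ?g x \<partial>lborel)"
    using nn_integral_real_affine[of ?g "-1" 0] by simp
  finally have "(\<integral>\<^sup>+(x::real). ennreal ((1 + x \<bullet> x) powr (- 1)) \<partial>lborel) = ennreal pi"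
    by (simp add: half flip: ennreal_plus)
  then have "ennreal pi = ?G * ennreal (sqrt pi)"
    using nn_integral_Japanese_aux[of 1, where 'a = real] by (simp add: Gamma_one_half_real)
  then have "ennreal pi * ennreal (1 / sqrt pi) = ?G * (ennreal (sqrt pi) * ennreal (1 / sqrt pi))"
    by (simp add: mult.assoc)
  also have "ennreal (sqrt pi) * ennreal (1 / sqrt pi) = 1"
    by (simp flip: ennreal_mult)
  finally show ?thesis
    by (simp add: real_div_sqrt flip: ennreal_mult)
qed

lemma nn_integral_Japanese:
  assumes s: "s > DIM('a) / 2"
  shows "(\<integral>\<^sup>+(x::'a::euclidean_space). ennreal ((1 + x \<bullet> x) powr (- s)) \<partial>lborel) =
    ennreal (pi powr (DIM('a) / 2) * Gamma (s - DIM('a) / 2) / Gamma s)"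
proof -
  let ?I = "\<integral>\<^sup>+(x::'a). ennreal ((1 + x \<bullet> x) powr (- s)) \<partial>lborel"
  have s0: "s > 0" using s by (smt (verit) divide_nonneg_nonneg of_nat_0_le_iff)
  have G: "Gamma s > 0" "Gamma (s - DIM('a) / 2) > 0" using s s0 by (auto intro: Gamma_real_pos)
  have "?I = ennreal (1 / Gamma s) * (ennreal (Gamma s) * ?I)"
    using G by (simp flip: mult.assoc ennreal_mult)
  also have "ennreal (Gamma s) * ?I = ennreal (sqrt pi ^ DIM('a) * Gamma (s - DIM('a) / 2))"
    using nn_integral_Japanese_aux[OF s] G by (simp add: nn_integral_gauss ennreal_power ennreal_mult)
  also have "ennreal (1 / Gamma s) * \<dots> = ennreal (1 / Gamma s * (sqrt pi ^ DIM('a) * Gamma (s - DIM('a) / 2)))"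
    using G by (intro ennreal_mult[symmetric]) auto
  also have "sqrt pi ^ DIM('a) = pi powr (DIM('a) / 2)"
    by (simp add: powr_half_sqrt[symmetric] powr_power)
  finally show ?thesis by simp
qed

section \<open>Densities on projective space in the affine chart\<close>

text \<open>For an even \<open>W\<close> of degree \<open>- n - 1\<close> this is the integral of a
  density over projective space: the points outside the chart form a null set.\<close>

definition chart_int :: "((real^'n) \<times> real \<Rightarrow> complex) \<Rightarrow> complex" where
  "chart_int W = (\<integral>x. W (x, 1) \<partial>lborel)"

lemma measurable_off0:
  fixes W :: "'a::euclidean_space \<Rightarrow> complex"
  assumes "continuous_on (- {0}) W"
  shows "W \<in> borel_measurable borel"
proof -
  have "(\<lambda>X. if X \<in> - {0} then W X else W 0) \<in> borel_measurable borel"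
    by (rule borel_measurable_continuous_on_if) (use assms in auto)
  then show ?thesis by (rule measurable_cong[THEN iffD1, rotated]) auto
qed

lemma measurable_chart:
  assumes [measurable]: "W \<in> borel_measurable borel"
  shows "(\<lambda>x::real^'n. W (x, 1::real)) \<in> borel_measurable borel"
  by measurable

lemma chart_nonzero [simp]: "(x, 1::real) \<noteq> 0"
  by (simp add: zero_prod_def)

lemma norm_chart: "norm (x::'a::real_inner, 1::real) = sqrt (1 + x \<bullet> x)"
  by (simp add: norm_Pair power2_norm_eq_inner add.commute)

lemma norm_chart_powr: "norm (x::'a::real_inner, 1::real) powr s = (1 + x \<bullet> x) powr (s / 2)"
  using add_pos_nonneg[of 1 "x \<bullet> x"] by (simp add: norm_chart powr_half_sqrt[symmetric] powr_powr)

lemma nn_integral_chart_norm: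
  fixes s :: real
  assumes "s > CARD('n)"
  shows "(\<integral>\<^sup>+(x::real^'n). ennreal (norm (x, 1::real) powr (- s)) \<partial>lborel) =
    ennreal (pi powr (CARD('n) / 2) * Gamma ((s - CARD('n)) / 2) / Gamma (s / 2))"
  using nn_integral_Japanese[of "s / 2", where 'a = "real^'n"] assms
  by (simp add: norm_chart_powr diff_divide_distrib)

lemma has_bochner_integral_chart_norm:
  fixes s :: real
  assumes "s > CARD('n)"
  shows "has_bochner_integral lborel (\<lambda>x::real^'n. norm (x, 1::real) powr (- s))
    (pi powr (CARD('n) / 2) * Gamma ((s - CARD('n)) / 2) / Gamma (s / 2))"
proof (rule has_bochner_integral_nn_integral)
  show "(\<lambda>x::real^'n. norm (x, 1::real) powr (- s)) \<in> borel_measurable lborel" by measurable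
qed (use nn_integral_chart_norm[OF assms] assms in \<open>auto intro!: divide_nonneg_nonneg mult_nonneg_nonneg less_imp_le[OF Gamma_real_pos]\<close>)

text \<open>The rotation invariant density, read in the chart; a multiple of it dominates every
  continuous density of degree \<open>- n - 1\<close>.\<close>

abbreviation (input) wt :: "real^'n \<Rightarrow> real" where
  "wt x \<equiv> norm (x, 1::real) powr (- real (Suc CARD('n)))"

lemma integrable_wt: "integrable lborel (wt :: real^'n \<Rightarrow> real)"
  using has_bochner_integral_chart_norm[of "real (Suc CARD('n))", where 'n = 'n]
  by (auto simp: has_bochner_integral_iff)

lemma chart_integrable:
  fixes W :: "(real^'n) \<times> real \<Rightarrow> complex"
  assumes "W \<in> borel_measurable borel" "\<And>X. X \<noteq> 0 \<Longrightarrow> norm (W X) \<le> M * norm X powr (- real (Suc CARD('n)))"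
  shows "integrable lborel (\<lambda>x. W (x, 1))"
    "norm (chart_int W) \<le> M * (\<integral>x. wt (x :: real^'n) \<partial>lborel)"
proof -
  have i: "integrable lborel (\<lambda>x::real^'n. M * wt x)"
    by (intro integrable_mult_right integrable_wt)
  show *: "integrable lborel (\<lambda>x. W (x, 1))"
    by (rule Bochner_Integration.integrable_bound[OF i])
      (use measurable_chart[OF assms(1)] in \<open>auto intro!: AE_I2 order_trans[OF assms(2)] simp del: of_nat_Suc\<close>)
  have "norm (chart_int W) \<le> (\<integral>x. M * wt (x :: real^'n) \<partial>lborel)"
    unfolding chart_int_def by (rule Bochner_Integration.integral_norm_bound_integral[OF * i]) (simp add: assms(2) del: of_nat_Suc)
  then show "norm (chart_int W) \<le> M * (\<integral>x. wt (x :: real^'n) \<partial>lborel)"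
    by simp
qed

text \<open>A radial factor makes a density integrable over the whole space. On each line the powers
  of \<open>\<bar>t\<bar>\<close>, including the Jacobian \<open>\<bar>t\<bar> ^ n\<close>, combine
  to the exponent \<open>k - 1\<close>, so that \<open>k > 0\<close> yields a Gamma
  integral.\<close>

lemma polar_integrable:
  fixes W :: "(real^'n) \<times> real \<Rightarrow> complex"
  assumes [measurable]: "W \<in> borel_measurable borel"
    and M: "\<And>X. X \<noteq> 0 \<Longrightarrow> norm (W X) \<le> M * norm X powr (- real (Suc CARD('n)))" and k: "k > 0"
  shows "integrable lborel (\<lambda>X. of_real (norm X powr k * exp (- norm X)) * W X)"
proof (rule integrableI_bounded)
  show "(\<lambda>X. of_real (norm X powr k * exp (- norm X)) * W X) \<in> borel_measurable lborel" by measurable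
  obtain X0 :: "(real^'n) \<times> real" where "X0 \<noteq> 0" using chart_nonzero by blast
  then have M0: "M \<ge> 0" using order_trans[OF norm_ge_zero M] by (smt (verit) mult_neg_pos powr_gt_zero norm_eq_zero zero_le_mult_iff)
  have "(\<integral>\<^sup>+X. ennreal (norm (of_real (norm X powr k * exp (- norm X)) * W X)) \<partial>lborel) \<le>
     (\<integral>\<^sup>+(x::real^'n). \<integral>\<^sup>+t. ennreal (M * norm (x, 1::real) powr (k - real (Suc CARD('n)))) *
        ennreal (\<bar>t\<bar> powr (k - 1) * exp (- (norm (x, 1::real) * \<bar>t\<bar>))) \<partial>lborel \<partial>lborel)"
  proof (subst nn_integral_polar, measurable, rule nn_integral_mono)
    fix x :: "real^'n"
    have "ennreal (\<bar>t\<bar> ^ CARD('n)) * ennreal (norm (of_real (norm (t *\<^sub>R (x, 1::real)) powr k * exp (- norm (t *\<^sub>R (x, 1::real)))) * W (t *\<^sub>R (x, 1)))) \<le>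
      ennreal (M * norm (x, 1::real) powr (k - real (Suc CARD('n)))) *
        ennreal (\<bar>t\<bar> powr (k - 1) * exp (- (norm (x, 1::real) * \<bar>t\<bar>)))" if t: "t \<noteq> 0" for t
    proof -
      let ?r = "norm (x, 1::real)"
      have r: "?r > 0" by simp
      have "norm (W (t *\<^sub>R (x, 1))) \<le> M * norm (t *\<^sub>R (x, 1::real)) powr (- real (Suc CARD('n)))"
        using t by (intro M) (simp del: scaleR_Pair)
      then have "\<bar>t\<bar> ^ CARD('n) * ((\<bar>t\<bar> * ?r) powr k * exp (- (\<bar>t\<bar> * ?r)) * norm (W (t *\<^sub>R (x, 1)))) \<le>
         \<bar>t\<bar> ^ CARD('n) * ((\<bar>t\<bar> * ?r) powr k * exp (- (\<bar>t\<bar> * ?r)) * (M * (\<bar>t\<bar> * ?r) powr (- real (Suc CARD('n)))))"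
        by (intro mult_left_mono) (auto simp del: scaleR_Pair of_nat_Suc)
      also have "\<dots> = (M * ?r powr (k - real (Suc CARD('n)))) * (\<bar>t\<bar> powr (k - 1) * exp (- (?r * \<bar>t\<bar>)))"
      proof -
        have "\<bar>t\<bar> ^ CARD('n) = \<bar>t\<bar> powr CARD('n)" using t by (simp add: powr_realpow)
        moreover have "\<bar>t\<bar> powr CARD('n) * \<bar>t\<bar> powr k * \<bar>t\<bar> powr (- real (Suc CARD('n))) = \<bar>t\<bar> powr (k - 1)"
          by (simp flip: powr_add)
        moreover have "?r powr k * ?r powr (- real (Suc CARD('n))) = ?r powr (k - real (Suc CARD('n)))"
          unfolding powr_add[symmetric] by (rule arg_cong[of _ _ "\<lambda>s. ?r powr s"]) simp
        moreover have "\<bar>t\<bar> powr CARD('n) * ((\<bar>t\<bar> * ?r) powr k * exp (- (\<bar>t\<bar> * ?r)) * (M * (\<bar>t\<bar> * ?r) powr (- real (Suc CARD('n))))) =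
            (M * (?r powr k * ?r powr (- real (Suc CARD('n))))) *
            ((\<bar>t\<bar> powr CARD('n) * \<bar>t\<bar> powr k * \<bar>t\<bar> powr (- real (Suc CARD('n)))) * exp (- (?r * \<bar>t\<bar>)))"
          using r t by (simp add: powr_mult mult_ac del: of_nat_Suc)
        ultimately show ?thesis by (simp only:)
      qed
      finally show ?thesis using M0
        by (simp add: norm_mult flip: ennreal_mult del: scaleR_Pair of_nat_Suc)
    qed
    then show "(\<integral>\<^sup>+t. ennreal (\<bar>t\<bar> ^ CARD('n)) * ennreal (norm (of_real (norm (t *\<^sub>R (x, 1::real)) powr k * exp (- norm (t *\<^sub>R (x, 1::real)))) * W (t *\<^sub>R (x, 1)))) \<partial>lborel)
      \<le> (\<integral>\<^sup>+t. ennreal (M * norm (x, 1::real) powr (k - real (Suc CARD('n)))) *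
        ennreal (\<bar>t\<bar> powr (k - 1) * exp (- (norm (x, 1::real) * \<bar>t\<bar>))) \<partial>lborel)"
      using AE_lborel_singleton[of "0::real"] by (intro nn_integral_mono_AE) auto
  qed
  also have "\<dots> = (\<integral>\<^sup>+(x::real^'n). ennreal (M * 2 * Gamma k) * ennreal (wt x) \<partial>lborel)"
  proof (rule nn_integral_cong)
    fix x :: "real^'n"
    let ?r = "norm (x, 1::real)"
    have "(\<integral>\<^sup>+t. ennreal (M * ?r powr (k - real (Suc CARD('n)))) * ennreal (\<bar>t\<bar> powr (k - 1) * exp (- (?r * \<bar>t\<bar>))) \<partial>lborel)
      = ennreal (M * ?r powr (k - real (Suc CARD('n)))) * ennreal (2 * Gamma k * ?r powr (- k))"
      using k by (subst nn_integral_cmult) (auto simp: nn_integral_abs_powr_exp simp del: of_nat_Suc)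
    also have "\<dots> = ennreal ((M * 2 * Gamma k) * (?r powr (k - real (Suc CARD('n))) * ?r powr (- k)))"
      using M0 Gamma_real_pos[OF k] by (simp add: mult_ac flip: ennreal_mult del: of_nat_Suc)
    also have "?r powr (k - real (Suc CARD('n))) * ?r powr (- k) = wt x"
      unfolding powr_add[symmetric] by (rule arg_cong[of _ _ "\<lambda>s. ?r powr s"]) simp
    finally show "(\<integral>\<^sup>+t. ennreal (M * ?r powr (k - real (Suc CARD('n)))) * ennreal (\<bar>t\<bar> powr (k - 1) * exp (- (?r * \<bar>t\<bar>))) \<partial>lborel)
      = ennreal (M * 2 * Gamma k) * ennreal (wt x)"
      using M0 Gamma_real_pos[OF k] by (subst ennreal_mult[symmetric]) auto
  qed
  also have "\<dots> = ennreal (M * 2 * Gamma k) * (\<integral>\<^sup>+(x::real^'n). ennreal (wt x) \<partial>lborel)"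
    by (rule nn_integral_cmult) measurable
  also have "\<dots> < \<infinity>"
    using nn_integral_chart_norm[of "real (Suc CARD('n))", where 'n = 'n]
    by (simp add: ennreal_mult_less_top del: of_nat_Suc)
  finally show "(\<integral>\<^sup>+X. ennreal (norm (of_real (norm X powr k * exp (- norm X)) * W X)) \<partial>lborel) < \<infinity>" .
qed

text \<open>Along the line through \<open>(x, 1)\<close> the integrand is \<open>W (x, 1)\<close>
  times a function of \<open>t\<close> whose integral is \<open>2 * Gamma k\<close>, whatever the
  norm of \<open>(x, 1)\<close>; evenness keeps the half-lines from cancelling. Integrals over the
  chart thus become integrals over Euclidean space, where translations are available.\<close>

lemma polar_integral:
  fixes W :: "(real^'n) \<times> real \<Rightarrow> complex"
  assumes [measurable]: "W \<in> borel_measurable borel"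
    and M: "\<And>X. X \<noteq> 0 \<Longrightarrow> norm (W X) \<le> M * norm X powr (- real (Suc CARD('n)))" and k: "k > 0"
    and hom: "hom (- of_nat (Suc CARD('n))) e W" "even e"
  shows "(\<integral>X. of_real (norm X powr k * exp (- norm X)) * W X \<partial>lborel) = of_real (2 * Gamma k) * chart_int W"
proof -
  let ?f = "\<lambda>X. complex_of_real (norm X powr k * exp (- norm X)) * W X"
  let ?w = "\<lambda>(x::real^'n, t::real). ennreal (\<bar>t\<bar> ^ CARD('n))"
  let ?T = "\<lambda>(x::real^'n, t::real). t *\<^sub>R (x, 1::real)"
  let ?h = "\<lambda>(x::real^'n, t::real). (\<bar>t\<bar> ^ CARD('n)) *\<^sub>R ?f (t *\<^sub>R (x, 1))"
  have w: "?w = (\<lambda>y. ennreal ((\<lambda>(x::real^'n, t::real). \<bar>t\<bar> ^ CARD('n)) y))" by auto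
  have T[measurable]: "?T \<in> borel_measurable (lborel \<Otimes>\<^sub>M lborel)"
    by (simp add: case_prod_unfold) measurable
  have f[measurable]: "?f \<in> borel_measurable borel" by measurable
  have int: "integrable lborel ?f" by (rule polar_integrable[OF assms(1-3)])
  have int2: "integrable (density (lborel \<Otimes>\<^sub>M lborel) ?w) (\<lambda>y. ?f (?T y))"
    using int by (subst (asm) lborel_polar) (subst (asm) integrable_distr_eq, auto simp: T)
  have eqh: "(\<lambda>y. (case y of (x, t) \<Rightarrow> \<bar>t\<bar> ^ CARD('n)) *\<^sub>R ?f (?T y)) = ?h"
    by (auto simp: fun_eq_iff)
  have int3: "integrable (lborel \<Otimes>\<^sub>M lborel) ?h"
  proof -
    have "integrable (lborel \<Otimes>\<^sub>M lborel) (\<lambda>y. (case y of (x, t) \<Rightarrow> \<bar>t\<bar> ^ CARD('n)) *\<^sub>R ?f (?T y))"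
      using int2 unfolding w
      by (rule integrable_density[THEN iffD1, rotated -1]) (measurable, auto simp: case_prod_unfold intro!: AE_I2)
    then show ?thesis unfolding eqh .
  qed
  have "(\<integral>X. ?f X \<partial>lborel) = (\<integral>y. ?f (?T y) \<partial>(density (lborel \<Otimes>\<^sub>M lborel) ?w))"
    by (subst lborel_polar) (subst integral_distr, auto simp: T)
  also have "\<dots> = (\<integral>y. ?h y \<partial>(lborel \<Otimes>\<^sub>M lborel))"
  proof -
    have "(\<integral>y. ?f (?T y) \<partial>(density (lborel \<Otimes>\<^sub>M lborel) ?w)) =
        (\<integral>y. (case y of (x, t) \<Rightarrow> \<bar>t\<bar> ^ CARD('n)) *\<^sub>R ?f (?T y) \<partial>(lborel \<Otimes>\<^sub>M lborel))"
      unfolding w by (rule integral_density) (measurable, auto simp: case_prod_unfold intro!: AE_I2)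
    then show ?thesis unfolding eqh .
  qed
  also have "\<dots> = (\<integral>x. (\<integral>t. ?h (x, t) \<partial>lborel) \<partial>lborel)"
    using lborel_pair.integral_fst'[OF int3] by simp
  also have "\<dots> = (\<integral>x. of_real (2 * Gamma k) * W (x, 1) \<partial>lborel)"
  proof (rule Bochner_Integration.integral_cong[OF refl])
    fix x :: "real^'n"
    let ?r = "norm (x, 1::real)"
    let ?g = "\<lambda>t. \<bar>t\<bar> powr (k - 1) * exp (- (?r * \<bar>t\<bar>))"
    have g: "has_bochner_integral lborel ?g (2 * Gamma k * ?r powr (- k))"
      using nn_integral_abs_powr_exp[OF k, of ?r] Gamma_real_pos[OF k]
      by (intro has_bochner_integral_nn_integral) auto
    have "(\<integral>t. ?h (x, t) \<partial>lborel) = (\<integral>t. of_real (?g t) * (of_real (?r powr k) * W (x, 1)) \<partial>lborel)"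
    proof (rule integral_cong_AE)
      have "?h (x, t) = of_real (?g t) * (of_real (?r powr k) * W (x, 1))" if t: "t \<noteq> 0" for t
      proof -
        have "W (t *\<^sub>R (x, 1)) = spow (- of_nat (Suc CARD('n))) e t * W (x, 1)"
          using homD[OF hom(1) t, of "(x, 1)"] by simp
        also have "spow (- of_nat (Suc CARD('n))) e t = of_real (\<bar>t\<bar> powr (- real (Suc CARD('n))))"
          using t hom(2) spow_parity[of e 0 "- of_nat (Suc CARD('n))" t] by (simp add: spow_def powr_of_real[symmetric])
        finally have W: "W (t *\<^sub>R (x, 1)) = of_real (\<bar>t\<bar> powr (- real (Suc CARD('n)))) * W (x, 1)" .
        have "\<bar>t\<bar> powr CARD('n) * \<bar>t\<bar> powr k * \<bar>t\<bar> powr (- real (Suc CARD('n))) = \<bar>t\<bar> powr (k - 1)"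
          by (simp flip: powr_add)
        then have "\<bar>t\<bar> ^ CARD('n) * (\<bar>t\<bar> * ?r) powr k * \<bar>t\<bar> powr (- real (Suc CARD('n))) = \<bar>t\<bar> powr (k - 1) * ?r powr k"
          using t by (simp add: powr_realpow[symmetric] powr_mult mult_ac del: of_nat_Suc)
        then have *: "\<bar>t\<bar> ^ CARD('n) * ((\<bar>t\<bar> * ?r) powr k * exp (- (\<bar>t\<bar> * ?r))) * \<bar>t\<bar> powr (- real (Suc CARD('n))) = ?g t * ?r powr k"
          by (simp add: mult_ac del: of_nat_Suc)
        have "?h (x, t) = of_real (\<bar>t\<bar> ^ CARD('n) * ((\<bar>t\<bar> * ?r) powr k * exp (- (\<bar>t\<bar> * ?r))) * \<bar>t\<bar> powr (- real (Suc CARD('n)))) * W (x, 1)"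
          unfolding case_prod_conv W norm_scaleR real_scaleR_def scaleR_conv_of_real of_real_mult by (simp only: mult.assoc)
        then show ?thesis unfolding * by (simp add: mult_ac)
      qed
      then show "AE t in lborel. ?h (x, t) = of_real (?g t) * (of_real (?r powr k) * W (x, 1))"
        using AE_lborel_singleton[of "0::real"] by auto
    qed (simp_all only: case_prod_conv, measurable)
    also have "\<dots> = of_real (2 * Gamma k * ?r powr (- k)) * (of_real (?r powr k) * W (x, 1))"
      unfolding integral_mult_left_zero integral_complex_of_real
      using g by (simp only: has_bochner_integral_iff)
    also have "\<dots> = of_real (2 * Gamma k) * of_real (?r powr (- k) * ?r powr k) * W (x, 1)"
      by simp
    also have "?r powr (- k) * ?r powr k = 1"
      by (simp flip: powr_add)
    finally show "(\<integral>t. ?h (x, t) \<partial>lborel) = of_real (2 * Gamma k) * W (x, 1)" by simp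
  qed
  finally show ?thesis by (simp add: chart_int_def)
qed

section \<open>Vanishing integrals of derivatives\<close>

lemma lborel_shift:
  fixes f :: "'a::euclidean_space \<Rightarrow> complex"
  assumes [measurable]: "f \<in> borel_measurable borel"
  shows "integrable lborel (\<lambda>X. f (b + X)) \<longleftrightarrow> integrable lborel f"
    "(\<integral>X. f (b + X) \<partial>lborel) = (\<integral>X. f X \<partial>lborel)"
proof -
  have "integrable lborel f \<longleftrightarrow> integrable (distr lborel borel ((+) b)) f"
    by (simp add: lborel_distr_plus)
  also have "\<dots> \<longleftrightarrow> integrable lborel (\<lambda>X. f (b + X))"
    by (rule integrable_distr_eq) measurable
  finally show "integrable lborel (\<lambda>X. f (b + X)) \<longleftrightarrow> integrable lborel f" ..
  have "(\<integral>X. f X \<partial>lborel) = (\<integral>X. f X \<partial>distr lborel borel ((+) b))"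
    by (simp add: lborel_distr_plus)
  also have "\<dots> = (\<integral>X. f (b + X) \<partial>lborel)"
    by (rule integral_distr) measurable
  finally show "(\<integral>X. f (b + X) \<partial>lborel) = (\<integral>X. f X \<partial>lborel)" ..
qed

text \<open>By translation invariance \<open>f (b + X) - f X\<close> has integral 0. This difference
  is the integral of \<open>g\<close> over a segment, and Fubini's theorem turns the whole into the
  integral of \<open>g\<close>.\<close>

lemma integral_derivative_eq_0:
  fixes f g :: "'a::euclidean_space \<Rightarrow> complex"
  assumes f: "integrable lborel f" "continuous_on UNIV f"
    and g: "integrable lborel g" "continuous_on UNIV g"
    and D: "\<And>X. X \<noteq> 0 \<Longrightarrow> (f has_derivative D X) (at X)" "\<And>X. X \<noteq> 0 \<Longrightarrow> D X b = g X"
  shows "(\<integral>X. g X \<partial>lborel) = 0"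
proof (cases "b = 0")
  case True
  have "g X = 0" if "X \<noteq> 0" for X
    using D that True linear_0[OF has_derivative_linear] by metis
  then show ?thesis
    using AE_lborel_singleton[of "0::'a"] by (intro integral_eq_zero_AE) auto
next
  case False
  have fm[measurable]: "f \<in> borel_measurable borel" and gm[measurable]: "g \<in> borel_measurable borel"
    using f g by (auto intro: borel_measurable_continuous_onI)
  have ftc: "(\<integral>t. indicator {0..1} t *\<^sub>R g (t *\<^sub>R b + X) \<partial>lborel) = f (b + X) - f X" for X
  proof -
    let ?S = "{t. t *\<^sub>R b + X = 0}"
    \<comment> \<open>A line in direction \<open>b\<close> passes through the origin at most once,
      and the fundamental theorem of calculus allows finitely many exceptional points for a
      continuous \<open>f\<close>.\<close>
    have fin: "finite ?S"
    proof (rule finite_subset)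
      show "?S \<subseteq> {t. t *\<^sub>R b = - X}" by (auto simp: eq_neg_iff_add_eq_0)
      have "t = s" if "t *\<^sub>R b = - X" "s *\<^sub>R b = - X" for t s
        using that False by (metis scaleR_cancel_right)
      then have "{t. t *\<^sub>R b = - X} = {} \<or> (\<exists>s. {t. t *\<^sub>R b = - X} = {s})"
        by blast
      then show "finite {t. t *\<^sub>R b = - X}" by auto
    qed
    have "((\<lambda>t. g (t *\<^sub>R b + X)) has_integral f (1 *\<^sub>R b + X) - f (0 *\<^sub>R b + X)) {0..1}"
    proof (rule fundamental_theorem_of_calculus_strong[OF fin])
      fix t assume "t \<in> {0..1} - ?S"
      then have nz: "t *\<^sub>R b + X \<noteq> 0" by simp
      have "((\<lambda>t. f (t *\<^sub>R b + X)) has_derivative (\<lambda>h. D (t *\<^sub>R b + X) (h *\<^sub>R b))) (at t)"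
      proof -
        have 1: "((\<lambda>t. t *\<^sub>R b + X) has_derivative (\<lambda>h. h *\<^sub>R b)) (at t)"
          by (auto intro!: derivative_eq_intros)
        show ?thesis by (rule has_derivative_compose[OF 1 D(1)[OF nz]])
      qed
      then show "((\<lambda>t. f (t *\<^sub>R b + X)) has_vector_derivative g (t *\<^sub>R b + X)) (at t)"
        using linear_cmul[OF has_derivative_linear[OF D(1)[OF nz]]] D(2)[OF nz]
        by (simp add: has_vector_derivative_def)
    next
      show "continuous_on {0..1} (\<lambda>t. f (t *\<^sub>R b + X))"
        by (intro continuous_on_compose2[OF f(2)] continuous_intros) auto
    qed auto
    then have hi: "((\<lambda>t. g (t *\<^sub>R b + X)) has_integral f (b + X) - f X) {0..1}" by simp
    have "set_integrable lborel {0..1} (\<lambda>t. g (t *\<^sub>R b + X))"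
      unfolding set_integrable_def
      by (rule borel_integrable_compact) (auto intro!: continuous_on_compose2[OF g(2)] continuous_intros)
    from set_borel_integral_eq_integral(2)[OF this] integral_unique[OF hi] show ?thesis
      by (simp add: set_lebesgue_integral_def)
  qed
  let ?h = "\<lambda>(t, X). indicator {0..1::real} t *\<^sub>R g (t *\<^sub>R b + X)"
  have sh: "integrable lborel (\<lambda>X. g (t *\<^sub>R b + X))" "integrable lborel (\<lambda>X. f (t *\<^sub>R b + X))" for t
    using lborel_shift(1)[OF gm] lborel_shift(1)[OF fm] f g by auto
  have i01: "integrable lborel (\<lambda>t. indicator {0..1::real} t * c)" for c :: real
    by (intro integrable_mult_left integrable_real_indicator) auto
  have H: "integrable (lborel \<Otimes>\<^sub>M lborel) ?h"
  proof (rule lborel_pair.Fubini_integrable)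
    show "?h \<in> borel_measurable (lborel \<Otimes>\<^sub>M lborel)"
      by (simp add: case_prod_unfold) measurable
    have "(\<integral>X. norm (g (t *\<^sub>R b + X)) \<partial>lborel) = (\<integral>X. norm (g X) \<partial>lborel)" for t
      using lborel_shift(2)[of "\<lambda>X. complex_of_real (norm (g X))" "t *\<^sub>R b"] by simp
    then show "integrable lborel (\<lambda>t. \<integral>X. norm (?h (t, X)) \<partial>lborel)"
      using i01 by simp
    show "AE t in lborel. integrable lborel (\<lambda>X. ?h (t, X))"
      using sh by simp
  qed
  have "0 = (\<integral>X. f (b + X) \<partial>lborel) - (\<integral>X. f X \<partial>lborel)"
    using lborel_shift(2)[OF fm] by simp
  also have "\<dots> = (\<integral>X. f (b + X) - f X \<partial>lborel)"
    using sh(2)[of 1] f(1) by simp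
  also have "\<dots> = (\<integral>X. (\<integral>t. ?h (t, X) \<partial>lborel) \<partial>lborel)"
    using ftc by simp
  also have "\<dots> = (\<integral>t. (\<integral>X. ?h (t, X) \<partial>lborel) \<partial>lborel)"
    by (rule lborel_pair.Fubini_integral) (use H in \<open>simp add: case_prod_unfold\<close>)
  also have "\<dots> = (\<integral>t. indicator {0..1::real} t *\<^sub>R (\<integral>X. g X \<partial>lborel) \<partial>lborel)"
    using lborel_shift(2)[OF gm] by simp
  also have "\<dots> = (\<integral>X. g X \<partial>lborel)"
    by simp
  finally show ?thesis ..
qed

abbreviation (input) rad :: "real \<Rightarrow> 'a::real_normed_vector \<Rightarrow> complex" where
  "rad k X \<equiv> of_real (norm X powr k * exp (- norm X))"

lemma rad_npow: "rad k X = npow (of_real k) X * exp (- npow 1 X)"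
  by (simp add: npow_def powr_of_real exp_of_real[symmetric] flip: of_real_minus)

lemma rad_has_derivative:
  fixes X :: "'a::euclidean_space"
  assumes X: "X \<noteq> 0"
  shows "(rad k has_derivative (\<lambda>H. of_real (H \<bullet> X) * npow (- 2) X * (of_real k * rad k X - rad (k + 1) X))) (at X)"
proof -
  have a: "npow (of_real k - 2) X = npow (of_real k) X * npow (- 2) X" for k
    using npow_add[of "of_real k" "- 2" X] by simp
  have b: "npow (of_real (k + 1)) X = npow (of_real k) X * npow 1 X"
    using npow_add[of "of_real k" 1 X] by simp
  have 1: "(npow 1 has_derivative (\<lambda>H. 1 * of_real (H \<bullet> X) * npow (1 - 2) X)) (at X)"
    by (rule npow_has_derivative[OF X])
  have 2: "((\<lambda>X. - npow 1 X) has_derivative (\<lambda>H. - (1 * of_real (H \<bullet> X) * npow (1 - 2) X))) (at X)"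
    by (rule has_derivative_minus[OF 1])
  have 3: "((\<lambda>X. exp (- npow 1 X)) has_derivative (\<lambda>H. exp (- npow 1 X) * (- (1 * of_real (H \<bullet> X) * npow (1 - 2) X)))) (at X)"
    by (rule has_derivative_compose[OF 2 DERIV_exp[unfolded has_field_derivative_def]])
  from has_derivative_mult[OF npow_has_derivative[OF X] 3, of "of_real k"]
  have "((\<lambda>X. npow (of_real k) X * exp (- npow 1 X)) has_derivative
     (\<lambda>H. of_real (H \<bullet> X) * npow (- 2) X * (of_real k * rad k X - rad (k + 1) X))) (at X)"
    by (rule has_derivative_eq_rhs)
      (unfold rad_npow b a, use a[of 1] in \<open>simp add: algebra_simps fun_eq_iff\<close>)
  then show ?thesis unfolding rad_npow .
qed

lemma continuous_extend_0:
  fixes f :: "'a::euclidean_space \<Rightarrow> complex"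
  assumes "continuous_on (- {0}) f" "f 0 = 0" "c > 0" "\<And>X. X \<noteq> 0 \<Longrightarrow> norm (f X) \<le> M * norm X powr c"
  shows "continuous_on UNIV f"
proof -
  have "isCont f X" for X
  proof (cases "X = 0")
    case True
    have "((\<lambda>X::'a. M * norm X powr c) \<longlongrightarrow> 0) (at 0)"
      using assms(3) by (auto intro!: tendsto_eq_intros)
    then have "(f \<longlongrightarrow> 0) (at 0)"
      by (rule Lim_null_comparison[rotated]) (use assms(4) in \<open>auto simp: eventually_at_filter\<close>)
    then show ?thesis using True assms(2) by (simp add: isCont_def)
  next
    case False
    then show ?thesis using assms(1) by (simp add: continuous_on_eq_continuous_at open_Compl)
  qed
  then show ?thesis by (simp add: continuous_at_imp_continuous_on)
qed

lemma continuous_rad_mult: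
  fixes V :: "'a::euclidean_space \<Rightarrow> complex"
  assumes "continuous_on (- {0}) V" "\<And>X. X \<noteq> 0 \<Longrightarrow> norm (V X) \<le> M * norm X powr (- d)" "k > d"
  shows "continuous_on UNIV (\<lambda>X. rad k X * V X)"
proof (rule continuous_extend_0[where M = M and c = "k - d"])
  show "continuous_on (- {0}) (\<lambda>X. rad k X * V X)"
    by (intro continuous_intros assms) auto
  show "norm (rad k X * V X) \<le> M * norm X powr (k - d)" if "X \<noteq> 0" for X
  proof -
    have "norm (rad k X * V X) \<le> (norm X powr k * exp (- norm X)) * (M * norm X powr (- d))"
      using assms(2)[OF that] by (simp add: norm_mult mult_left_mono)
    also have "\<dots> \<le> (norm X powr k * 1) * (M * norm X powr (- d))"
      by (intro mult_right_mono mult_left_mono) (use order_trans[OF norm_ge_zero assms(2)[OF that]] in auto)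
    also have "\<dots> = M * (norm X powr k * norm X powr (- d))" by simp
    also have "norm X powr k * norm X powr (- d) = norm X powr (k - d)"
      by (simp flip: powr_add)
    finally show ?thesis .
  qed
qed (use assms in auto)

text \<open>Stokes' theorem on projective space.\<close>

lemma chart_int_derivative:
  fixes W :: "(real^'n) \<times> real \<Rightarrow> complex"
  assumes cD: "continuous_on (- {0}) (\<lambda>X. D X b)"
    and dW: "\<And>X. X \<noteq> 0 \<Longrightarrow> (W has_derivative D X) (at X)"
    and hW: "hom (- of_nat CARD('n)) e W" "odd e"
    and hD: "hom (- of_nat (Suc CARD('n))) f (\<lambda>X. D X b)" "even f"
  shows "chart_int (\<lambda>X. D X b) = 0"
proof -
  \<comment> \<open>Any \<open>k\<close> above \<open>n + 1\<close> makes the radial factor times a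
    density extend continuously by 0 to the origin, as \<open>integral_derivative_eq_0\<close>
    demands.\<close>
  define k where "k = real (Suc CARD('n)) + 1"
  have k: "k > real (Suc CARD('n))" "k > 0" "k + 1 > 0" "k + 1 > real (Suc CARD('n))" by (simp_all add: k_def)
  have cW: "continuous_on (- {0}) W"
    by (auto intro!: continuous_at_imp_continuous_on has_derivative_continuous[OF dW])
  \<comment> \<open>The density that the derivative of the radial factor contributes, once with
    exponent \<open>k\<close> and once with \<open>k + 1\<close>.\<close>
  define V where "V X = of_real (b \<bullet> X) * npow (- 2) X * W X" for X
  define V1 where "V1 X = npow (- 1) X * W X" for X
  have npc: "continuous_on (- {0}) (npow s :: (real^'n) \<times> real \<Rightarrow> complex)" for s
    by (rule smooth_off0_continuous[OF smooth_off0_npow])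
  have cV: "continuous_on (- {0}) V" "continuous_on (- {0}) V1"
    unfolding V_def[abs_def] V1_def[abs_def] by (intro continuous_intros cW npc)+
  have hV: "hom (- of_nat (Suc CARD('n))) (Suc e) V"
    using hom_mult[OF hom_mult[OF hom_inner[of b] hom_npow[of "-2"]] hW(1)] by (simp add: V_def[abs_def])
  have hV1: "hom (- of_nat (Suc CARD('n))) e V1"
    using hom_mult[OF hom_npow[of "-1"] hW(1)] by (simp add: V1_def[abs_def])
  have dre: "Re (- of_nat (Suc CARD('n))) = - real (Suc CARD('n))" by simp
  obtain MD where MD: "\<And>X. X \<noteq> 0 \<Longrightarrow> norm (D X b) \<le> MD * norm X powr (- real (Suc CARD('n)))"
    using hom_bound[OF cD hD(1)] unfolding dre by blast
  obtain MV where MV: "\<And>X. X \<noteq> 0 \<Longrightarrow> norm (V X) \<le> MV * norm X powr (- real (Suc CARD('n)))"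
    using hom_bound[OF cV(1) hV] unfolding dre by blast
  obtain M1 where M1: "\<And>X. X \<noteq> 0 \<Longrightarrow> norm (V1 X) \<le> M1 * norm X powr (- real (Suc CARD('n)))"
    using hom_bound[OF cV(2) hV1] unfolding dre by blast
  let ?g = "\<lambda>X. rad k X * D X b + (of_real k * (rad k X * V X) - rad (k + 1) X * V X)"
  let ?f = "\<lambda>X. rad k X * W X"
  have feq: "?f = (\<lambda>X. rad (k + 1) X * V1 X)"
  proof
    fix X :: "(real^'n) \<times> real"
    show "?f X = rad (k + 1) X * V1 X"
    proof (cases "X = 0")
      case False
      then have "rad (k + 1) X * V1 X = rad k X * (of_real (norm X) * npow (- 1) X) * W X"
        by (simp add: V1_def powr_add)
      also have "of_real (norm X) * npow (- 1) X = 1"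
        using npow_add[of 1 "- 1" X] npow_0[OF False] False by (simp add: npow_def)
      finally show ?thesis by simp
    qed simp
  qed
  note m = measurable_off0[OF cD] measurable_off0[OF cV(1)] measurable_off0[OF cV(2)]
  have iD: "integrable lborel (\<lambda>X. rad k X * D X b)"
    by (rule polar_integrable[OF m(1) MD k(2)])
  have iV: "integrable lborel (\<lambda>X. rad k X * V X)"
    by (rule polar_integrable[OF m(2) MV k(2)])
  have iV': "integrable lborel (\<lambda>X. rad (k + 1) X * V X)"
    by (rule polar_integrable[OF m(2) MV k(3)])
  have "(\<integral>X. ?g X \<partial>lborel) = 0"
  proof (rule integral_derivative_eq_0)
    show "integrable lborel ?f" unfolding feq
      by (rule polar_integrable[OF m(3) M1 k(3)])
    show "continuous_on UNIV ?f" unfolding feq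
      by (rule continuous_rad_mult[OF cV(2) M1 k(4)])
    show "integrable lborel ?g" by (intro Bochner_Integration.integrable_add Bochner_Integration.integrable_diff integrable_mult_right iD iV iV')
    show "continuous_on UNIV ?g"
      by (intro continuous_on_add continuous_on_diff continuous_on_mult_left
          continuous_rad_mult[OF cV(1) MV k(1)] continuous_rad_mult[OF cV(1) MV k(4)] continuous_rad_mult[OF cD MD k(1)])
    show "(?f has_derivative (\<lambda>H. rad k X * D X H + of_real (H \<bullet> X) * npow (- 2) X * (of_real k * rad k X - rad (k + 1) X) * W X)) (at X)"
      if "X \<noteq> 0" for X
      by (rule has_derivative_mult[OF rad_has_derivative[OF that] dW[OF that]])
    show "rad k X * D X b + of_real (b \<bullet> X) * npow (- 2) X * (of_real k * rad k X - rad (k + 1) X) * W X = ?g X" for X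
      by (simp add: V_def algebra_simps)
  qed
  also have "(\<integral>X. ?g X \<partial>lborel) = of_real (2 * Gamma k) * chart_int (\<lambda>X. D X b) +
      (of_real k * (of_real (2 * Gamma k) * chart_int V) - of_real (2 * Gamma (k + 1)) * chart_int V)"
  proof -
    have "(\<integral>X. ?g X \<partial>lborel) = (\<integral>X. rad k X * D X b \<partial>lborel) +
       (of_real k * (\<integral>X. rad k X * V X \<partial>lborel) - (\<integral>X. rad (k + 1) X * V X \<partial>lborel))"
      by (simp only: Bochner_Integration.integral_add Bochner_Integration.integral_diff integral_mult_right_zero
          iD iV iV' Bochner_Integration.integrable_diff integrable_mult_right)
    also have "(\<integral>X. rad k X * D X b \<partial>lborel) = of_real (2 * Gamma k) * chart_int (\<lambda>X. D X b)"
      by (rule polar_integral[OF m(1) MD k(2) hD])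
    also have "(\<integral>X. rad k X * V X \<partial>lborel) = of_real (2 * Gamma k) * chart_int V"
      by (rule polar_integral[OF m(2) MV k(2) hV]) (use hW in auto)
    also have "(\<integral>X. rad (k + 1) X * V X \<partial>lborel) = of_real (2 * Gamma (k + 1)) * chart_int V"
      by (rule polar_integral[OF m(2) MV k(3) hV]) (use hW in auto)
    finally show ?thesis .
  qed
  \<comment> \<open>The functional equation makes the two contributions of \<open>V\<close>
    cancel.\<close>
  also have "Gamma (k + 1) = k * Gamma k"
    using k by (intro Gamma_plus1) (auto elim!: nonpos_Ints_cases)
  finally show ?thesis
    using Gamma_real_pos[OF k(2)] by simp
qed

lemma chart_int_ddir:
  fixes V :: "(real^'n) \<times> real \<Rightarrow> complex"
  assumes "smooth_off0 V" "hom (- of_nat CARD('n)) e V" "odd e"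
  shows "chart_int (ddir V b) = 0"
proof (rule chart_int_derivative)
  show "continuous_on (- {0}) (ddir V b)"
    by (intro smooth_off0_continuous smooth_off0_ddir assms)
  show "hom (- of_nat (Suc CARD('n))) (Suc e) (ddir V b)"
  proof -
    have "- of_nat (Suc CARD('n)) = - of_nat CARD('n) - (1::complex)" by simp
    then show ?thesis using hom_ddir[OF assms(1,2), of b] by (simp only:)
  qed
qed (use assms smooth_off0_has_derivative in auto)

section \<open>The kernel integral in its region of convergence\<close>

text \<open>For \<open>V\<close> of degree \<open>- n - 1 - \<alpha>\<close> and parity
  \<open>e\<close> the integrand is an even density, so that \<open>J\<close> is a transform between
  homogeneous functions.\<close>

definition J :: "complex \<Rightarrow> nat \<Rightarrow> ((real^'n) \<times> real \<Rightarrow> complex) \<Rightarrow> (real^'n) \<times> real \<Rightarrow> complex" where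
  "J \<alpha> e V Y = chart_int (\<lambda>X. spow \<alpha> e (X \<bullet> Y) * V X)"

lemma J_bound:
  fixes V :: "(real^'n) \<times> real \<Rightarrow> complex"
  assumes V[measurable]: "V \<in> borel_measurable borel"
    and M: "\<And>X. X \<noteq> 0 \<Longrightarrow> norm (V X) \<le> M * norm X powr (- real (Suc CARD('n)) - Re \<alpha>)"
    and \<alpha>: "Re \<alpha> \<ge> 0"
  shows "integrable lborel (\<lambda>x. spow \<alpha> e ((x, 1) \<bullet> Y) * V (x, 1))"
    "norm (J \<alpha> e V Y) \<le> M * norm Y powr Re \<alpha> * (\<integral>x. wt (x :: real^'n) \<partial>lborel)"
    "\<And>X. X \<noteq> 0 \<Longrightarrow> norm (spow \<alpha> e (X \<bullet> Y) * V X) \<le> M * norm Y powr Re \<alpha> * norm X powr (- real (Suc CARD('n)))"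
proof -
  show b: "norm (spow \<alpha> e (X \<bullet> Y) * V X) \<le> M * norm Y powr Re \<alpha> * norm X powr (- real (Suc CARD('n)))"
    if X: "X \<noteq> 0" for X
  proof -
    have "norm (spow \<alpha> e (X \<bullet> Y) * V X) \<le> (norm X * norm Y) powr Re \<alpha> * (M * norm X powr (- real (Suc CARD('n)) - Re \<alpha>))"
      unfolding norm_mult norm_spow
      by (intro mult_mono powr_mono2 \<alpha> M X Cauchy_Schwarz_ineq2) auto
    also have "\<dots> = M * norm Y powr Re \<alpha> * (norm X powr Re \<alpha> * norm X powr (- real (Suc CARD('n)) - Re \<alpha>))"
      by (simp add: powr_mult)
    also have "norm X powr Re \<alpha> * norm X powr (- real (Suc CARD('n)) - Re \<alpha>) = norm X powr (- real (Suc CARD('n)))"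
      unfolding powr_add[symmetric] by simp
    finally show ?thesis .
  qed
  have m: "(\<lambda>X. spow \<alpha> e (X \<bullet> Y) * V X) \<in> borel_measurable borel" by measurable
  show "integrable lborel (\<lambda>x. spow \<alpha> e ((x, 1) \<bullet> Y) * V (x, 1))"
    "norm (J \<alpha> e V Y) \<le> M * norm Y powr Re \<alpha> * (\<integral>x. wt (x :: real^'n) \<partial>lborel)"
    using chart_integrable[OF m b] by (auto simp: J_def)
qed

lemma hom_bound_J:
  fixes V :: "(real^'n) \<times> real \<Rightarrow> complex"
  assumes "smooth_off0 V" "hom (- of_nat (Suc CARD('n)) - \<alpha>) e V"
  obtains M where "M \<ge> 0" "\<And>X. X \<noteq> 0 \<Longrightarrow> norm (V X) \<le> M * norm X powr (- real (Suc CARD('n)) - Re \<alpha>)"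
  using hom_bound[OF smooth_off0_continuous[OF assms(1)] assms(2)] by auto

lemma J_integrable:
  fixes V :: "(real^'n) \<times> real \<Rightarrow> complex" and Y :: "(real^'n) \<times> real"
  assumes "smooth_off0 V" "hom (- of_nat (Suc CARD('n)) - \<alpha>) e' V" "Re \<alpha> \<ge> 0"
  shows "integrable lborel (\<lambda>x. spow \<alpha> e ((x, 1) \<bullet> Y) * V (x, 1))"
proof -
  obtain M where M: "\<And>X. X \<noteq> 0 \<Longrightarrow> norm (V X) \<le> M * norm X powr (- real (Suc CARD('n)) - Re \<alpha>)"
    using hom_bound_J[OF assms(1,2)] by blast
  show ?thesis
    by (rule J_bound(1)[OF measurable_off0[OF smooth_off0_continuous[OF assms(1)]] M assms(3)])
qed

text \<open>Stokes' theorem for \<open>spow (\<alpha> + 1) (Suc e) (X \<bullet> Y) * V X\<close>.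
  Read from left to right it raises the exponent, which is the mechanism of the continuation;
  \<open>Re \<alpha> > 0\<close> makes the raised kernel continuously differentiable.\<close>

lemma J_ddir:
  fixes V :: "(real^'n) \<times> real \<Rightarrow> complex"
  assumes V: "smooth_off0 V" "hom (- of_nat (Suc CARD('n)) - \<alpha>) e V" and \<alpha>: "Re \<alpha> > 0"
  shows "(\<alpha> + 1) * of_real (b \<bullet> Y) * J \<alpha> e V Y = - J (\<alpha> + 1) (Suc e) (ddir V b) Y"
proof -
  let ?D = "\<lambda>X H. spow (\<alpha> + 1) (Suc e) (X \<bullet> Y) * ddir V H X + of_real (H \<bullet> Y) * ((\<alpha> + 1) * spow \<alpha> e (X \<bullet> Y)) * V X"
  have cs: "continuous_on S (\<lambda>X. spow \<beta> f (X \<bullet> Y))" if "Re \<beta> > 0" for \<beta> f and S :: "((real^'n) \<times> real) set"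
    by (rule continuous_on_compose2[OF continuous_spow[OF that, of UNIV]]) (auto intro!: continuous_intros)
  have hs: "hom \<beta> f (\<lambda>X::(real^'n) \<times> real. spow \<beta> f (X \<bullet> Y))" for \<beta> f
    by (simp add: hom_def spow_mult)
  have "chart_int (\<lambda>X. ?D X b) = 0"
  proof (rule chart_int_derivative[where D = ?D and b = b and W = "\<lambda>X. spow (\<alpha> + 1) (Suc e) (X \<bullet> Y) * V X"])
    show "continuous_on (- {0}) (\<lambda>X. ?D X b)"
      using \<alpha> by (intro continuous_intros cs smooth_off0_continuous smooth_off0_ddir V) auto
    show "((\<lambda>X. spow (\<alpha> + 1) (Suc e) (X \<bullet> Y) * V X) has_derivative ?D X) (at X)" if "X \<noteq> 0" for X
    proof -
      have 1: "((\<lambda>X. X \<bullet> Y) has_derivative (\<lambda>H. H \<bullet> Y)) (at X)"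
        by (auto intro!: derivative_eq_intros)
      have 2: "((\<lambda>X. spow (\<alpha> + 1) (Suc e) (X \<bullet> Y)) has_derivative (\<lambda>H. (H \<bullet> Y) *\<^sub>R ((\<alpha> + 1) * spow (\<alpha> + 1 - 1) (Suc (Suc e)) (X \<bullet> Y)))) (at X)"
        by (rule has_derivative_compose[OF 1 spow_has_derivative[unfolded has_vector_derivative_def]]) (use \<alpha> in simp)
      show ?thesis
        by (rule has_derivative_eq_rhs[OF has_derivative_mult[OF 2 smooth_off0_has_derivative[OF V(1) that]]])
          (simp add: scaleR_conv_of_real fun_eq_iff)
    qed
    show "hom (- of_nat CARD('n)) (Suc e + e) (\<lambda>X. spow (\<alpha> + 1) (Suc e) (X \<bullet> Y) * V X)"
      using hom_mult[OF hs V(2), of "\<alpha> + 1" "Suc e"] by simp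
    show "hom (- of_nat (Suc CARD('n))) (e + e) (\<lambda>X. ?D X b)"
    proof (rule hom_add)
      show "hom (- of_nat (Suc CARD('n))) (e + e) (\<lambda>X. spow (\<alpha> + 1) (Suc e) (X \<bullet> Y) * ddir V b X)"
        using hom_mult[OF hs hom_ddir[OF V, of b], of "\<alpha> + 1" "Suc e"] by (auto intro: hom_parity)
      show "hom (- of_nat (Suc CARD('n))) (e + e) (\<lambda>X. of_real (b \<bullet> Y) * ((\<alpha> + 1) * spow \<alpha> e (X \<bullet> Y)) * V X)"
        using hom_cmult[OF hom_mult[OF hs V(2), of \<alpha> e], of "of_real (b \<bullet> Y) * (\<alpha> + 1)"] by (simp add: mult_ac)
    qed
  qed auto
  moreover have "chart_int (\<lambda>X. ?D X b) = J (\<alpha> + 1) (Suc e) (ddir V b) Y + of_real (b \<bullet> Y) * (\<alpha> + 1) * J \<alpha> e V Y"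
  proof -
    have 1: "integrable lborel (\<lambda>x. spow (\<alpha> + 1) (Suc e) ((x, 1) \<bullet> Y) * ddir V b (x, 1))"
      using \<alpha> hom_ddir[OF V, of b] by (intro J_integrable smooth_off0_ddir V) (auto simp: algebra_simps)
    have 2: "integrable lborel (\<lambda>x. (of_real (b \<bullet> Y) * (\<alpha> + 1)) * (spow \<alpha> e ((x, 1) \<bullet> Y) * V (x, 1)))"
      using \<alpha> V by (intro integrable_mult_right J_integrable) auto
    show ?thesis using Bochner_Integration.integral_add[OF 1 2]
      by (simp add: J_def chart_int_def mult_ac)
  qed
  ultimately show ?thesis
    by (simp add: mult_ac eq_neg_iff_add_eq_0 add.commute)
qed

text \<open>Differentiating the kernel of exponent \<open>1\<close> leaves the constant \<open>1\<close>, not a sign.\<close>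

lemma J_1_ddir:
  fixes V :: "(real^'n) \<times> real \<Rightarrow> complex"
  assumes V: "smooth_off0 V" "hom (- of_nat (Suc CARD('n))) e V" and e: "even e"
  shows "J 1 (Suc e) (ddir V b) Y = - of_real (b \<bullet> Y) * chart_int V"
proof -
  let ?W = "\<lambda>X. of_real (Y \<bullet> X) * V X"
  have W: "smooth_off0 ?W" by (intro smooth_off0_mult smooth_off0_inner V)
  have "hom (1 + - of_nat (Suc CARD('n))) (Suc 0 + e) ?W"
    by (rule hom_mult[OF hom_inner V(2)])
  then have "chart_int (ddir ?W b) = 0"
    using e by (intro chart_int_ddir[OF W]) auto
  moreover have "ddir ?W b X = of_real (Y \<bullet> X) * ddir V b X + of_real (Y \<bullet> b) * V X" if "X \<noteq> 0" for X
    using ddir_mult[OF smooth_off0_inner V(1) that] by (simp add: ddir_inner)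
  ultimately have "chart_int (\<lambda>X. spow 1 (Suc e) (X \<bullet> Y) * ddir V b X + of_real (Y \<bullet> b) * V X) = 0"
    using e spow_parity[of "Suc e" "Suc 0" 1] by (simp add: chart_int_def spow_one inner_commute)
  moreover have 1: "integrable lborel (\<lambda>x. spow 1 (Suc e) ((x, 1) \<bullet> Y) * ddir V b (x, 1))"
    using hom_ddir[OF V, of b] by (intro J_integrable smooth_off0_ddir V) (auto simp: algebra_simps)
  moreover have 2: "integrable lborel (\<lambda>x. of_real (Y \<bullet> b) * V (x, 1))"
  proof -
    have "hom (- of_nat (Suc CARD('n)) - 0) e V" using V(2) by simp
    then obtain M where "\<And>X. X \<noteq> 0 \<Longrightarrow> norm (V X) \<le> M * norm X powr (- real (Suc CARD('n)) - Re 0)"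
      using hom_bound_J[OF V(1)] by blast
    then show ?thesis
      by (intro integrable_mult_right chart_integrable(1)[OF measurable_off0[OF smooth_off0_continuous[OF V(1)]]]) simp
  qed
  ultimately have "J 1 (Suc e) (ddir V b) Y + of_real (Y \<bullet> b) * chart_int V = 0"
    using Bochner_Integration.integral_add[OF 1 2] by (simp add: J_def chart_int_def)
  then show ?thesis by (simp add: eq_neg_iff_add_eq_0 inner_commute)
qed

text \<open>\<open>spow_taylor\<close> is integrated pointwise. Its bound has total degree
  \<open>- n - 1\<close> in \<open>X\<close>, so that the invariant density dominates it.\<close>

lemma J_taylor:
  fixes V :: "(real^'n) \<times> real \<Rightarrow> complex"
  assumes V[measurable]: "V \<in> borel_measurable borel"
    and M: "\<And>X. X \<noteq> 0 \<Longrightarrow> norm (V X) \<le> M * norm X powr (- real (Suc CARD('n)) - Re \<alpha>)"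
    and \<alpha>: "Re \<alpha> > 2"
  shows "norm (J \<alpha> e V (Y + H) - J \<alpha> e V Y - \<alpha> * J (\<alpha> - 1) (Suc e) (\<lambda>X. of_real (H \<bullet> X) * V X) Y) \<le>
    norm \<alpha> * norm (\<alpha> - 1) * M * (norm Y + norm H) powr (Re \<alpha> - 2) * (norm H)\<^sup>2 * (\<integral>x. wt (x :: real^'n) \<partial>lborel)"
proof -
  let ?W = "\<lambda>X. (spow \<alpha> e (X \<bullet> (Y + H)) - spow \<alpha> e (X \<bullet> Y) - \<alpha> * spow (\<alpha> - 1) (Suc e) (X \<bullet> Y) * of_real (X \<bullet> H)) * V X"
  have bd: "norm (?W X) \<le> norm \<alpha> * norm (\<alpha> - 1) * M * (norm Y + norm H) powr (Re \<alpha> - 2) * (norm H)\<^sup>2 * norm X powr (- real (Suc CARD('n)))"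
    if X: "X \<noteq> 0" for X
  proof -
    have "norm (?W X) \<le> (norm \<alpha> * norm (\<alpha> - 1) * (\<bar>X \<bullet> Y\<bar> + \<bar>X \<bullet> H\<bar>) powr (Re \<alpha> - 2) * (X \<bullet> H)\<^sup>2) * norm (V X)"
      unfolding norm_mult inner_add_right by (intro mult_right_mono spow_taylor[OF \<alpha>] norm_ge_zero)
    also have "\<dots> \<le> (norm \<alpha> * norm (\<alpha> - 1) * (norm X * (norm Y + norm H)) powr (Re \<alpha> - 2) * (norm X * norm H)\<^sup>2) *
       (M * norm X powr (- real (Suc CARD('n)) - Re \<alpha>))"
    proof (intro mult_mono powr_mono2 M X)
      show "\<bar>X \<bullet> Y\<bar> + \<bar>X \<bullet> H\<bar> \<le> norm X * (norm Y + norm H)"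
        using Cauchy_Schwarz_ineq2[of X Y] Cauchy_Schwarz_ineq2[of X H] by (simp add: ring_distribs)
      show "(X \<bullet> H)\<^sup>2 \<le> (norm X * norm H)\<^sup>2"
        using Cauchy_Schwarz_ineq2[of X H] abs_le_square_iff by fastforce
    qed (use \<alpha> in auto)
    also have "\<dots> = norm \<alpha> * norm (\<alpha> - 1) * M * (norm Y + norm H) powr (Re \<alpha> - 2) * (norm H)\<^sup>2 *
       (norm X powr (Re \<alpha> - 2) * norm X powr 2 * norm X powr (- real (Suc CARD('n)) - Re \<alpha>))"
      using X by (simp add: powr_mult power_mult_distrib)
    also have "norm X powr (Re \<alpha> - 2) * norm X powr 2 * norm X powr (- real (Suc CARD('n)) - Re \<alpha>) = norm X powr (- real (Suc CARD('n)))"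
      unfolding powr_add[symmetric] by simp
    finally show ?thesis .
  qed
  have 1: "integrable lborel (\<lambda>x. spow \<alpha> e ((x, 1) \<bullet> Y) * V (x, 1))" for Y :: "(real^'n) \<times> real"
    by (rule J_bound(1)[OF V M]) (use \<alpha> in auto)
  have 2: "integrable lborel (\<lambda>x. spow (\<alpha> - 1) (Suc e) ((x, 1) \<bullet> Y) * (of_real (H \<bullet> (x, 1)) * V (x, 1)))"
  proof (rule J_bound(1)[where M = "norm H * M" and V = "\<lambda>X. of_real (H \<bullet> X) * V X"])
    show "norm (of_real (H \<bullet> X) * V X) \<le> norm H * M * norm X powr (- real (Suc CARD('n)) - Re (\<alpha> - 1))" if X: "X \<noteq> 0" for X
    proof -
      have "norm (of_real (H \<bullet> X) * V X) \<le> (norm H * norm X) * (M * norm X powr (- real (Suc CARD('n)) - Re \<alpha>))"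
        unfolding norm_mult norm_of_real by (intro mult_mono Cauchy_Schwarz_ineq2 M X) auto
      also have "\<dots> = norm H * M * (norm X powr 1 * norm X powr (- real (Suc CARD('n)) - Re \<alpha>))"
        by simp
      also have "norm X powr 1 * norm X powr (- real (Suc CARD('n)) - Re \<alpha>) = norm X powr (- real (Suc CARD('n)) - Re (\<alpha> - 1))"
        unfolding powr_add[symmetric] by simp
      finally show ?thesis .
    qed
  qed (use \<alpha> in auto)
  have "J \<alpha> e V (Y + H) - J \<alpha> e V Y - \<alpha> * J (\<alpha> - 1) (Suc e) (\<lambda>X. of_real (H \<bullet> X) * V X) Y =
     (\<integral>x. spow \<alpha> e ((x, 1) \<bullet> (Y + H)) * V (x, 1) - spow \<alpha> e ((x, 1) \<bullet> Y) * V (x, 1) -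
        \<alpha> * (spow (\<alpha> - 1) (Suc e) ((x, 1) \<bullet> Y) * (of_real (H \<bullet> (x, 1)) * V (x, 1))) \<partial>lborel)"
    unfolding J_def chart_int_def
    by (simp only: Bochner_Integration.integral_diff integral_mult_right_zero
          1 2 Bochner_Integration.integrable_diff integrable_mult_right)
  also have "\<dots> = chart_int ?W"
    unfolding chart_int_def by (intro Bochner_Integration.integral_cong) (simp_all add: algebra_simps inner_commute)
  finally have eq: "J \<alpha> e V (Y + H) - J \<alpha> e V Y - \<alpha> * J (\<alpha> - 1) (Suc e) (\<lambda>X. of_real (H \<bullet> X) * V X) Y = chart_int ?W" .
  have "?W \<in> borel_measurable borel" by measurable
  from chart_integrable(2)[OF this bd] show ?thesis
    unfolding eq .
qed

section \<open>The normalized transform\<close>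

text \<open>Cauchy's estimate turns a locally uniform integrable majorant of the integrand into one of the
  difference quotients.\<close>

lemma holomorphic_integral:
  fixes F :: "complex \<Rightarrow> 'a \<Rightarrow> complex"
  assumes S: "open S"
    and meas: "\<And>z. z \<in> S \<Longrightarrow> F z \<in> borel_measurable M"
    and hol: "\<And>x. x \<in> space M \<Longrightarrow> (\<lambda>z. F z x) holomorphic_on S"
    and dom: "\<And>z. z \<in> S \<Longrightarrow> \<exists>r>0. \<exists>g. cball z r \<subseteq> S \<and> integrable M g \<and>
      (\<forall>w\<in>cball z r. \<forall>x\<in>space M. norm (F w x) \<le> g x)"
  shows "(\<lambda>z. \<integral>x. F z x \<partial>M) holomorphic_on S"
proof -
  have "(\<lambda>z. \<integral>x. F z x \<partial>M) field_differentiable (at z)" if z: "z \<in> S" for z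
  proof -
    obtain r g where r: "r > 0" "cball z r \<subseteq> S" and g: "integrable M g"
      and bd: "\<And>w x. w \<in> cball z r \<Longrightarrow> x \<in> space M \<Longrightarrow> norm (F w x) \<le> g x"
      using dom[OF z] by blast
    let ?q = "\<lambda>w x. (F w x - F z x) / (w - z)"
    have int: "integrable M (F w)" if "w \<in> cball z r" for w
      by (rule Bochner_Integration.integrable_bound[OF g])
        (use that r(2) meas bd in \<open>auto intro!: AE_I2 order_trans[OF bd abs_ge_self]\<close>)
    have q: "norm (?q w x) \<le> 2 / r * g x" if w: "w \<in> cball z (r / 2)" "w \<noteq> z" and x: "x \<in> space M" for w x
    proof -
      have h: "(\<lambda>z. F z x) holomorphic_on cball z r"
        using hol[OF x] r(2) holomorphic_on_subset by blast
      have d: "norm (deriv (\<lambda>z. F z x) v) \<le> 2 / r * g x" if v: "v \<in> cball z (r / 2)" for v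
      proof -
        have sub: "cball v (r / 2) \<subseteq> cball z r"
          using v by (auto simp: dist_norm) (smt (verit) field_sum_of_halves norm_triangle_sub dist_norm norm_minus_commute dist_triangle)
        have "norm ((deriv ^^ 1) (\<lambda>z. F z x) v) \<le> fact 1 * g x / (r / 2) ^ 1"
        proof (rule Cauchy_inequality)
          show "(\<lambda>z. F z x) holomorphic_on ball v (r / 2)"
            using h sub ball_subset_cball holomorphic_on_subset by blast
          show "continuous_on (cball v (r / 2)) (\<lambda>z. F z x)"
            using h sub holomorphic_on_imp_continuous_on holomorphic_on_subset by blast
          show "norm (F w x) \<le> g x" if "norm (v - w) = r / 2" for w
            using that sub x by (intro bd) (auto simp: dist_norm subset_iff)
        qed (use r in auto)
        then show ?thesis by (simp add: mult.commute)
      qed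
      have "norm (F w x - F z x) \<le> 2 / r * g x * norm (w - z)"
      proof (rule field_differentiable_bound[where S = "cball z (r / 2)" and f' = "deriv (\<lambda>z. F z x)"])
        fix v assume v: "v \<in> cball z (r / 2)"
        then have "v \<in> S" using r by (auto simp: subset_iff)
        then show "((\<lambda>z. F z x) has_field_derivative deriv (\<lambda>z. F z x) v) (at v within cball z (r / 2))"
          using hol[OF x] S holomorphic_derivI DERIV_subset by blast
        show "norm (deriv (\<lambda>z. F z x) v) \<le> 2 / r * g x" by (rule d[OF v])
      qed (use w r in auto)
      then show ?thesis using w by (simp add: norm_divide field_simps)
    qed
    \<comment> \<open>Dominated convergence concerns sequences, so the limit is tested on sequences
      in a smaller disc, where Cauchy's estimate bounds the quotients.\<close>
    have lim: "(\<lambda>n. \<integral>x. ?q (w n) x \<partial>M) \<longlonglongrightarrow> (\<integral>x. deriv (\<lambda>z. F z x) z \<partial>M)"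
      if w: "\<And>n. w n \<in> cball z (r / 2) - {z}" "w \<longlonglongrightarrow> z" for w
    proof (rule integral_dominated_convergence[where w = "\<lambda>x. 2 / r * g x"])
      have lx: "(\<lambda>n. ?q (w n) x) \<longlonglongrightarrow> deriv (\<lambda>z. F z x) z" if x: "x \<in> space M" for x
      proof -
        have "((\<lambda>z. F z x) has_field_derivative deriv (\<lambda>z. F z x) z) (at z)"
          using holomorphic_derivI[OF hol[OF x] S z] by simp
        then have "((\<lambda>v. ?q v x) \<longlongrightarrow> deriv (\<lambda>z. F z x) z) (at z)"
          by (simp add: has_field_derivative_iff)
        moreover have "filterlim w (at z) sequentially"
          using w by (auto simp: filterlim_at)
        ultimately show ?thesis by (rule filterlim_compose)
      qed
      then show "AE x in M. (\<lambda>n. ?q (w n) x) \<longlonglongrightarrow> deriv (\<lambda>z. F z x) z" by auto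
      have wS: "w n \<in> S" for n
      proof -
        have "w n \<in> cball z (r / 2)" using w(1)[of n] by simp
        then show ?thesis using r by (auto simp: subset_iff)
      qed
      show m: "?q (w n) \<in> borel_measurable M" for n
        using meas[OF wS] meas[OF z] by measurable
      show "(\<lambda>x. deriv (\<lambda>z. F z x) z) \<in> borel_measurable M"
        by (rule borel_measurable_LIMSEQ_metric[OF m lx])
      show "integrable M (\<lambda>x. 2 / r * g x)" using g by simp
      show "AE x in M. norm (?q (w n) x) \<le> 2 / r * g x" for n
        using q w(1) by auto
    qed
    have "((\<lambda>w. ((\<integral>x. F w x \<partial>M) - (\<integral>x. F z x \<partial>M)) / (w - z)) \<longlongrightarrow> (\<integral>x. deriv (\<lambda>z. F z x) z \<partial>M)) (at z within cball z (r / 2))"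
      unfolding tendsto_at_iff_sequentially comp_def
    proof (intro allI impI)
      fix w assume w: "\<forall>n. w n \<in> cball z (r / 2) - {z}" "w \<longlonglongrightarrow> z"
      have "((\<integral>x. F (w n) x \<partial>M) - (\<integral>x. F z x \<partial>M)) / (w n - z) = (\<integral>x. ?q (w n) x \<partial>M)" for n
      proof -
        have "w n \<in> cball z (r / 2)" using w(1) by simp
        then have "w n \<in> cball z r" "z \<in> cball z r" using r by auto
        then show ?thesis using int by simp
      qed
      then show "(\<lambda>n. ((\<integral>x. F (w n) x \<partial>M) - (\<integral>x. F z x \<partial>M)) / (w n - z)) \<longlonglongrightarrow> (\<integral>x. deriv (\<lambda>z. F z x) z \<partial>M)"
        using lim[of w] w by simp
    qed
    then have "((\<lambda>z. \<integral>x. F z x \<partial>M) has_field_derivative (\<integral>x. deriv (\<lambda>z. F z x) z \<partial>M)) (at z within cball z (r / 2))"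
      by (simp add: has_field_derivative_iff)
    moreover have "z \<in> interior (cball z (r / 2))" using r by simp
    ultimately show ?thesis
      by (metis at_within_interior field_differentiable_def)
  qed
  then show ?thesis by (auto simp: holomorphic_on_def intro: field_differentiable_at_within)
qed

lemma spow_holomorphic: "(\<lambda>z. spow (\<alpha> + z) e t) holomorphic_on S"
  by (cases "t = 0") (auto simp: spow_def intro!: holomorphic_intros)

lemma open_half_plane: "open {z. Re (\<alpha> + z) > c}"
  by (intro open_Collect_less continuous_intros)

lemma connected_half_plane: "connected {z. Re (\<alpha> + z) > c}"
proof -
  have "{z. Re (\<alpha> + z) > c} = {z. Re z > c - Re \<alpha>}" by auto
  then show ?thesis using convex_halfspace_Re_gt[of "c - Re \<alpha>"] convex_connected by metis
qed

text \<open>The bound \<open>c\<close> may lie arbitrarily far to the right of \<open>a\<close>: the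
  half plane is connected, and the identity theorem carries the equality over.\<close>

lemma half_plane_eqI:
  assumes "f holomorphic_on {z. Re (\<alpha> + z) > a}" "g holomorphic_on {z. Re (\<alpha> + z) > a}"
    and "\<And>z. Re (\<alpha> + z) > c \<Longrightarrow> f z = g z" "Re (\<alpha> + z) > a"
  shows "f z = g z"
proof -
  let ?S = "{z. Re (\<alpha> + z) > a}"
  have "of_real (max a c + 1) - \<alpha> \<in> {z. Re (\<alpha> + z) > max a c}" by (simp add: max_def)
  then have ne: "{z. Re (\<alpha> + z) > max a c} \<noteq> {}" by blast
  show ?thesis
    by (rule analytic_continuation_open[OF open_half_plane[of "max a c" \<alpha>] open_half_plane[of a \<alpha>] ne connected_half_plane _ assms(1,2)])
      (use assms in auto)
qed

lemma entire_eqI: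
  assumes "f holomorphic_on UNIV" "g holomorphic_on UNIV" "\<And>z. Re (\<alpha> + z) > c \<Longrightarrow> f z = g z"
  shows "f = g"
proof
  show "f z = g z" for z
    by (rule half_plane_eqI[where f = f and g = g and \<alpha> = \<alpha> and a = "Re (\<alpha> + z) - 1" and c = c])
      (use assms holomorphic_on_subset in auto)
qed

text \<open>By the identity theorem the continuations to growing half planes agree on overlaps. The
  glued function uses at \<open>z\<close> one whose half plane reaches past
  \<open>z\<close>.\<close>

lemma entire_glue:
  assumes "\<And>k::nat. \<exists>f. f holomorphic_on {z. Re (\<alpha> + z) > - real k} \<and> (\<forall>z. Re (\<alpha> + z) > 0 \<longrightarrow> f z = g z)"
  shows "\<exists>f. f holomorphic_on UNIV \<and> (\<forall>z. Re (\<alpha> + z) > 0 \<longrightarrow> f z = g z)"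
proof -
  obtain F where F: "\<And>k. F k holomorphic_on {z. Re (\<alpha> + z) > - real k}"
    "\<And>k z. Re (\<alpha> + z) > 0 \<Longrightarrow> F k z = g z"
    using assms by metis
  have agree: "F k z = F l z" if "Re (\<alpha> + z) > - real k" "Re (\<alpha> + z) > - real l" for k l z
  proof (rule half_plane_eqI[where f = "F k" and g = "F l" and a = "- real (min k l)" and c = 0 and \<alpha> = \<alpha>])
    show "F k holomorphic_on {z. Re (\<alpha> + z) > - real (min k l)}" "F l holomorphic_on {z. Re (\<alpha> + z) > - real (min k l)}"
      by (auto intro: holomorphic_on_subset[OF F(1)])
  qed (use F(2) that in \<open>auto simp: min_def\<close>)
  define f where "f z = F (nat \<lceil>1 - Re (\<alpha> + z)\<rceil>) z" for z
  have idx: "Re (\<alpha> + z) > - real (nat \<lceil>1 - Re (\<alpha> + z)\<rceil>)" for z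
    using real_nat_ceiling_ge[of "1 - Re (\<alpha> + z)"] by linarith
  have fF: "f z = F k z" if "Re (\<alpha> + z) > - real k" for k z
    unfolding f_def by (rule agree[OF idx that])
  have "f holomorphic_on {z. Re (\<alpha> + z) > - real k}" for k
    by (rule holomorphic_transform[OF F(1)[of k]]) (simp add: fF)
  then have "f field_differentiable (at z)" for z
    using idx[of z] open_half_plane holomorphic_on_imp_differentiable_at by blast
  then have "f holomorphic_on UNIV" by (auto simp: holomorphic_on_def)
  moreover have "f z = g z" if "Re (\<alpha> + z) > 0" for z
    using fF[of 0 z] F(2) that by auto
  ultimately show ?thesis by blast
qed

text \<open>The degree is chosen so that \<open>spow (\<alpha> + z) e (X \<bullet> Y) * V z X\<close> has degree \<open>- n - 1\<close> in \<open>X\<close>, i.e.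
  is a density on projective space.\<close>

abbreviation famJ :: "complex \<Rightarrow> nat \<Rightarrow> (complex \<Rightarrow> (real^'n) \<times> real \<Rightarrow> complex) \<Rightarrow> bool" where
  "famJ \<alpha> \<equiv> fam (- of_nat (Suc CARD('n)) - \<alpha>)"

lemma famJ_hom:
  fixes V :: "complex \<Rightarrow> (real^'n) \<times> real \<Rightarrow> complex"
  shows "famJ \<alpha> e V \<Longrightarrow> hom (- of_nat (Suc CARD('n)) - (\<alpha> + z)) e (V z)"
  using fam_hom[of "- of_nat (Suc CARD('n)) - \<alpha>" e V z] by (simp only: diff_diff_eq)

lemma famJ_ddir:
  fixes V :: "complex \<Rightarrow> (real^'n) \<times> real \<Rightarrow> complex"
  shows "famJ \<alpha> e V \<Longrightarrow> famJ (\<alpha> + 1) (Suc e) (\<lambda>z. ddir (V z) b)"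
  using fam_ddir[of "- of_nat (Suc CARD('n)) - \<alpha>" e V b] by (simp only: diff_diff_eq)

lemma famJ_inner:
  fixes V :: "complex \<Rightarrow> (real^'n) \<times> real \<Rightarrow> complex"
  shows "famJ \<alpha> e V \<Longrightarrow> famJ (\<alpha> - 1) (Suc e) (\<lambda>z X. of_real (b \<bullet> X) * V z X)"
  using fam_inner[of "- of_nat (Suc CARD('n)) - \<alpha>" e V b] by (simp only: diff_add_eq diff_diff_eq2)

lemma famJ_measurable: "famJ \<alpha> e V \<Longrightarrow> V z \<in> borel_measurable borel"
  by (rule measurable_off0[OF smooth_off0_continuous[OF fam_smooth]])

lemma famJ_bound:
  fixes V :: "complex \<Rightarrow> (real^'n) \<times> real \<Rightarrow> complex"
  assumes "famJ \<alpha> e V" "compact K"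
  obtains M where "M \<ge> 0" "\<And>z X. z \<in> K \<Longrightarrow> X \<noteq> 0 \<Longrightarrow>
    norm (V z X) \<le> M * norm X powr (- real (Suc CARD('n)) - Re (\<alpha> + z))"
  using fam_bound[OF assms] by (auto simp: algebra_simps)

lemma J_holomorphic:
  fixes V :: "complex \<Rightarrow> (real^'n) \<times> real \<Rightarrow> complex"
  assumes V: "famJ \<alpha> e V"
  shows "(\<lambda>z. J (\<alpha> + z) f (V z) Y) holomorphic_on {z. Re (\<alpha> + z) > 0}"
  unfolding J_def chart_int_def
proof (rule holomorphic_integral)
  show "open {z. Re (\<alpha> + z) > 0}" by (rule open_half_plane)
  fix z assume z: "z \<in> {z. Re (\<alpha> + z) > 0}"
  show "(\<lambda>x. spow (\<alpha> + z) f ((x, 1) \<bullet> Y) * V z (x, 1)) \<in> borel_measurable lborel"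
    using famJ_measurable[OF V] by measurable
  \<comment> \<open>Half the distance to the boundary: on the disc the exponent stays between
    \<open>r\<close> and \<open>3 * r\<close>, and the base \<open>1 + norm Y\<close> makes the
    power monotone in the exponent.\<close>
  define r where "r = Re (\<alpha> + z) / 2"
  have r: "r > 0" using z by (simp add: r_def)
  have near: "r \<le> Re (\<alpha> + w)" "Re (\<alpha> + w) \<le> 3 * r" if "w \<in> cball z r" for w
    using abs_Re_le_cmod[of "z - w"] that by (auto simp: dist_norm r_def)
  obtain M where M: "M \<ge> 0" "\<And>w X. w \<in> cball z r \<Longrightarrow> X \<noteq> 0 \<Longrightarrow>
    norm (V w X) \<le> M * norm X powr (- real (Suc CARD('n)) - Re (\<alpha> + w))"
    using famJ_bound[OF V compact_cball[of z r]] by blast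
  show "\<exists>r>0. \<exists>g. cball z r \<subseteq> {z. Re (\<alpha> + z) > 0} \<and> integrable lborel g \<and>
      (\<forall>w\<in>cball z r. \<forall>x\<in>space lborel. norm (spow (\<alpha> + w) f ((x, 1) \<bullet> Y) * V w (x, 1)) \<le> g x)"
  proof (intro exI conjI ballI)
    show "cball z r \<subseteq> {z. Re (\<alpha> + z) > 0}" using near r by fastforce
    show "integrable lborel (\<lambda>x::real^'n. (M * (1 + norm Y) powr (3 * r)) * wt x)"
      by (rule integrable_mult_right[OF integrable_wt])
    fix w x assume w: "w \<in> cball z r"
    have "norm (spow (\<alpha> + w) f ((x, 1) \<bullet> Y) * V w (x, 1)) \<le> M * norm Y powr Re (\<alpha> + w) * wt x"
      using near[OF w] r by (intro J_bound(3) famJ_measurable[OF V] M w) auto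
    also have "\<dots> \<le> M * (1 + norm Y) powr (3 * r) * wt x"
    proof (intro mult_right_mono mult_left_mono M)
      have "norm Y powr Re (\<alpha> + w) \<le> (1 + norm Y) powr Re (\<alpha> + w)"
        using near[OF w] r by (intro powr_mono2) auto
      also have "\<dots> \<le> (1 + norm Y) powr (3 * r)"
        using near[OF w] by (intro powr_mono) auto
      finally show "norm Y powr Re (\<alpha> + w) \<le> (1 + norm Y) powr (3 * r)" .
    qed auto
    finally show "norm (spow (\<alpha> + w) f ((x, 1) \<bullet> Y) * V w (x, 1)) \<le> (M * (1 + norm Y) powr (3 * r)) * wt x" .
  qed (rule r)
next
  show "(\<lambda>z. spow (\<alpha> + z) f ((x, 1) \<bullet> Y) * V z (x, 1)) holomorphic_on {z. Re (\<alpha> + z) > 0}" for x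
    by (intro holomorphic_on_mult spow_holomorphic holomorphic_on_subset[OF fam_holomorphic[OF V]]) auto
qed

text \<open>The signed power \<open>spow \<alpha> e\<close>, as a distribution on the line, has its
  poles at \<open>\<alpha> = - 1 - (e mod 2) - 2 k\<close> with natural \<open>k\<close>. These are
  exactly the zeros of this entire function.\<close>

definition nf :: "nat \<Rightarrow> complex \<Rightarrow> complex" where
  "nf e \<alpha> = rGamma ((\<alpha> + 1 + of_nat (e mod 2)) / 2)"

text \<open>What is left of the factor \<open>\<alpha> + 1\<close> of \<open>J_ddir\<close> after
  normalization. For even \<open>e\<close> the recurrence of \<open>rGamma\<close> absorbs it up to
  the constant 2; for odd \<open>e\<close> the two Gamma arguments agree and it remains.\<close>

definition m1 :: "nat \<Rightarrow> complex \<Rightarrow> complex" where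
  "m1 e \<alpha> = (if even e then 2 else \<alpha> + 1)"

lemma nf_Suc: "m1 e \<alpha> * nf e \<alpha> = (\<alpha> + 1) * nf (Suc e) (\<alpha> + 1)"
proof (cases "even e")
  case True
  then have "e mod 2 = 0" "Suc e mod 2 = 1" by presburger+
  then show ?thesis using True rGamma_plus1[of "(\<alpha> + 1) / 2"]
    by (simp add: nf_def m1_def field_simps)
next
  case False
  then have "e mod 2 = 1" "Suc e mod 2 = 0" by presburger+
  then show ?thesis using False by (simp add: nf_def m1_def field_simps)
qed

lemma nf_holomorphic [holomorphic_intros]: "f holomorphic_on S \<Longrightarrow> (\<lambda>z. nf e (f z)) holomorphic_on S"
  unfolding nf_def by (intro holomorphic_intros) auto

lemma m1_holomorphic [holomorphic_intros]: "f holomorphic_on S \<Longrightarrow> (\<lambda>z. m1 e (f z)) holomorphic_on S"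
  unfolding m1_def by (cases "even e") (auto intro: holomorphic_intros)

lemma nf_J_ddir:
  fixes V :: "(real^'n) \<times> real \<Rightarrow> complex"
  assumes V: "smooth_off0 V" "hom (- of_nat (Suc CARD('n)) - \<alpha>) e V" and \<alpha>: "Re \<alpha> > 0"
  shows "m1 e \<alpha> * of_real (b \<bullet> Y) * (nf e \<alpha> * J \<alpha> e V Y) = - (nf (Suc e) (\<alpha> + 1) * J (\<alpha> + 1) (Suc e) (ddir V b) Y)"
proof -
  have "m1 e \<alpha> * of_real (b \<bullet> Y) * (nf e \<alpha> * J \<alpha> e V Y) = (m1 e \<alpha> * nf e \<alpha>) * (of_real (b \<bullet> Y) * J \<alpha> e V Y)"
    by (simp add: mult_ac)
  also have "\<dots> = nf (Suc e) (\<alpha> + 1) * ((\<alpha> + 1) * of_real (b \<bullet> Y) * J \<alpha> e V Y)"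
    unfolding nf_Suc by (simp add: mult_ac)
  also have "\<dots> = - (nf (Suc e) (\<alpha> + 1) * J (\<alpha> + 1) (Suc e) (ddir V b) Y)"
    unfolding J_ddir[OF assms] by simp
  finally show ?thesis .
qed

text \<open>Integration by parts along \<open>Y\<close> shifts the domain of the transform by one to the left. For odd
  parity it seems to produce a pole at the exponent \<open>-1\<close>, but its residue is the integral of a
  derivative.\<close>

lemma J_continuation_step:
  fixes V :: "complex \<Rightarrow> (real^'n) \<times> real \<Rightarrow> complex"
  assumes "famJ \<alpha> e V" and Y: "Y \<noteq> 0"
  shows "\<exists>f. f holomorphic_on {z. Re (\<alpha> + z) > - real k} \<and>
    (\<forall>z. Re (\<alpha> + z) > 0 \<longrightarrow> f z = nf e (\<alpha> + z) * J (\<alpha> + z) e (V z) Y)"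
  using assms(1)
proof (induction k arbitrary: \<alpha> e V)
  case 0
  show ?case
    by (intro exI[of _ "\<lambda>z. nf e (\<alpha> + z) * J (\<alpha> + z) e (V z) Y"] conjI)
      (use J_holomorphic[OF 0, of e Y] in \<open>auto intro!: holomorphic_on_mult nf_holomorphic holomorphic_on_add\<close>)
next
  case (Suc k)
  let ?V' = "\<lambda>z. ddir (V z) Y"
  have V': "famJ (\<alpha> + 1) (Suc e) ?V'" by (rule famJ_ddir[OF Suc.prems])
  obtain g where g: "g holomorphic_on {z. Re (\<alpha> + 1 + z) > - real k}"
    "\<And>z. Re (\<alpha> + 1 + z) > 0 \<Longrightarrow> g z = nf (Suc e) (\<alpha> + 1 + z) * J (\<alpha> + 1 + z) (Suc e) (?V' z) Y"
    using Suc.IH[OF V'] by blast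
  have S: "{z. Re (\<alpha> + z) > - real (Suc k)} = {z. Re (\<alpha> + 1 + z) > - real k}" by auto
  \<comment> \<open>The direction \<open>b = Y\<close> gives the factor
    \<open>Y \<bullet> Y\<close>, which is nonzero and can be divided off.\<close>
  define q where "q = complex_of_real (Y \<bullet> Y)"
  have q: "q \<noteq> 0" using Y by (simp add: q_def)
  have rel: "m1 e (\<alpha> + z) * q * (nf e (\<alpha> + z) * J (\<alpha> + z) e (V z) Y) = - g z" if "Re (\<alpha> + z) > 0" for z
  proof -
    have eq: "\<alpha> + 1 + z = \<alpha> + z + 1" by simp
    show ?thesis
      using nf_J_ddir[OF fam_smooth[OF Suc.prems] famJ_hom[OF Suc.prems] that, of Y Y] g(2)[of z, unfolded eq] that
      by (simp add: q_def)
  qed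
  show ?case
  proof (cases "even e")
    case True
    show ?thesis
    proof (intro exI[of _ "\<lambda>z. - g z / (2 * q)"] conjI allI impI)
      show "(\<lambda>z. - g z / (2 * q)) holomorphic_on {z. Re (\<alpha> + z) > - real (Suc k)}"
        unfolding S using q by (intro holomorphic_intros g) auto
      show "- g z / (2 * q) = nf e (\<alpha> + z) * J (\<alpha> + z) e (V z) Y" if "Re (\<alpha> + z) > 0" for z
        using rel[OF that] True q by (simp add: m1_def field_simps)
    qed
  next
    case False
    \<comment> \<open>At \<open>z1\<close> the exponent is -1 and \<open>m1\<close> vanishes, so
      \<open>g\<close> has to vanish there as well.\<close>
    define z1 where "z1 = - 1 - \<alpha>"
    have gz1: "g z1 = 0" if k: "k > 0"
    proof -
      \<comment> \<open>At \<open>z1\<close> the integral for \<open>g\<close> has exponent 0, on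
        the border of the region where \<open>g\<close> is known as an integral. A second
        integration by parts moves it to exponent 1.\<close>
      let ?V'' = "\<lambda>z. ddir (?V' z) Y"
      have V'': "famJ (\<alpha> + 1 + 1) (Suc (Suc e)) ?V''" by (rule famJ_ddir[OF V'])
      define h where "h z = - (nf (Suc (Suc e)) (\<alpha> + 1 + 1 + z) * J (\<alpha> + 1 + 1 + z) (Suc (Suc e)) (?V'' z) Y) / (2 * q)" for z
      have S1: "{z. Re (\<alpha> + 1 + z) > -1} = {z. Re (\<alpha> + 1 + 1 + z) > 0}" by auto
      have "g z1 = h z1"
      proof (rule half_plane_eqI[where f = g and g = h and \<alpha> = "\<alpha> + 1" and a = "-1" and c = 0])
        show "g holomorphic_on {z. Re (\<alpha> + 1 + z) > -1}"
          using k by (intro holomorphic_on_subset[OF g(1)]) (auto simp: less_Suc_eq_le Suc_le_eq[symmetric])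
        show "h holomorphic_on {z. Re (\<alpha> + 1 + z) > -1}"
          unfolding h_def S1 using q by (intro holomorphic_intros J_holomorphic[OF V'']) auto
        show "g z = h z" if z: "Re (\<alpha> + 1 + z) > 0" for z
        proof -
          have eq: "\<alpha> + 1 + 1 + z = \<alpha> + 1 + z + 1" by simp
          have "2 * q * g z = - (nf (Suc (Suc e)) (\<alpha> + 1 + 1 + z) * J (\<alpha> + 1 + 1 + z) (Suc (Suc e)) (?V'' z) Y)"
            using nf_J_ddir[OF fam_smooth[OF V'] famJ_hom[OF V'] z, of Y Y] g(2)[OF z] False
            unfolding eq by (simp add: q_def m1_def)
          then show ?thesis using q by (simp add: h_def field_simps)
        qed
        show "Re (\<alpha> + 1 + z1) > -1" by (simp add: z1_def)
      qed
      also have "J 1 (Suc (Suc e)) (?V'' z1) Y = 0"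
      proof -
        have a: "\<alpha> + 1 + z1 = 0" "\<alpha> + z1 = - 1" by (simp_all add: z1_def)
        have h1: "hom (- of_nat (Suc CARD('n))) (Suc e) (?V' z1)"
          using famJ_hom[OF V', of z1] unfolding a by simp
        have "- of_nat (Suc CARD('n)) - (-1) = (- of_nat CARD('n) :: complex)" by simp
        then have h0: "hom (- of_nat CARD('n)) e (V z1)"
          using famJ_hom[OF Suc.prems, of z1] unfolding a by (simp only:)
        have "J 1 (Suc (Suc e)) (?V'' z1) Y = - of_real (Y \<bullet> Y) * chart_int (?V' z1)"
          using False by (intro J_1_ddir[OF fam_smooth[OF V'] h1]) auto
        also have "chart_int (?V' z1) = 0"
          by (rule chart_int_ddir[OF fam_smooth[OF Suc.prems] h0 False])
        finally show ?thesis by simp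
      qed
      then have "h z1 = 0"
        by (simp add: h_def z1_def)
      finally show ?thesis .
    qed
    \<comment> \<open>The quotient with its removable singularity at \<open>z1\<close> filled in by
      the derivative.\<close>
    define f where "f = (\<lambda>z. - (if z = z1 then deriv g z1 else (g z - g z1) / (z - z1)) / q)"
    define f0 where "f0 = (\<lambda>z. - (g z / (z - z1)) / q)"
    have eqr: "- (g z / (z - z1)) / q = nf e (\<alpha> + z) * J (\<alpha> + z) e (V z) Y" if "Re (\<alpha> + z) > 0" for z
    proof -
      have "z - z1 = \<alpha> + z + 1" by (simp add: z1_def)
      moreover have "\<alpha> + z + 1 \<noteq> 0"
      proof
        assume "\<alpha> + z + 1 = 0"
        then have "Re (\<alpha> + z) + 1 = 0" by (metis Re_complex_of_real of_real_1 plus_complex.sel(1) zero_complex.sel(1) of_real_0)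
        then show False using that by simp
      qed
      ultimately have d: "(z - z1) * q * (nf e (\<alpha> + z) * J (\<alpha> + z) e (V z) Y) = - g z" "(z - z1) * q \<noteq> 0"
        using rel[OF that] False q by (simp_all only: m1_def if_False mult_eq_0_iff simp_thms)
      have "nf e (\<alpha> + z) * J (\<alpha> + z) e (V z) Y = - g z / ((z - z1) * q)"
        using d by (metis nonzero_mult_div_cancel_left)
      then show ?thesis by simp
    qed
    show ?thesis
    proof (cases "k = 0")
      \<comment> \<open>For \<open>k = 0\<close> the point \<open>z1\<close> lies on the boundary of
        the open half plane, so the plain quotient is already holomorphic.\<close>
      case True
      show ?thesis
      proof (intro exI[of _ f0] conjI allI impI)
        have "z \<noteq> z1" if "Re (\<alpha> + 1 + z) > - real k" for z
          using that True by (auto simp: z1_def)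
        then show "f0 holomorphic_on {z. Re (\<alpha> + z) > - real (Suc k)}"
          unfolding S f0_def using q by (intro holomorphic_intros g) auto
        show "f0 z = nf e (\<alpha> + z) * J (\<alpha> + z) e (V z) Y" if "Re (\<alpha> + z) > 0" for z
          using eqr[OF that] by (simp only: f0_def)
      qed
    next
      case False
      then have g0: "g z1 = 0" using gz1 by simp
      show ?thesis
      proof (intro exI[of _ f] conjI allI impI)
        show "f holomorphic_on {z. Re (\<alpha> + z) > - real (Suc k)}"
          unfolding S f_def using q
          by (intro holomorphic_on_divide holomorphic_on_minus pole_lemma_open[OF g(1)] open_half_plane) auto
        show "f z = nf e (\<alpha> + z) * J (\<alpha> + z) e (V z) Y" if "Re (\<alpha> + z) > 0" for z
        proof -
          have "z \<noteq> z1" using that by (auto simp: z1_def)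
          then show ?thesis using eqr[OF that] g0 by (simp add: f_def)
        qed
      qed
    qed
  qed
qed

text \<open>The entire continuation of the normalized transform. The normalizing factor \<open>nf\<close> removes
  exactly the poles.\<close>

definition Phi :: "complex \<Rightarrow> nat \<Rightarrow> (complex \<Rightarrow> (real^'n) \<times> real \<Rightarrow> complex) \<Rightarrow> (real^'n) \<times> real \<Rightarrow> complex \<Rightarrow> complex" where
  "Phi \<alpha> e V Y = (SOME f. f holomorphic_on UNIV \<and>
    (\<forall>z. Re (\<alpha> + z) > 0 \<longrightarrow> f z = nf e (\<alpha> + z) * J (\<alpha> + z) e (V z) Y))"

lemma Phi:
  assumes "famJ \<alpha> e V" "Y \<noteq> 0"
  shows Phi_holomorphic: "Phi \<alpha> e V Y holomorphic_on UNIV"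
    and Phi_eq_J: "Re (\<alpha> + z) > 0 \<Longrightarrow> Phi \<alpha> e V Y z = nf e (\<alpha> + z) * J (\<alpha> + z) e (V z) Y"
  using someI_ex[OF entire_glue[OF J_continuation_step[OF assms]]] unfolding Phi_def by auto

lemma Phi_holomorphic' [holomorphic_intros]:
  assumes "famJ \<alpha> e V" "Y \<noteq> 0"
  shows "(\<lambda>z. Phi \<alpha> e V Y z) holomorphic_on S"
  using holomorphic_on_subset[OF Phi_holomorphic[OF assms]] by auto

lemma Phi_eqI:
  assumes "famJ \<alpha> e V" "Y \<noteq> 0" "f holomorphic_on UNIV"
    "\<And>z. Re (\<alpha> + z) > max c 0 \<Longrightarrow> f z = nf e (\<alpha> + z) * J (\<alpha> + z) e (V z) Y"
  shows "Phi \<alpha> e V Y z = f z"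
proof -
  have "Phi \<alpha> e V Y = f"
    by (rule entire_eqI[OF Phi_holomorphic[OF assms(1,2)] assms(3), where \<alpha> = \<alpha> and c = "max c 0"])
      (use Phi_eq_J[OF assms(1,2)] assms(4) in auto)
  then show ?thesis by simp
qed

lemma nf_Suc_Suc [simp]: "nf (Suc (Suc e)) = nf e"
  by (simp add: nf_def fun_eq_iff)

lemma J_Suc_Suc [simp]: "J \<alpha> (Suc (Suc e)) = J \<alpha> e"
  by (simp add: J_def fun_eq_iff)

lemma Phi_Suc_Suc [simp]: "Phi \<alpha> (Suc (Suc e)) = Phi \<alpha> e"
  by (simp add: Phi_def fun_eq_iff)

lemma famJ_Suc_Suc: "famJ \<alpha> (Suc (Suc e)) V \<Longrightarrow> famJ \<alpha> e V" "famJ \<alpha> e V \<Longrightarrow> famJ \<alpha> (Suc (Suc e)) V"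
  by (auto intro: fam_parity)

lemma famJ_J_integrable:
  fixes V :: "complex \<Rightarrow> (real^'n) \<times> real \<Rightarrow> complex" and Y :: "(real^'n) \<times> real"
  assumes "famJ \<alpha> e V" "Re (\<alpha> + z) > 0"
  shows "integrable lborel (\<lambda>x. spow (\<alpha> + z) e ((x, 1) \<bullet> Y) * V z (x, 1))"
  using assms(2) by (intro J_integrable[OF fam_smooth[OF assms(1)] famJ_hom[OF assms(1)]]) auto

section \<open>Algebraic rules for the continued transform\<close>

lemma Phi_add:
  fixes V :: "complex \<Rightarrow> (real^'n) \<times> real \<Rightarrow> complex"
  assumes V: "famJ \<alpha> e V" and W: "famJ \<alpha> e W" and Y: "Y \<noteq> 0"
  shows "Phi \<alpha> e (\<lambda>z X. V z X + W z X) Y z = Phi \<alpha> e V Y z + Phi \<alpha> e W Y z"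
proof (rule Phi_eqI[OF fam_add[OF V W] Y, where c = 0])
  fix z assume z: "Re (\<alpha> + z) > max 0 0"
  have "J (\<alpha> + z) e (\<lambda>X. V z X + W z X) Y = J (\<alpha> + z) e (V z) Y + J (\<alpha> + z) e (W z) Y"
    using Bochner_Integration.integral_add[OF famJ_J_integrable[OF V, of z Y] famJ_J_integrable[OF W, of z Y]] z
    by (simp add: J_def chart_int_def algebra_simps)
  then show "Phi \<alpha> e V Y z + Phi \<alpha> e W Y z = nf e (\<alpha> + z) * J (\<alpha> + z) e (\<lambda>X. V z X + W z X) Y"
    using z by (simp add: Phi_eq_J[OF V Y] Phi_eq_J[OF W Y] algebra_simps)
qed (intro holomorphic_intros V W Y)

lemma Phi_mult:
  fixes V :: "complex \<Rightarrow> (real^'n) \<times> real \<Rightarrow> complex"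
  assumes V: "famJ \<alpha> e V" and g: "g holomorphic_on UNIV" and Y: "Y \<noteq> 0"
  shows "Phi \<alpha> e (\<lambda>z X. g z * V z X) Y z = g z * Phi \<alpha> e V Y z"
proof (rule Phi_eqI[OF fam_mult[OF V g] Y, where c = 0])
  fix z assume z: "Re (\<alpha> + z) > max 0 0"
  have "J (\<alpha> + z) e (\<lambda>X. g z * V z X) Y = g z * J (\<alpha> + z) e (V z) Y"
    by (simp add: J_def chart_int_def mult.left_commute[of _ "g z"])
  then show "g z * Phi \<alpha> e V Y z = nf e (\<alpha> + z) * J (\<alpha> + z) e (\<lambda>X. g z * V z X) Y"
    using z by (simp add: Phi_eq_J[OF V Y])
qed (intro holomorphic_intros V g Y)

lemma Phi_cmult:
  assumes "famJ \<alpha> e V" "Y \<noteq> 0"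
  shows "Phi \<alpha> e (\<lambda>z X. c * V z X) Y z = c * Phi \<alpha> e V Y z"
  using Phi_mult[OF assms(1) holomorphic_on_const assms(2)] .

lemma Phi_cong:
  assumes "\<And>z X. X \<noteq> 0 \<Longrightarrow> V z X = W z X"
  shows "Phi \<alpha> e V = Phi \<alpha> e W"
  using assms by (simp add: Phi_def J_def chart_int_def fun_eq_iff)

lemma Phi_scale:
  fixes V :: "complex \<Rightarrow> (real^'n) \<times> real \<Rightarrow> complex"
  assumes V: "famJ \<alpha> e V" and Y: "Y \<noteq> 0" and r: "r \<noteq> 0"
  shows "Phi \<alpha> e V (r *\<^sub>R Y) z = spow (\<alpha> + z) e r * Phi \<alpha> e V Y z"
proof (rule Phi_eqI[OF V, where c = 0])
  fix z assume z: "Re (\<alpha> + z) > max 0 0"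
  have "J (\<alpha> + z) e (V z) (r *\<^sub>R Y) = spow (\<alpha> + z) e r * J (\<alpha> + z) e (V z) Y"
    by (simp add: J_def chart_int_def spow_mult mult.assoc del: inner_Pair)
  then show "spow (\<alpha> + z) e r * Phi \<alpha> e V Y z = nf e (\<alpha> + z) * J (\<alpha> + z) e (V z) (r *\<^sub>R Y)"
    using z by (simp add: Phi_eq_J[OF V Y])
qed (use Y r in \<open>auto intro!: holomorphic_intros spow_holomorphic V\<close>)

lemma Phi_ddir:
  fixes V :: "complex \<Rightarrow> (real^'n) \<times> real \<Rightarrow> complex"
  assumes V: "famJ \<alpha> e V" and Y: "Y \<noteq> 0"
  shows "m1 e (\<alpha> + z) * of_real (b \<bullet> Y) * Phi \<alpha> e V Y z = - Phi (\<alpha> + 1) (Suc e) (\<lambda>z. ddir (V z) b) Y z"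
proof -
  have "(\<lambda>z. m1 e (\<alpha> + z) * of_real (b \<bullet> Y) * Phi \<alpha> e V Y z) = (\<lambda>z. - Phi (\<alpha> + 1) (Suc e) (\<lambda>z. ddir (V z) b) Y z)"
  proof (rule entire_eqI[where \<alpha> = \<alpha> and c = 0])
    fix z assume z: "Re (\<alpha> + z) > 0"
    have eq: "\<alpha> + 1 + z = \<alpha> + z + 1" by simp
    show "m1 e (\<alpha> + z) * of_real (b \<bullet> Y) * Phi \<alpha> e V Y z = - Phi (\<alpha> + 1) (Suc e) (\<lambda>z. ddir (V z) b) Y z"
      using nf_J_ddir[OF fam_smooth[OF V] famJ_hom[OF V] z, of b Y] z
        Phi_eq_J[OF V Y z] Phi_eq_J[OF famJ_ddir[OF V] Y, of z b, unfolded eq]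
      by simp
  qed (intro holomorphic_intros V Y famJ_ddir)+
  then show ?thesis by meson
qed

text \<open>The coefficient of the derivative in \<open>Y\<close>: differentiating the kernel gives
  \<open>\<alpha>\<close>, and \<open>m2\<close> is what remains of it after normalization
  (\<open>m2_nf\<close>).\<close>

definition m2 :: "nat \<Rightarrow> complex \<Rightarrow> complex" where
  "m2 e \<alpha> = m1 (Suc e) (\<alpha> - 1)"

lemma m2_Suc: "m2 (Suc e) (\<alpha> + 1) = m1 e \<alpha>"
  by (simp add: m2_def m1_def)

lemma m2_holomorphic [holomorphic_intros]: "f holomorphic_on S \<Longrightarrow> (\<lambda>z. m2 e (f z)) holomorphic_on S"
  unfolding m2_def by (intro holomorphic_intros)

lemma m2_nf: "m2 e \<alpha> * nf (Suc e) (\<alpha> - 1) = \<alpha> * nf e \<alpha>"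
  using nf_Suc[of "Suc e" "\<alpha> - 1"] by (simp add: m2_def)

text \<open>\<open>Phi_ddir\<close> is applied to the linear form of \<open>a\<close> times
  \<open>V\<close>, whose derivative along \<open>b\<close> has two terms. By
  \<open>ddir_Phi\<close> the left side is \<open>b \<bullet> Y\<close> times the derivative along
  \<open>a\<close>: the transform intertwines two first order operators.\<close>

lemma Phi_inner_ddir:
  fixes V :: "complex \<Rightarrow> (real^'n) \<times> real \<Rightarrow> complex"
  assumes V: "famJ \<alpha> e V" and Y: "Y \<noteq> 0"
  shows "m2 e (\<alpha> + z) * of_real (b \<bullet> Y) * Phi (\<alpha> - 1) (Suc e) (\<lambda>z X. of_real (a \<bullet> X) * V z X) Y z =
    - (of_real (a \<bullet> b) * Phi \<alpha> e V Y z + Phi \<alpha> e (\<lambda>z X. of_real (a \<bullet> X) * ddir (V z) b X) Y z)"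
proof -
  have aV: "famJ \<alpha> e (\<lambda>z X. of_real (a \<bullet> X) * ddir (V z) b X)"
    using famJ_inner[OF famJ_ddir[OF V, of b], of a] famJ_Suc_Suc by simp
  have "Phi (\<alpha> - 1 + 1) (Suc (Suc e)) (\<lambda>z. ddir (\<lambda>X. of_real (a \<bullet> X) * V z X) b) Y z =
    Phi \<alpha> e (\<lambda>z X. of_real (a \<bullet> b) * V z X + of_real (a \<bullet> X) * ddir (V z) b X) Y z"
  proof -
    have "Phi \<alpha> e (\<lambda>z. ddir (\<lambda>X. of_real (a \<bullet> X) * V z X) b) =
      Phi \<alpha> e (\<lambda>z X. of_real (a \<bullet> b) * V z X + of_real (a \<bullet> X) * ddir (V z) b X)"
      by (rule Phi_cong) (simp add: ddir_mult[OF smooth_off0_inner fam_smooth[OF V]] ddir_inner)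
    then show ?thesis by simp
  qed
  also have "\<dots> = of_real (a \<bullet> b) * Phi \<alpha> e V Y z + Phi \<alpha> e (\<lambda>z X. of_real (a \<bullet> X) * ddir (V z) b X) Y z"
    by (simp add: Phi_add[OF fam_cmult[OF V] aV Y] Phi_cmult[OF V Y])
  finally show ?thesis
    using Phi_ddir[OF famJ_inner[OF V, of a] Y, of z b] by (simp add: m2_def diff_add_eq)
qed

text \<open>Linearity in \<open>H\<close> makes the candidate for the derivative a linear map and
  reduces bounds for it to a basis.\<close>

lemma Phi_inner_sum:
  fixes V :: "complex \<Rightarrow> (real^'n) \<times> real \<Rightarrow> complex"
  assumes V: "famJ \<alpha> e V" and Y: "Y \<noteq> 0"
  shows "Phi (\<alpha> - 1) (Suc e) (\<lambda>z X. of_real (H \<bullet> X) * V z X) Y z =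
    (\<Sum>b\<in>Basis. of_real (H \<bullet> b) * Phi (\<alpha> - 1) (Suc e) (\<lambda>z X. of_real (b \<bullet> X) * V z X) Y z)"
proof -
  let ?P = "\<lambda>W. Phi (\<alpha> - 1) (Suc e) W Y z"
  let ?W = "\<lambda>B z X. \<Sum>b\<in>B. of_real (H \<bullet> b) * (of_real (b \<bullet> X) * V z X)"
  have "famJ (\<alpha> - 1) (Suc e) (?W B) \<and> ?P (?W B) = (\<Sum>b\<in>B. of_real (H \<bullet> b) * ?P (\<lambda>z X. of_real (b \<bullet> X) * V z X))"
    if "finite B" for B
    using that
  proof induction
    case empty
    have "famJ (\<alpha> - 1) (Suc e) (\<lambda>z X. 0 * (of_real (H \<bullet> X) * V z X))"
      by (intro fam_cmult famJ_inner V)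
    moreover have "?P (\<lambda>z X. 0 * (of_real (H \<bullet> X) * V z X)) = 0 * ?P (\<lambda>z X. of_real (H \<bullet> X) * V z X)"
      by (rule Phi_cmult[OF famJ_inner[OF V] Y])
    ultimately show ?case by simp
  next
    case (insert b B)
    have "famJ (\<alpha> - 1) (Suc e) (\<lambda>z X. of_real (H \<bullet> b) * (of_real (b \<bullet> X) * V z X))"
      by (intro fam_cmult famJ_inner V)
    then show ?case
      using insert fam_add[of _ _ "\<lambda>z X. of_real (H \<bullet> b) * (of_real (b \<bullet> X) * V z X)" "?W B"]
        Phi_add[OF _ _ Y, of "\<alpha> - 1" "Suc e" "\<lambda>z X. of_real (H \<bullet> b) * (of_real (b \<bullet> X) * V z X)" "?W B" z]
        Phi_cmult[OF famJ_inner[OF V] Y]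
      by simp
  qed
  from this[OF finite_Basis]
  have "?P (?W Basis) = (\<Sum>b\<in>Basis. of_real (H \<bullet> b) * ?P (\<lambda>z X. of_real (b \<bullet> X) * V z X))" by simp
  moreover have "?W Basis = (\<lambda>z X. of_real (H \<bullet> X) * V z X)"
  proof (intro ext)
    fix z X
    have "of_real (H \<bullet> X) = (\<Sum>b\<in>Basis. of_real (H \<bullet> b) * complex_of_real (b \<bullet> X))"
      by (subst euclidean_inner) (simp add: inner_commute)
    then show "?W Basis z X = of_real (H \<bullet> X) * V z X"
      by (simp add: sum_distrib_right mult.assoc)
  qed
  ultimately show ?thesis by simp
qed

section \<open>Smoothness in \<open>Y\<close> of the continued transform\<close>

text \<open>The linear term uses the continued transform of exponent \<open>\<alpha> - 1\<close>,
  not a derivative. So the remainder is entire in \<open>z\<close> and can be estimated before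
  differentiability in \<open>Y\<close> is known.\<close>

definition Phi_rem :: "complex \<Rightarrow> nat \<Rightarrow> (complex \<Rightarrow> (real^'n) \<times> real \<Rightarrow> complex) \<Rightarrow>
    (real^'n) \<times> real \<Rightarrow> (real^'n) \<times> real \<Rightarrow> complex \<Rightarrow> complex" where
  "Phi_rem \<alpha> e V Y0 Y z = Phi \<alpha> e V Y z - Phi \<alpha> e V Y0 z -
     m2 e (\<alpha> + z) * Phi (\<alpha> - 1) (Suc e) (\<lambda>z X. of_real ((Y - Y0) \<bullet> X) * V z X) Y0 z"

lemma Phi_rem_holomorphic:
  assumes "famJ \<alpha> e V" "Y0 \<noteq> 0" "Y \<noteq> 0"
  shows "Phi_rem \<alpha> e V Y0 Y holomorphic_on S"
proof -
  have "(\<lambda>z. Phi_rem \<alpha> e V Y0 Y z) holomorphic_on S"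
    unfolding Phi_rem_def by (intro holomorphic_intros assms famJ_inner)
  then show ?thesis by simp
qed

lemma bounded_on_cball:
  assumes "f holomorphic_on UNIV"
  obtains C where "C \<ge> 0" "\<And>z. z \<in> cball c R \<Longrightarrow> norm (f z :: complex) \<le> C"
proof -
  have "compact (f ` cball c R)"
    by (intro compact_continuous_image holomorphic_on_imp_continuous_on holomorphic_on_subset[OF assms] compact_cball) simp
  then have "bounded (f ` cball c R)" by (rule compact_imp_bounded)
  then obtain C where "\<forall>z\<in>cball c R. norm (f z) \<le> C"
    unfolding bounded_iff by blast
  then have "norm (f z) \<le> max C 0" if "z \<in> cball c R" for z
    using that by (meson max.coboundedI1)
  then show ?thesis by (rule that[OF max.cobounded2[of 0 C]])
qed

lemma bounded_on_cball_ex: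
  assumes "f holomorphic_on UNIV"
  shows "\<exists>C\<ge>0. \<forall>z\<in>cball c R. norm (f z :: complex) \<le> C"
proof -
  obtain C where "C \<ge> 0" "\<And>z. z \<in> cball c R \<Longrightarrow> norm (f z) \<le> C"
    by (rule bounded_on_cball[OF assms, of c R], rule that)
  then show ?thesis by (intro exI[of _ C] conjI ballI)
qed

text \<open>With real parts at least 3 both \<open>\<alpha> + z\<close> and the lowered exponent lie
  in the region of convergence, and \<open>J_taylor\<close> applies uniformly on the disc.\<close>

lemma Phi_taylor_base:
  fixes V :: "complex \<Rightarrow> (real^'n) \<times> real \<Rightarrow> complex"
  assumes V: "famJ \<alpha> e V" and Y0: "Y0 \<noteq> 0" and D: "\<And>z. z \<in> cball c R \<Longrightarrow> Re (\<alpha> + z) \<ge> 3"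
  shows "\<exists>\<delta>>0. \<exists>C. \<forall>z\<in>cball c R. \<forall>Y\<in>ball Y0 \<delta>. Y \<noteq> 0 \<and> norm (Phi_rem \<alpha> e V Y0 Y z) \<le> C * (norm (Y - Y0))\<^sup>2"
proof -
  obtain M where M: "M \<ge> 0" "\<And>w X. w \<in> cball c R \<Longrightarrow> X \<noteq> 0 \<Longrightarrow>
    norm (V w X) \<le> M * norm X powr (- real (Suc CARD('n)) - Re (\<alpha> + w))"
    using famJ_bound[OF V compact_cball[of c R]] by blast
  have "(\<lambda>z. nf e (\<alpha> + z) * (\<alpha> + z) * (\<alpha> + z - 1)) holomorphic_on UNIV"
    by (intro holomorphic_intros)
  from bounded_on_cball[OF this] obtain N where N: "N \<ge> 0"
    "\<And>z. z \<in> cball c R \<Longrightarrow> norm (nf e (\<alpha> + z) * (\<alpha> + z) * (\<alpha> + z - 1)) \<le> N" by blast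
  define I where "I = (\<integral>x. wt (x :: real^'n) \<partial>lborel)"
  have I: "I \<ge> 0" unfolding I_def by (intro integral_nonneg_AE) auto
  define B where "B = (1 + (norm Y0 + norm Y0)) powr (Re \<alpha> + Re c + R)"
  have "norm (Phi_rem \<alpha> e V Y0 Y z) \<le> (N * M * B * I) * (norm (Y - Y0))\<^sup>2" "Y \<noteq> 0"
    if z: "z \<in> cball c R" and Y: "Y \<in> ball Y0 (norm Y0)" for z Y
  proof -
    show nz: "Y \<noteq> 0" using Y by auto
    let ?H = "Y - Y0"
    have re: "Re (\<alpha> + z) \<ge> 3" by (rule D[OF z])
    have eq: "\<alpha> - 1 + z = \<alpha> + z - 1" by simp
    have a: "Phi (\<alpha> - 1) (Suc e) (\<lambda>z X. of_real (?H \<bullet> X) * V z X) Y0 z =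
       nf (Suc e) (\<alpha> + z - 1) * J (\<alpha> + z - 1) (Suc e) (\<lambda>X. of_real (?H \<bullet> X) * V z X) Y0"
      using Phi_eq_J[OF famJ_inner[OF V] Y0, of z ?H, unfolded eq] re by simp
    have "m2 e (\<alpha> + z) * Phi (\<alpha> - 1) (Suc e) (\<lambda>z X. of_real (?H \<bullet> X) * V z X) Y0 z =
      nf e (\<alpha> + z) * ((\<alpha> + z) * J (\<alpha> + z - 1) (Suc e) (\<lambda>X. of_real (?H \<bullet> X) * V z X) Y0)"
      unfolding a mult.assoc[symmetric] m2_nf by (simp add: mult_ac)
    then have "Phi_rem \<alpha> e V Y0 Y z = nf e (\<alpha> + z) * (J (\<alpha> + z) e (V z) (Y0 + ?H) - J (\<alpha> + z) e (V z) Y0 -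
       (\<alpha> + z) * J (\<alpha> + z - 1) (Suc e) (\<lambda>X. of_real (?H \<bullet> X) * V z X) Y0)"
      using re Phi_eq_J[OF V Y0, of z] Phi_eq_J[OF V nz, of z] by (simp add: Phi_rem_def algebra_simps)
    also have "norm \<dots> \<le> norm (nf e (\<alpha> + z)) * (norm (\<alpha> + z) * norm (\<alpha> + z - 1) * M * (norm Y0 + norm ?H) powr (Re (\<alpha> + z) - 2) * (norm ?H)\<^sup>2 * I)"
      unfolding norm_mult[of "nf e (\<alpha> + z)"] I_def
      by (intro mult_left_mono J_taylor famJ_measurable[OF V] M z) (use re in auto)
    also have "\<dots> = norm (nf e (\<alpha> + z) * (\<alpha> + z) * (\<alpha> + z - 1)) * (M * (norm Y0 + norm ?H) powr (Re (\<alpha> + z) - 2) * (norm ?H)\<^sup>2 * I)"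
      by (simp add: norm_mult mult_ac)
    also have "\<dots> \<le> N * (M * B * (norm ?H)\<^sup>2 * I)"
    proof (intro mult_mono N z mult_left_mono M(1) I mult_right_mono)
      have "(norm Y0 + norm ?H) powr (Re (\<alpha> + z) - 2) \<le> (1 + (norm Y0 + norm Y0)) powr (Re (\<alpha> + z) - 2)"
        using Y re by (intro powr_mono2) (auto simp: dist_norm norm_minus_commute)
      also have "\<dots> \<le> B"
        unfolding B_def
      proof (rule powr_mono)
        show "Re (\<alpha> + z) - 2 \<le> Re \<alpha> + Re c + R"
          using abs_Re_le_cmod[of "c - z"] z by (auto simp: dist_norm)
      qed auto
      finally show "(norm Y0 + norm ?H) powr (Re (\<alpha> + z) - 2) \<le> B" .
    qed (simp_all add: M(1) I B_def mult_nonneg_nonneg)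
    finally show "norm (Phi_rem \<alpha> e V Y0 Y z) \<le> (N * M * B * I) * (norm (Y - Y0))\<^sup>2"
      by (simp add: mult_ac)
  qed
  then show ?thesis
    by (intro exI[of _ "norm Y0"] conjI exI[of _ "N * M * B * I"] ballI) (use Y0 in auto)
qed

text \<open>Integration by parts along \<open>Y0\<close> turns the remainder for \<open>V\<close>
  into that for its derivative at the next exponent. The extra term is quadratic in
  \<open>Y - Y0\<close>: one factor comes from \<open>Y0 \<bullet> (Y - Y0)\<close>, the other from
  the linear term.\<close>

lemma Phi_rem_ddir:
  fixes V :: "complex \<Rightarrow> (real^'n) \<times> real \<Rightarrow> complex"
  assumes V: "famJ \<alpha> e V" and Y0: "Y0 \<noteq> 0" and Y: "Y \<noteq> 0"
  shows "m1 e (\<alpha> + z) * of_real (Y0 \<bullet> Y) * Phi_rem \<alpha> e V Y0 Y z =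
    - Phi_rem (\<alpha> + 1) (Suc e) (\<lambda>z. ddir (V z) Y0) Y0 Y z
    - m1 e (\<alpha> + z) * m2 e (\<alpha> + z) * of_real (Y0 \<bullet> (Y - Y0)) *
      Phi (\<alpha> - 1) (Suc e) (\<lambda>z X. of_real ((Y - Y0) \<bullet> X) * V z X) Y0 z"
proof -
  define H where "H = Y - Y0"
  define P where "P = Phi \<alpha> e V Y z"
  define P0 where "P0 = Phi \<alpha> e V Y0 z"
  define Q where "Q = Phi (\<alpha> - 1) (Suc e) (\<lambda>z X. of_real (H \<bullet> X) * V z X) Y0 z"
  define P' where "P' = Phi (\<alpha> + 1) (Suc e) (\<lambda>z. ddir (V z) Y0) Y z"
  define P0' where "P0' = Phi (\<alpha> + 1) (Suc e) (\<lambda>z. ddir (V z) Y0) Y0 z"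
  define Q' where "Q' = Phi \<alpha> e (\<lambda>z X. of_real (H \<bullet> X) * ddir (V z) Y0 X) Y0 z"
  define m where "m = m1 e (\<alpha> + z)"
  define k where "k = m2 e (\<alpha> + z)"
  define q where "q = complex_of_real (Y0 \<bullet> Y0)"
  define h where "h = complex_of_real (Y0 \<bullet> H)"
  have yq: "complex_of_real (Y0 \<bullet> Y) = q + h" by (simp add: q_def h_def H_def inner_diff_right)
  have 1: "m * (q + h) * P = - P'"
    using Phi_ddir[OF V Y, of z Y0] by (simp only: m_def P_def P'_def yq)
  have 2: "m * q * P0 = - P0'"
    using Phi_ddir[OF V Y0, of z Y0] by (simp only: m_def P0_def P0'_def q_def)
  have 3: "k * q * Q = - (h * P0 + Q')"
    using Phi_inner_ddir[OF V Y0, of z Y0 H] by (simp only: k_def q_def Q_def h_def P0_def Q'_def inner_commute[of H])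
  have r: "Phi_rem \<alpha> e V Y0 Y z = P - P0 - k * Q"
    by (simp only: Phi_rem_def P_def P0_def k_def Q_def H_def)
  have r': "Phi_rem (\<alpha> + 1) (Suc e) (\<lambda>z. ddir (V z) Y0) Y0 Y z = P' - P0' - m * Q'"
  proof -
    have "m2 (Suc e) (\<alpha> + 1 + z) = m"
      using m2_Suc[of e "\<alpha> + z"] by (simp add: m_def add_ac)
    then show ?thesis by (simp add: Phi_rem_def P'_def P0'_def Q'_def H_def)
  qed
  have "m * (q + h) * (P - P0 - k * Q) = m * (q + h) * P - m * q * P0 - m * h * P0 - m * (k * q * Q) - m * k * h * Q"
    by (simp add: algebra_simps)
  also have "\<dots> = - (P' - P0' - m * Q') - m * k * h * Q"
    unfolding 1 2 3 by (simp add: algebra_simps)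
  finally show ?thesis
    unfolding r r' yq by (simp only: m_def k_def h_def Q_def H_def)
qed

text \<open>The estimate of the remainder is transported to the left by integration by parts along \<open>Y0\<close>;
  the zero of \<open>m1\<close> is avoided by estimating on a circle and applying the maximum principle.\<close>

lemma Phi_taylor_step:
  fixes V :: "complex \<Rightarrow> (real^'n) \<times> real \<Rightarrow> complex"
  assumes "famJ \<alpha> e V" "Y0 \<noteq> 0" "\<And>z. z \<in> cball c R \<Longrightarrow> Re (\<alpha> + z) \<ge> 3 - real k / 2"
  shows "\<exists>\<delta>>0. \<exists>C. \<forall>z\<in>cball c R. \<forall>Y\<in>ball Y0 \<delta>. Y \<noteq> 0 \<and> norm (Phi_rem \<alpha> e V Y0 Y z) \<le> C * (norm (Y - Y0))\<^sup>2"
  using assms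
proof (induction k arbitrary: \<alpha> e V R)
  case 0
  then show ?case by (intro Phi_taylor_base) auto
next
  case (Suc k)
  note V = Suc.prems(1) and Y0 = Suc.prems(2)
  show ?case
  proof (cases "R < 0")
    case True
    then show ?thesis using Y0 by (intro exI[of _ "norm Y0"]) auto
  next
    case False
    define z1 where "z1 = - 1 - \<alpha>"
    \<comment> \<open>Raising the exponent gains 1 and enlarging the disc costs at most 1 / 2,
      whence the \<open>k / 2\<close> in the statement. The circle of radius \<open>R'\<close> has
      to avoid the zero \<open>z1\<close> of \<open>m1\<close>.\<close>
    obtain R' where R': "R < R'" "R' \<le> R + 1 / 2" "R' \<noteq> dist c z1"
    proof (cases "dist c z1 = R + 1 / 2")
      case True
      show ?thesis by (rule that[of "R + 1 / 4"]) (use True in auto)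
    next
      case False
      show ?thesis by (rule that[of "R + 1 / 2"]) (use False in auto)
    qed
    define \<eta> where "\<eta> = min 2 \<bar>R' - dist c z1\<bar>"
    have \<eta>: "\<eta> > 0" using R' by (simp add: \<eta>_def)
    have m1: "norm (m1 e (\<alpha> + z)) \<ge> \<eta>" if z: "dist c z = R'" for z
    proof (cases "even e")
      case False
      have "norm (m1 e (\<alpha> + z)) = dist z z1" using False by (simp add: m1_def z1_def dist_norm algebra_simps)
      moreover have "\<bar>R' - dist c z1\<bar> \<le> dist z z1"
        using z dist_triangle2[of c z1 z] dist_triangle[of c z z1] by (simp add: dist_commute abs_le_iff)
      ultimately show ?thesis by (simp add: \<eta>_def)
    qed (simp add: m1_def \<eta>_def)
    have D': "Re (\<alpha> + 1 + z) \<ge> 3 - real k / 2" if z: "z \<in> cball c R'" for z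
    proof (cases "z = c")
      case True
      moreover have "Re (\<alpha> + c) \<ge> 3 - real (Suc k) / 2" using Suc.prems(3)[of c] False by simp
      ultimately show ?thesis by (simp add: field_simps)
    next
      case zc: False
      \<comment> \<open>The point of the smaller disc nearest to \<open>z\<close>, at distance at
        most 1 / 2.\<close>
      define w where "w = c + of_real (min R (dist c z) / dist c z) * (z - c)"
      have d: "dist c z > 0" using zc by simp
      have "norm (w - c) = \<bar>min R (dist c z) / dist c z\<bar> * dist c z"
        by (simp add: w_def norm_mult dist_norm norm_minus_commute[of z c] del: of_real_divide)
      also have "\<dots> = min R (dist c z)" using False d by simp
      finally have "w \<in> cball c R" by (simp add: dist_norm norm_minus_commute)
      then have "Re (\<alpha> + w) \<ge> 3 - real (Suc k) / 2" by (rule Suc.prems(3))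
      moreover have "dist w z \<le> 1 / 2"
      proof -
        define t where "t = min R (dist c z) / dist c z"
        have t: "(t - 1) * dist c z = min R (dist c z) - dist c z"
          using d by (simp add: t_def left_diff_distrib)
        have "w - z = of_real (t - 1) * (z - c)" by (simp add: w_def t_def algebra_simps)
        then have "dist w z = \<bar>t - 1\<bar> * dist c z"
          by (simp only: dist_norm norm_mult norm_of_real norm_minus_commute[of z c])
        also have "\<dots> = \<bar>min R (dist c z) - dist c z\<bar>"
          unfolding t[symmetric] abs_mult by simp
        also have "\<dots> \<le> 1 / 2" using z R' by (auto simp: min_def)
        finally show ?thesis .
      qed
      then have "\<bar>Re w - Re z\<bar> \<le> 1 / 2" using abs_Re_le_cmod[of "w - z"] by (simp add: dist_norm)
      moreover have "real (Suc k) / 2 = 1 / 2 + real k / 2" by (simp add: add_divide_distrib)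
      ultimately show ?thesis unfolding plus_complex.sel one_complex.sel abs_le_iff by linarith
    qed
    let ?V' = "\<lambda>z. ddir (V z) Y0"
    obtain \<delta> C where \<delta>: "\<delta> > 0" and C: "\<And>z Y. z \<in> cball c R' \<Longrightarrow> Y \<in> ball Y0 \<delta> \<Longrightarrow>
        norm (Phi_rem (\<alpha> + 1) (Suc e) ?V' Y0 Y z) \<le> C * (norm (Y - Y0))\<^sup>2"
    proof -
      have "\<exists>\<delta>>0. \<exists>C. \<forall>z\<in>cball c R'. \<forall>Y\<in>ball Y0 \<delta>. Y \<noteq> 0 \<and>
          norm (Phi_rem (\<alpha> + 1) (Suc e) ?V' Y0 Y z) \<le> C * (norm (Y - Y0))\<^sup>2"
        by (rule Suc.IH[OF famJ_ddir[OF V] Y0 D'])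
      then show ?thesis using that by blast
    qed
    let ?Q = "\<lambda>H z. m1 e (\<alpha> + z) * m2 e (\<alpha> + z) * Phi (\<alpha> - 1) (Suc e) (\<lambda>z X. of_real (H \<bullet> X) * V z X) Y0 z"
    \<comment> \<open>Being linear in \<open>H\<close> and bounded on the disc for each basis
      vector, this term is bounded by a multiple of \<open>norm H\<close>.\<close>
    obtain K where K: "K \<ge> 0" "\<And>z H. z \<in> cball c R' \<Longrightarrow> norm (?Q H z) \<le> K * norm H"
    proof -
      have "(\<lambda>z. ?Q b z) holomorphic_on UNIV" for b
        by (intro holomorphic_intros Y0 famJ_inner V)
      then have "\<forall>b. \<exists>C\<ge>0. \<forall>z\<in>cball c R'. norm (?Q b z) \<le> C"
        by (intro allI bounded_on_cball_ex)
      then obtain B where "\<forall>b. B b \<ge> 0 \<and> (\<forall>z\<in>cball c R'. norm (?Q b z) \<le> B b)"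
        by (rule choice[THEN exE])
      then have B: "B b \<ge> 0" "z \<in> cball c R' \<Longrightarrow> norm (?Q b z) \<le> B b" for b z by blast+
      have "norm (?Q H z) \<le> (\<Sum>b\<in>Basis. B b) * norm H" if z: "z \<in> cball c R'" for z H
      proof -
        have "?Q H z = (\<Sum>b\<in>Basis. of_real (H \<bullet> b) * ?Q b z)"
          unfolding Phi_inner_sum[OF V Y0, of H] by (simp add: sum_distrib_left mult_ac)
        also have "norm \<dots> \<le> (\<Sum>b\<in>Basis. norm H * B b)"
        proof (rule sum_norm_le)
          fix b :: "(real^'n) \<times> real" assume "b \<in> Basis"
          then show "norm (of_real (H \<bullet> b) * ?Q b z) \<le> norm H * B b"
            unfolding norm_mult[of "of_real (H \<bullet> b)"] norm_of_real
            by (intro mult_mono Basis_le_norm B z) auto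
        qed
        finally show ?thesis by (simp add: sum_distrib_left mult.commute)
      qed
      then show ?thesis using that[of "\<Sum>b\<in>Basis. B b"] B(1) by (simp add: sum_nonneg)
    qed
    define \<delta>' where "\<delta>' = min \<delta> (norm Y0 / 2)"
    define C' where "C' = (C + norm Y0 * K) / (\<eta> * ((norm Y0)\<^sup>2 / 2))"
    have \<delta>': "\<delta>' > 0" using \<delta> Y0 by (simp add: \<delta>'_def)
    have main: "Y \<noteq> 0 \<and> norm (Phi_rem \<alpha> e V Y0 Y z) \<le> C' * (norm (Y - Y0))\<^sup>2"
      if z: "z \<in> cball c R" and Y: "Y \<in> ball Y0 \<delta>'" for z Y
    proof -
      have Yd: "Y \<in> ball Y0 \<delta>" and dY: "norm (Y - Y0) \<le> norm Y0 / 2"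
        using Y by (auto simp: \<delta>'_def dist_norm norm_minus_commute)
      have nz: "Y \<noteq> 0" using dY Y0 by auto
      \<comment> \<open>Near \<open>Y0\<close> the product \<open>Y0 \<bullet> Y\<close> stays away
        from 0, so it can be divided off along with \<open>m1\<close>.\<close>
      have ip: "Y0 \<bullet> Y \<ge> (norm Y0)\<^sup>2 / 2"
      proof -
        have "\<bar>Y0 \<bullet> (Y - Y0)\<bar> \<le> norm Y0 * norm (Y - Y0)" by (rule Cauchy_Schwarz_ineq2)
        also have "\<dots> \<le> norm Y0 * (norm Y0 / 2)" using dY by (intro mult_left_mono) auto
        finally have "- (Y0 \<bullet> (Y - Y0)) \<le> (norm Y0)\<^sup>2 / 2" by (simp only: abs_le_iff power2_eq_square times_divide_eq_right)
        moreover have "Y0 \<bullet> Y = (norm Y0)\<^sup>2 + Y0 \<bullet> (Y - Y0)" by (simp add: inner_diff_right power2_norm_eq_inner)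
        ultimately show ?thesis by linarith
      qed
      have "norm (Phi_rem \<alpha> e V Y0 Y z) \<le> C' * (norm (Y - Y0))\<^sup>2"
      proof (rule maximum_modulus_frontier[of "Phi_rem \<alpha> e V Y0 Y" "cball c R'"])
        show "Phi_rem \<alpha> e V Y0 Y holomorphic_on interior (cball c R')"
          by (rule Phi_rem_holomorphic[OF V Y0 nz])
        show "continuous_on (closure (cball c R')) (Phi_rem \<alpha> e V Y0 Y)"
          by (rule holomorphic_on_imp_continuous_on[OF Phi_rem_holomorphic[OF V Y0 nz]])
        show "bounded (cball c R')" by simp
        show "z \<in> cball c R'" using z R' by auto
        fix w assume "w \<in> frontier (cball c R')"
        then have w: "dist c w = R'" by simp
        then have wc: "w \<in> cball c R'" by simp
        let ?r = "norm (Phi_rem \<alpha> e V Y0 Y w)"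
        have "\<eta> * ((norm Y0)\<^sup>2 / 2) * ?r \<le> norm (m1 e (\<alpha> + w)) * (Y0 \<bullet> Y) * ?r"
          using m1[OF w] ip \<eta> by (intro mult_right_mono mult_mono) auto
        also have "\<dots> = norm (m1 e (\<alpha> + w) * of_real (Y0 \<bullet> Y) * Phi_rem \<alpha> e V Y0 Y w)"
          using ip by (simp add: norm_mult order_trans[OF _ ip])
        also have "\<dots> = norm (Phi_rem (\<alpha> + 1) (Suc e) ?V' Y0 Y w + of_real (Y0 \<bullet> (Y - Y0)) * ?Q (Y - Y0) w)"
          unfolding Phi_rem_ddir[OF V Y0 nz]
          by (subst norm_minus_cancel[symmetric]) (simp add: mult_ac)
        also have "\<dots> \<le> C * (norm (Y - Y0))\<^sup>2 + (norm Y0 * norm (Y - Y0)) * (K * norm (Y - Y0))"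
          unfolding norm_mult[of "of_real (Y0 \<bullet> (Y - Y0))"]
          by (intro norm_triangle_le add_mono C wc Yd, unfold norm_mult[of "of_real (Y0 \<bullet> (Y - Y0))"] norm_of_real)
            (intro mult_mono Cauchy_Schwarz_ineq2 K wc; simp)
        also have "\<dots> = (C + norm Y0 * K) * (norm (Y - Y0))\<^sup>2"
          by (simp add: algebra_simps power2_eq_square)
        finally show "?r \<le> C' * (norm (Y - Y0))\<^sup>2"
          using \<eta> Y0 by (simp add: C'_def field_simps)
      qed
      then show ?thesis using nz by simp
    qed
    then show ?thesis using \<delta>' by blast
  qed
qed

lemma Phi_taylor:
  fixes V :: "complex \<Rightarrow> (real^'n) \<times> real \<Rightarrow> complex"
  assumes V: "famJ \<alpha> e V" and Y0: "Y0 \<noteq> 0"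
  obtains \<delta> C where "\<delta> > 0" "C \<ge> 0"
    "\<And>z Y. z \<in> cball 0 R \<Longrightarrow> Y \<in> ball Y0 \<delta> \<Longrightarrow> norm (Phi_rem \<alpha> e V Y0 Y z) \<le> C * (norm (Y - Y0))\<^sup>2"
proof -
  obtain k :: nat where k: "real k \<ge> 2 * (3 - Re \<alpha> + R)" using real_arch_simple by blast
  have "Re (\<alpha> + z) \<ge> 3 - real k / 2" if "z \<in> cball 0 R" for z
    using abs_Re_le_cmod[of z] that k by (auto simp: dist_norm field_simps)
  from Phi_taylor_step[OF V Y0 this] obtain \<delta> C where *: "\<delta> > 0"
    "\<forall>z\<in>cball 0 R. \<forall>Y\<in>ball Y0 \<delta>. Y \<noteq> 0 \<and> norm (Phi_rem \<alpha> e V Y0 Y z) \<le> C * (norm (Y - Y0))\<^sup>2"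
    by blast
  show thesis
  proof (rule that[of \<delta> "\<bar>C\<bar>"])
    fix z :: complex and Y assume zY: "z \<in> cball 0 R" "Y \<in> ball Y0 \<delta>"
    have "norm (Phi_rem \<alpha> e V Y0 Y z) \<le> C * (norm (Y - Y0))\<^sup>2" using *(2) zY by blast
    also have "\<dots> \<le> \<bar>C\<bar> * (norm (Y - Y0))\<^sup>2" by (rule mult_right_mono) auto
    finally show "norm (Phi_rem \<alpha> e V Y0 Y z) \<le> \<bar>C\<bar> * (norm (Y - Y0))\<^sup>2" .
  qed (use * in auto)
qed

lemma Phi_has_derivative:
  fixes V :: "complex \<Rightarrow> (real^'n) \<times> real \<Rightarrow> complex"
  assumes V: "famJ \<alpha> e V" and Y0: "Y0 \<noteq> 0"
  shows "((\<lambda>Y. Phi \<alpha> e V Y z) has_derivative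
    (\<lambda>H. m2 e (\<alpha> + z) * Phi (\<alpha> - 1) (Suc e) (\<lambda>z X. of_real (H \<bullet> X) * V z X) Y0 z)) (at Y0)"
proof -
  let ?L = "\<lambda>H. m2 e (\<alpha> + z) * Phi (\<alpha> - 1) (Suc e) (\<lambda>z X. of_real (H \<bullet> X) * V z X) Y0 z"
  have bl: "bounded_linear ?L"
  proof -
    have "bounded_linear (\<lambda>H. complex_of_real (H \<bullet> b))" for b :: "(real^'n) \<times> real"
      by (rule bounded_linear_compose[OF bounded_linear_of_real bounded_linear_inner_left])
    then have "bounded_linear (\<lambda>H. m2 e (\<alpha> + z) * (\<Sum>b\<in>Basis. of_real (H \<bullet> b) *
        Phi (\<alpha> - 1) (Suc e) (\<lambda>z X. of_real (b \<bullet> X) * V z X) Y0 z))"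
      by (intro bounded_linear_const_mult bounded_linear_sum bounded_linear_mult_const)
    moreover have "?L = (\<lambda>H. m2 e (\<alpha> + z) * (\<Sum>b\<in>Basis. of_real (H \<bullet> b) *
        Phi (\<alpha> - 1) (Suc e) (\<lambda>z X. of_real (b \<bullet> X) * V z X) Y0 z))"
      by (intro ext arg_cong2[where f = times] refl Phi_inner_sum V Y0)
    ultimately show ?thesis by (simp only:)
  qed
  obtain \<delta> C where \<delta>: "\<delta> > 0" "C \<ge> 0"
    and C: "\<And>Y. Y \<in> ball Y0 \<delta> \<Longrightarrow> norm (Phi_rem \<alpha> e V Y0 Y z) \<le> C * (norm (Y - Y0))\<^sup>2"
  proof (rule Phi_taylor[OF V Y0, of "norm z"])
    fix \<delta> C :: real
    assume "\<delta> > 0" "C \<ge> 0" and *: "\<And>w Y. w \<in> cball 0 (norm z) \<Longrightarrow> Y \<in> ball Y0 \<delta> \<Longrightarrow>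
        norm (Phi_rem \<alpha> e V Y0 Y w) \<le> C * (norm (Y - Y0))\<^sup>2"
    show thesis
      by (rule that[OF \<open>\<delta> > 0\<close> \<open>C \<ge> 0\<close>]) (rule *, simp_all)
  qed
  show ?thesis
    unfolding has_derivative_within
  proof (intro conjI bl)
    show "((\<lambda>Y. (1 / norm (Y - Y0)) *\<^sub>R (Phi \<alpha> e V Y z - (Phi \<alpha> e V Y0 z + ?L (Y - Y0)))) \<longlongrightarrow> 0) (at Y0)"
    proof (rule Lim_null_comparison)
      show "((\<lambda>Y. C * norm (Y - Y0)) \<longlongrightarrow> 0) (at Y0)"
        by (auto intro!: tendsto_eq_intros)
      have "norm ((1 / norm (Y - Y0)) *\<^sub>R (Phi \<alpha> e V Y z - (Phi \<alpha> e V Y0 z + ?L (Y - Y0)))) \<le> C * norm (Y - Y0)"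
        if "Y \<in> ball Y0 \<delta>" "Y \<noteq> Y0" for Y
      proof -
        define A where "A = Phi \<alpha> e V Y z - (Phi \<alpha> e V Y0 z + ?L (Y - Y0))"
        have "norm A \<le> C * (norm (Y - Y0))\<^sup>2"
          using C[OF that(1)] by (simp only: A_def Phi_rem_def diff_diff_eq)
        then have "norm A / norm (Y - Y0) \<le> C * (norm (Y - Y0))\<^sup>2 / norm (Y - Y0)"
          by (intro divide_right_mono) auto
        also have "\<dots> = C * norm (Y - Y0)" by (simp add: power2_eq_square)
        finally show ?thesis unfolding A_def[symmetric] by simp
      qed
      then show "\<forall>\<^sub>F Y in at Y0. norm ((1 / norm (Y - Y0)) *\<^sub>R (Phi \<alpha> e V Y z - (Phi \<alpha> e V Y0 z + ?L (Y - Y0)))) \<le> C * norm (Y - Y0)"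
        using \<delta> by (auto simp: eventually_at dist_commute intro!: exI[of _ \<delta>])
    qed
  qed
qed

lemma ddir_Phi:
  fixes V :: "complex \<Rightarrow> (real^'n) \<times> real \<Rightarrow> complex"
  assumes "famJ \<alpha> e V" "Y \<noteq> 0"
  shows "ddir (\<lambda>Y. Phi \<alpha> e V Y z) a Y = m2 e (\<alpha> + z) * Phi (\<alpha> - 1) (Suc e) (\<lambda>z X. of_real (a \<bullet> X) * V z X) Y z"
  by (rule ddir_eqI[OF Phi_has_derivative[OF assms]])

text \<open>Each derivative is a constant times the transform of another family, since families are
  closed under multiplication by linear forms. Induction over all families at once gives every
  order.\<close>

lemma Phi_smooth:
  fixes V :: "complex \<Rightarrow> (real^'n) \<times> real \<Rightarrow> complex"
  assumes "famJ \<alpha> e V"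
  shows "smooth_off0 (\<lambda>Y. Phi \<alpha> e V Y z)"
proof -
  have "Ck_on k (\<lambda>Y. Phi \<alpha> e V Y z) (- {0})" for k
    using assms
  proof (induction k arbitrary: \<alpha> e V)
    case 0
    then show ?case
      by (auto intro!: continuous_at_imp_continuous_on has_derivative_continuous[OF Phi_has_derivative])
  next
    case (Suc k)
    have "Ck_on k (\<lambda>Y. frechet_derivative (\<lambda>Y. Phi \<alpha> e V Y z) (at Y) a) (- {0})" for a
    proof (rule Ck_on_cong)
      show "Ck_on k (\<lambda>Y. m2 e (\<alpha> + z) * Phi (\<alpha> - 1) (Suc e) (\<lambda>z X. of_real (a \<bullet> X) * V z X) Y z) (- {0})"
        by (intro Ck_on_mult Ck_on_const Suc.IH famJ_inner Suc.prems) auto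
    qed (use ddir_Phi[OF Suc.prems] in \<open>auto simp: ddir_def\<close>)
    moreover have "\<forall>Y\<in>- {0}. (\<lambda>Y. Phi \<alpha> e V Y z) differentiable (at Y)"
      by (intro ballI differentiableI[OF Phi_has_derivative[OF Suc.prems]]) simp
    ultimately show ?case by simp
  qed
  then show ?thesis by (simp add: smooth_off0_def)
qed

lemma Phi_hom:
  fixes V :: "complex \<Rightarrow> (real^'n) \<times> real \<Rightarrow> complex"
  assumes "famJ \<alpha> e V"
  shows "hom (\<alpha> + z) e (\<lambda>Y. Phi \<alpha> e V Y z)"
  unfolding hom_def using Phi_scale[OF assms] by blast

text \<open>The bound has to be uniform in \<open>z\<close> and \<open>Y\<close> together, which
  holomorphy for each single \<open>Y\<close> does not provide. The Taylor estimate gives it near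
  every \<open>Y0\<close>; compactness of the sphere and homogeneity extend it.\<close>

lemma Phi_bound:
  fixes V :: "complex \<Rightarrow> (real^'n) \<times> real \<Rightarrow> complex"
  assumes V: "famJ \<alpha> e V"
  obtains M where "M \<ge> 0" "\<And>z Y. z \<in> cball 0 R \<Longrightarrow> Y \<noteq> 0 \<Longrightarrow> norm (Phi \<alpha> e V Y z) \<le> M * norm Y powr Re (\<alpha> + z)"
proof -
  have loc: "\<exists>\<delta>>0. \<exists>C. \<forall>z\<in>cball 0 R. \<forall>Y\<in>ball Y0 \<delta>. norm (Phi \<alpha> e V Y z) \<le> C" if Y0: "Y0 \<noteq> 0" for Y0
  proof -
    obtain \<delta> C where \<delta>: "\<delta> > 0" "C \<ge> 0"
      and C: "\<And>z Y. z \<in> cball 0 R \<Longrightarrow> Y \<in> ball Y0 \<delta> \<Longrightarrow> norm (Phi_rem \<alpha> e V Y0 Y z) \<le> C * (norm (Y - Y0))\<^sup>2"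
      by (rule Phi_taylor[OF V Y0, of R], rule that)
    have h: "(\<lambda>z. Phi \<alpha> e V Y0 z) holomorphic_on UNIV"
      "\<And>b. (\<lambda>z. m2 e (\<alpha> + z) * Phi (\<alpha> - 1) (Suc e) (\<lambda>z X. of_real (b \<bullet> X) * V z X) Y0 z) holomorphic_on UNIV"
      by (intro holomorphic_intros V Y0 famJ_inner)+
    obtain A where A: "\<And>z. z \<in> cball 0 R \<Longrightarrow> norm (Phi \<alpha> e V Y0 z) \<le> A"
      by (rule bounded_on_cball[OF h(1), of 0 R], rule that)
    let ?Q = "\<lambda>b z. m2 e (\<alpha> + z) * Phi (\<alpha> - 1) (Suc e) (\<lambda>z X. of_real (b \<bullet> X) * V z X) Y0 z"
    have "\<forall>b. \<exists>B\<ge>0. \<forall>z\<in>cball 0 R. norm (?Q b z) \<le> B"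
      by (intro allI bounded_on_cball_ex h(2))
    then obtain B where "\<forall>b. B b \<ge> 0 \<and> (\<forall>z\<in>cball 0 R. norm (?Q b z) \<le> B b)"
      by (rule choice[THEN exE])
    then have B: "B b \<ge> 0" "z \<in> cball 0 R \<Longrightarrow> norm (?Q b z) \<le> B b" for b z by blast+
    have "norm (Phi \<alpha> e V Y z) \<le> A + (\<Sum>b\<in>Basis. \<delta> * B b) + C * \<delta>\<^sup>2" if z: "z \<in> cball 0 R" and Y: "Y \<in> ball Y0 \<delta>" for z Y
    proof -
      let ?H = "Y - Y0"
      have H: "norm ?H \<le> \<delta>" using Y by (simp add: dist_norm norm_minus_commute)
      have "m2 e (\<alpha> + z) * Phi (\<alpha> - 1) (Suc e) (\<lambda>z X. of_real (?H \<bullet> X) * V z X) Y0 z =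
        (\<Sum>b\<in>Basis. of_real (?H \<bullet> b) * (m2 e (\<alpha> + z) * Phi (\<alpha> - 1) (Suc e) (\<lambda>z X. of_real (b \<bullet> X) * V z X) Y0 z))"
        unfolding Phi_inner_sum[OF V Y0, of ?H] by (simp add: sum_distrib_left mult_ac)
      also have "norm \<dots> \<le> (\<Sum>b\<in>Basis. \<delta> * B b)"
      proof (rule sum_norm_le)
        fix b :: "(real^'n) \<times> real" assume b: "b \<in> Basis"
        show "norm (of_real (?H \<bullet> b) * (m2 e (\<alpha> + z) * Phi (\<alpha> - 1) (Suc e) (\<lambda>z X. of_real (b \<bullet> X) * V z X) Y0 z)) \<le> \<delta> * B b"
          unfolding norm_mult[of "of_real (?H \<bullet> b)"] norm_of_real
          by (intro mult_mono order_trans[OF Basis_le_norm[OF b] H] B z) (use \<delta> in auto)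
      qed
      finally have 1: "norm (m2 e (\<alpha> + z) * Phi (\<alpha> - 1) (Suc e) (\<lambda>z X. of_real (?H \<bullet> X) * V z X) Y0 z) \<le> (\<Sum>b\<in>Basis. \<delta> * B b)" .
      have 2: "norm (Phi_rem \<alpha> e V Y0 Y z) \<le> C * \<delta>\<^sup>2"
        using C[OF z Y] mult_left_mono[OF power_mono[OF H, of 2], of C] \<delta> by simp
      have "Phi \<alpha> e V Y z = Phi \<alpha> e V Y0 z + m2 e (\<alpha> + z) * Phi (\<alpha> - 1) (Suc e) (\<lambda>z X. of_real (?H \<bullet> X) * V z X) Y0 z + Phi_rem \<alpha> e V Y0 Y z"
        by (simp add: Phi_rem_def)
      also have "norm \<dots> \<le> A + (\<Sum>b\<in>Basis. \<delta> * B b) + C * \<delta>\<^sup>2"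
        by (intro norm_triangle_le add_mono A z 1 2)
      finally show ?thesis .
    qed
    then show ?thesis using \<delta> by blast
  qed
  let ?S = "sphere (0 :: (real^'n) \<times> real) 1"
  have "\<exists>\<delta> C. Y0 \<in> ?S \<longrightarrow> \<delta> > 0 \<and> (\<forall>z\<in>cball 0 R. \<forall>Y\<in>ball Y0 \<delta>. norm (Phi \<alpha> e V Y z) \<le> C)" for Y0
    using loc[of Y0] by (cases "Y0 = 0") auto
  then obtain \<delta> C where \<delta>: "\<And>Y0. Y0 \<in> ?S \<Longrightarrow> \<delta> Y0 > 0"
    "\<And>Y0 z Y. Y0 \<in> ?S \<Longrightarrow> z \<in> cball 0 R \<Longrightarrow> Y \<in> ball Y0 (\<delta> Y0) \<Longrightarrow> norm (Phi \<alpha> e V Y z) \<le> C Y0"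
    by metis
  have "?S \<subseteq> (\<Union>Y0\<in>?S. ball Y0 (\<delta> Y0))" using \<delta>(1) by auto
  then obtain F where F: "F \<subseteq> ?S" "finite F" "?S \<subseteq> (\<Union>Y0\<in>F. ball Y0 (\<delta> Y0))"
    by (rule compactE_image[OF compact_sphere[of 0 1] open_ball])
  define M where "M = (\<Sum>Y0\<in>F. \<bar>C Y0\<bar>)"
  have M0: "M \<ge> 0" by (simp add: M_def sum_nonneg)
  have sph: "norm (Phi \<alpha> e V Y z) \<le> M" if Y: "Y \<in> ?S" and z: "z \<in> cball 0 R" for Y z
  proof -
    obtain Y0 where Y0: "Y0 \<in> F" "Y \<in> ball Y0 (\<delta> Y0)" using F(3) Y by blast
    then have "norm (Phi \<alpha> e V Y z) \<le> \<bar>C Y0\<bar>" using \<delta>(2)[of Y0 z Y] F(1) z by force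
    also have "\<dots> \<le> M" unfolding M_def using Y0(1) F(2) by (intro member_le_sum) auto
    finally show ?thesis .
  qed
  have "norm (Phi \<alpha> e V Y z) \<le> M * norm Y powr Re (\<alpha> + z)" if Y: "Y \<noteq> 0" and z: "z \<in> cball 0 R" for Y z
  proof -
    have "Phi \<alpha> e V Y z = spow (\<alpha> + z) e (norm Y) * Phi \<alpha> e V ((1 / norm Y) *\<^sub>R Y) z"
      using Phi_scale[OF V, of "(1 / norm Y) *\<^sub>R Y" "norm Y" z] Y by simp
    then show ?thesis
      using sph[of "(1 / norm Y) *\<^sub>R Y" z] z Y by (simp add: norm_mult norm_spow mult.commute mult_left_mono)
  qed
  then show ?thesis using M0 that by blast
qed

lemma Phi_measurable: "famJ \<alpha> e V \<Longrightarrow> (\<lambda>Y. Phi \<alpha> e V Y z) \<in> borel_measurable borel"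
  by (rule measurable_off0[OF smooth_off0_continuous[OF Phi_smooth]])

section \<open>Symmetry of the transform\<close>

text \<open>Fubini's theorem and the symmetry of the kernel in \<open>X\<close> and
  \<open>Y\<close>; a multiple of the product of two invariant densities dominates the
  integrand.\<close>

lemma J_pairing:
  fixes V W :: "(real^'n) \<times> real \<Rightarrow> complex"
  assumes V: "smooth_off0 V" "hom (- of_nat (Suc CARD('n)) - \<alpha>) e V"
    and W: "smooth_off0 W" "hom (- of_nat (Suc CARD('n)) - \<alpha>) e W" and \<alpha>: "Re \<alpha> \<ge> 0"
  shows "chart_int (\<lambda>Y. J \<alpha> e V Y * W Y) = chart_int (\<lambda>X. V X * J \<alpha> e W X)"
proof -
  have mV[measurable]: "V \<in> borel_measurable borel" and mW[measurable]: "W \<in> borel_measurable borel"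
    using V W measurable_off0 smooth_off0_continuous by blast+
  obtain M where M: "M \<ge> 0" "\<And>X. X \<noteq> 0 \<Longrightarrow> norm (V X) \<le> M * norm X powr (- real (Suc CARD('n)) - Re \<alpha>)"
    using hom_bound_J[OF V] by blast
  obtain N where N: "N \<ge> 0" "\<And>X. X \<noteq> 0 \<Longrightarrow> norm (W X) \<le> N * norm X powr (- real (Suc CARD('n)) - Re \<alpha>)"
    using hom_bound_J[OF W] by blast
  let ?F = "\<lambda>(y::real^'n, x::real^'n). spow \<alpha> e ((x, 1::real) \<bullet> (y, 1::real)) * V (x, 1) * W (y, 1)"
  let ?B = "\<lambda>(y::real^'n, x::real^'n). M * N * (wt y * wt x)"
  have B: "integrable (lborel \<Otimes>\<^sub>M lborel) ?B"
  proof (rule lborel_pair.Fubini_integrable)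
    show "?B \<in> borel_measurable (lborel \<Otimes>\<^sub>M lborel)" by (simp add: case_prod_unfold) measurable
    have "(\<integral>x. norm (?B (y, x)) \<partial>lborel) = M * N * (wt y * (\<integral>x. wt (x::real^'n) \<partial>lborel))" for y
      using M N by simp
    then show "integrable lborel (\<lambda>y. \<integral>x. norm (?B (y, x)) \<partial>lborel)"
      using integrable_wt[where 'n = 'n] by simp
    show "AE y in lborel. integrable lborel (\<lambda>x. ?B (y, x))"
      using integrable_wt[where 'n = 'n] by simp
  qed
  have bd: "norm (?F (y, x)) \<le> ?B (y, x)" for y x
  proof -
    have "norm (?F (y, x)) \<le> (M * norm (y, 1::real) powr Re \<alpha> * wt x) * (N * norm (y, 1::real) powr (- real (Suc CARD('n)) - Re \<alpha>))"
      unfolding case_prod_conv norm_mult[of _ "W (y, 1)"]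
      by (intro mult_mono J_bound(3)[OF mV M(2) \<alpha>] N(2) mult_nonneg_nonneg M(1)) auto
    also have "\<dots> = M * N * ((norm (y, 1::real) powr Re \<alpha> * norm (y, 1::real) powr (- real (Suc CARD('n)) - Re \<alpha>)) * wt x)"
      by (simp add: mult_ac)
    also have "norm (y, 1::real) powr Re \<alpha> * norm (y, 1::real) powr (- real (Suc CARD('n)) - Re \<alpha>) = wt y"
      unfolding powr_add[symmetric] by (rule arg_cong[of _ _ "\<lambda>s. norm (y, 1::real) powr s"]) simp
    finally show ?thesis by simp
  qed
  have F: "integrable (lborel \<Otimes>\<^sub>M lborel) ?F"
  proof (rule Bochner_Integration.integrable_bound[OF B])
    show "?F \<in> borel_measurable (lborel \<Otimes>\<^sub>M lborel)" by (simp add: case_prod_unfold) measurable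
    show "AE p in lborel \<Otimes>\<^sub>M lborel. norm (?F p) \<le> norm (?B p)"
      by (rule AE_I2) (use bd in \<open>auto intro: order_trans[OF _ abs_ge_self]\<close>)
  qed
  have "chart_int (\<lambda>Y. J \<alpha> e V Y * W Y) = (\<integral>y. (\<integral>x. ?F (y, x) \<partial>lborel) \<partial>lborel)"
    by (simp add: chart_int_def J_def)
  also have "\<dots> = (\<integral>x. (\<integral>y. ?F (y, x) \<partial>lborel) \<partial>lborel)"
    using lborel_pair.Fubini_integral[of "\<lambda>y x. ?F (y, x)"] F by (simp add: case_prod_unfold)
  also have "\<dots> = (\<integral>x. (\<integral>y. V (x, 1) * (spow \<alpha> e ((y, 1::real) \<bullet> (x, 1::real)) * W (y, 1)) \<partial>lborel) \<partial>lborel)"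
    by (simp add: mult_ac inner_commute)
  also have "\<dots> = chart_int (\<lambda>X. V X * J \<alpha> e W X)"
    by (simp add: chart_int_def J_def)
  finally show ?thesis .
qed

lemma Phi_pairing_holomorphic:
  fixes V W :: "complex \<Rightarrow> (real^'n) \<times> real \<Rightarrow> complex"
  assumes V: "famJ \<alpha> e V" and W: "famJ \<alpha> e W"
  shows "(\<lambda>z. chart_int (\<lambda>Y. Phi \<alpha> e V Y z * W z Y)) holomorphic_on UNIV"
  unfolding chart_int_def
proof (rule holomorphic_integral)
  fix z :: complex
  note [measurable] = Phi_measurable[OF V] famJ_measurable[OF W]
  show "(\<lambda>x. Phi \<alpha> e V (x, 1) z * W z (x, 1)) \<in> borel_measurable lborel" by measurable
  obtain M where M: "M \<ge> 0" "\<And>w Y. w \<in> cball 0 (norm z + 1) \<Longrightarrow> Y \<noteq> 0 \<Longrightarrow> norm (Phi \<alpha> e V Y w) \<le> M * norm Y powr Re (\<alpha> + w)"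
    by (rule Phi_bound[OF V, of "norm z + 1"], rule that)
  obtain N where N: "N \<ge> 0" "\<And>w X. w \<in> cball 0 (norm z + 1) \<Longrightarrow> X \<noteq> 0 \<Longrightarrow>
      norm (W w X) \<le> N * norm X powr (- real (Suc CARD('n)) - Re (\<alpha> + w))"
    by (rule famJ_bound[OF W compact_cball[of 0 "norm z + 1"]], rule that)
  show "\<exists>r>0. \<exists>g. cball z r \<subseteq> UNIV \<and> integrable lborel g \<and>
      (\<forall>w\<in>cball z r. \<forall>x\<in>space lborel. norm (Phi \<alpha> e V (x, 1) w * W w (x, 1)) \<le> g x)"
  proof (intro exI conjI ballI)
    show "integrable lborel (\<lambda>x::real^'n. M * N * wt x)"
      by (rule integrable_mult_right[OF integrable_wt])
    fix w and x :: "real^'n" assume "w \<in> cball z 1"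
    then have w: "w \<in> cball 0 (norm z + 1)"
      using norm_triangle_ineq2[of w z] by (simp add: dist_norm norm_minus_commute)
    have "norm (Phi \<alpha> e V (x, 1) w * W w (x, 1)) \<le> (M * norm (x, 1::real) powr Re (\<alpha> + w)) *
        (N * norm (x, 1::real) powr (- real (Suc CARD('n)) - Re (\<alpha> + w)))"
      unfolding norm_mult by (intro mult_mono M(2) N(2) w mult_nonneg_nonneg M(1)) auto
    also have "\<dots> = M * N * (norm (x, 1::real) powr Re (\<alpha> + w) * norm (x, 1::real) powr (- real (Suc CARD('n)) - Re (\<alpha> + w)))"
      by (simp add: mult_ac)
    also have "norm (x, 1::real) powr Re (\<alpha> + w) * norm (x, 1::real) powr (- real (Suc CARD('n)) - Re (\<alpha> + w)) = wt x"
      unfolding powr_add[symmetric] by (rule arg_cong[of _ _ "\<lambda>s. norm (x, 1::real) powr s"]) simp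
    finally show "norm (Phi \<alpha> e V (x, 1) w * W w (x, 1)) \<le> M * N * wt x" .
  qed auto
next
  show "(\<lambda>z. Phi \<alpha> e V (x, 1) z * W z (x, 1)) holomorphic_on UNIV" for x :: "real^'n"
    by (intro holomorphic_intros V fam_holomorphic[OF W]) auto
qed auto

text \<open>Both sides are entire in \<open>z\<close>, by the locally uniform bounds of
  \<open>Phi_bound\<close>, and they agree where the integrals converge.\<close>

lemma Phi_pairing:
  fixes V W :: "complex \<Rightarrow> (real^'n) \<times> real \<Rightarrow> complex"
  assumes V: "famJ \<alpha> e V" and W: "famJ \<alpha> e W"
  shows "chart_int (\<lambda>Y. Phi \<alpha> e V Y z * W z Y) = chart_int (\<lambda>X. V z X * Phi \<alpha> e W X z)"
proof -
  have "(\<lambda>z. chart_int (\<lambda>Y. Phi \<alpha> e V Y z * W z Y)) = (\<lambda>z. chart_int (\<lambda>X. Phi \<alpha> e W X z * V z X))"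
  proof (rule entire_eqI[where \<alpha> = \<alpha> and c = 0])
    fix z assume z: "Re (\<alpha> + z) > 0"
    have e1: "chart_int (\<lambda>Y. Phi \<alpha> e V Y z * W z Y) = nf e (\<alpha> + z) * chart_int (\<lambda>Y. J (\<alpha> + z) e (V z) Y * W z Y)"
      unfolding chart_int_def by (simp add: Phi_eq_J[OF V _ z] mult.assoc)
    have e2: "chart_int (\<lambda>X. Phi \<alpha> e W X z * V z X) = nf e (\<alpha> + z) * chart_int (\<lambda>X. V z X * J (\<alpha> + z) e (W z) X)"
      unfolding chart_int_def by (simp add: Phi_eq_J[OF W _ z] mult_ac)
    show "chart_int (\<lambda>Y. Phi \<alpha> e V Y z * W z Y) = chart_int (\<lambda>X. Phi \<alpha> e W X z * V z X)"
      unfolding e1 e2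
      by (subst J_pairing[OF fam_smooth[OF V] famJ_hom[OF V] fam_smooth[OF W] famJ_hom[OF W]]) (use z in simp_all)
  qed (intro Phi_pairing_holomorphic V W)+
  from fun_cong[OF this, of z] show ?thesis by (simp add: mult.commute)
qed

section \<open>Transforms of the lowest zonal functions\<close>

lemma famJ_npow: "famJ \<alpha> 0 (\<lambda>z. npow (- of_nat (Suc CARD('n)) - (\<alpha> + z)) :: (real^'n) \<times> real \<Rightarrow> complex)"
proof (rule fam_cong[OF fam_base])
  show "smooth_off0 (npow (- of_nat (Suc CARD('n)) - \<alpha>) :: (real^'n) \<times> real \<Rightarrow> complex)"
    "hom (- of_nat (Suc CARD('n)) - \<alpha>) 0 (npow (- of_nat (Suc CARD('n)) - \<alpha>) :: (real^'n) \<times> real \<Rightarrow> complex)"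
    by (rule smooth_off0_npow hom_npow)+
  show "npow (- z) X * npow (- of_nat (Suc CARD('n)) - \<alpha>) X = npow (- of_nat (Suc CARD('n)) - (\<alpha> + z)) X"
    for z and X :: "(real^'n) \<times> real"
    unfolding npow_add[symmetric] by (rule arg_cong[of _ _ "\<lambda>s. npow s X"]) simp
qed

lemma dim_chart_ge_2: "DIM((real^'n) \<times> real) \<ge> 2"
  using zero_less_card_finite[where 'a = 'n] by (simp add: Suc_le_eq)

text \<open>The hypothesis \<open>rot\<close> says that the infinitesimal rotations annihilate
  \<open>G\<close>. With Euler's relation it determines the gradient, so that
  \<open>npow (- s) Y * G Y\<close> has derivative 0 on punctured space, which is connected in
  dimension at least 2.\<close>

lemma rotation_invariant_npow:
  fixes G :: "(real^'n) \<times> real \<Rightarrow> complex"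
  assumes G: "smooth_off0 G" "hom s e G"
    and rot: "\<And>a b Y. Y \<noteq> 0 \<Longrightarrow> of_real (b \<bullet> Y) * ddir G a Y = of_real (a \<bullet> Y) * ddir G b Y"
    and Y: "Y \<noteq> 0"
  shows "G Y = G (0, 1) * npow s Y"
proof -
  have D: "ddir (\<lambda>Y. npow (- s) Y * G Y) a Y = 0" if Y: "Y \<noteq> 0" for a Y
  proof -
    have q: "complex_of_real (Y \<bullet> Y) \<noteq> 0" using Y by simp
    have 1: "of_real (Y \<bullet> Y) * ddir G a Y = of_real (a \<bullet> Y) * (s * G Y)"
      using rot[OF Y, of Y a] hom_Euler[OF G Y] by simp
    have 2: "npow (- s) Y = npow (- s - 2) Y * of_real (Y \<bullet> Y)"
      using npow_add[of "- s - 2" 2 Y] npow_2[OF Y] by simp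
    have "ddir (\<lambda>Y. npow (- s) Y * G Y) a Y = npow (- s) Y * ddir G a Y + - s * of_real (a \<bullet> Y) * npow (- s - 2) Y * G Y"
      by (simp add: ddir_mult[OF smooth_off0_npow G(1) Y] ddir_npow[OF Y])
    also have "\<dots> = npow (- s - 2) Y * (of_real (Y \<bullet> Y) * ddir G a Y - of_real (a \<bullet> Y) * (s * G Y))"
      unfolding 2 by (simp add: algebra_simps)
    finally show ?thesis unfolding 1 by simp
  qed
  have sm: "smooth_off0 (\<lambda>Y. npow (- s) Y * G Y)" by (intro smooth_off0_mult smooth_off0_npow G)
  have e: "(0, 1::real) \<in> - {0 :: (real^'n) \<times> real}" by simp
  have "npow (- s) Y * G Y = npow (- s) (0 :: real^'n, 1::real) * G (0, 1)"
  proof (rule has_derivative_zero_unique_connected[of "- {0}" "\<lambda>Y. npow (- s) Y * G Y" Y "(0, 1)"])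
    show "open (- {0 :: (real^'n) \<times> real})" by (simp add: open_Compl)
    show "connected (- {0 :: (real^'n) \<times> real})" by (rule connected_punctured_universe[OF dim_chart_ge_2])
    show "((\<lambda>Y. npow (- s) Y * G Y) has_derivative (\<lambda>h. 0)) (at X)" if "X \<in> - {0}" for X
      using smooth_off0_has_derivative[OF sm, of X] D that by simp
  qed (use Y e in auto)
  also have "npow (- s) (0 :: real^'n, 1::real) = 1" by (simp add: npow_def norm_Pair)
  finally have 1: "npow (- s) Y * G Y = G (0, 1)" by simp
  have "npow s Y * npow (- s) Y = 1"
    using npow_add[of s "- s" Y] npow_0[OF Y] by simp
  then have "G Y = npow s Y * (npow (- s) Y * G Y)"
    by (simp flip: mult.assoc)
  then show ?thesis unfolding 1 by (simp only: mult.commute)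
qed

lemma Gamma_half_nonzero:
  assumes "(0::real) < t"
  shows "Gamma ((t + 1) / 2) \<noteq> 0"
proof -
  have "0 < (t + 1) / 2" using assms by simp
  from Gamma_real_pos[OF this] show ?thesis by simp
qed

lemma cancel_inverse_middle: "(g::real) \<noteq> 0 \<Longrightarrow> inverse g * (a * g / h) = a * inverse h"
  by (simp add: divide_inverse)

text \<open>For a radial function, the linear form of \<open>a\<close> times the derivative along
  \<open>b\<close> is symmetric in \<open>a\<close> and \<open>b\<close>. So
  \<open>Phi_inner_ddir\<close> shows that the transform is rotation invariant, and only a constant
  has to be found.\<close>

lemma Phi_npow:
  fixes Y :: "(real^'n) \<times> real"
  assumes Y: "Y \<noteq> 0"
  shows "Phi \<alpha> 0 (\<lambda>z. npow (- of_nat (Suc CARD('n)) - (\<alpha> + z))) Y z =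
    of_real (pi powr (CARD('n) / 2)) * rGamma ((\<alpha> + z + of_nat (Suc CARD('n))) / 2) * npow (\<alpha> + z) Y"
proof -
  let ?V = "\<lambda>z. npow (- of_nat (Suc CARD('n)) - (\<alpha> + z)) :: (real^'n) \<times> real \<Rightarrow> complex"
  note V = famJ_npow[of \<alpha>, where 'n = 'n]
  let ?c = "\<lambda>z. Phi \<alpha> 0 ?V (0, 1) z"
  let ?g = "\<lambda>z. of_real (pi powr (CARD('n) / 2)) * rGamma ((\<alpha> + z + of_nat (Suc CARD('n))) / 2)"
  have G: "Phi \<alpha> 0 ?V Y z = ?c z * npow (\<alpha> + z) Y"
  proof (rule rotation_invariant_npow[OF Phi_smooth[OF V] Phi_hom[OF V] _ Y])
    fix a b Y :: "(real^'n) \<times> real" assume Y: "Y \<noteq> 0"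
    have sym: "Phi \<alpha> 0 (\<lambda>z X. of_real (a \<bullet> X) * ddir (?V z) b X) = Phi \<alpha> 0 (\<lambda>z X. of_real (b \<bullet> X) * ddir (?V z) a X)"
      by (rule Phi_cong) (simp add: ddir_npow)
    show "of_real (b \<bullet> Y) * ddir (\<lambda>Y. Phi \<alpha> 0 ?V Y z) a Y = of_real (a \<bullet> Y) * ddir (\<lambda>Y. Phi \<alpha> 0 ?V Y z) b Y"
      using Phi_inner_ddir[OF V Y, of z b a] Phi_inner_ddir[OF V Y, of z a b]
      unfolding ddir_Phi[OF V Y] sym by (simp add: mult_ac inner_commute)
  qed
  \<comment> \<open>At \<open>(0, 1)\<close> the kernel is constantly 1 on the chart, and the
    integral is that of \<open>has_bochner_integral_chart_norm\<close>, known for real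
    exponents.\<close>
  have real: "?c z = ?g z" if z: "\<alpha> + z = of_real t" and t: "t > 0" for z t
  proof -
    have s: "real CARD('n) < real (Suc CARD('n)) + t" using t by simp
    have e: "(x, 1::real) \<bullet> (0, 1::real) = 1" for x :: "real^'n" by (simp add: inner_Pair)
    have "J (\<alpha> + z) 0 (?V z) (0, 1) = (\<integral>x. of_real (norm (x :: real^'n, 1::real) powr (- (real (Suc CARD('n)) + t))) \<partial>lborel)"
      unfolding J_def chart_int_def e spow_1 z npow_def
      by (rule Bochner_Integration.integral_cong[OF refl]) (simp add: powr_of_real[symmetric] algebra_simps)
    also have "\<dots> = of_real (pi powr (CARD('n) / 2) * Gamma ((real (Suc CARD('n)) + t - CARD('n)) / 2) / Gamma ((real (Suc CARD('n)) + t) / 2))"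
      using has_bochner_integral_chart_norm[OF s] by (simp add: has_bochner_integral_iff del: of_nat_Suc)
    also have "(real (Suc CARD('n)) + t - CARD('n)) / 2 = (t + 1) / 2" by simp
    finally have "J (\<alpha> + z) 0 (?V z) (0, 1) = of_real (pi powr (CARD('n) / 2) * Gamma ((t + 1) / 2) / Gamma ((real (Suc CARD('n)) + t) / 2))" .
    moreover have "Re (\<alpha> + z) > 0" using z t by (simp del: plus_complex.sel)
    ultimately have 1: "?c z = nf 0 (of_real t) * of_real (pi powr (CARD('n) / 2) * Gamma ((t + 1) / 2) / Gamma ((real (Suc CARD('n)) + t) / 2))"
      using Phi_eq_J[OF V, of "(0, 1)" z] by (simp only: z chart_nonzero simp_thms)
    have 2: "nf 0 (of_real t) = of_real (inverse (Gamma ((t + 1) / 2)))"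
      using rGamma_complex_of_real[of "(t + 1) / 2"] by (simp add: nf_def rGamma_inverse_Gamma)
    have 3: "?g z = of_real (pi powr (CARD('n) / 2) * inverse (Gamma ((real (Suc CARD('n)) + t) / 2)))"
    proof -
      have "(\<alpha> + z + of_nat (Suc CARD('n))) / 2 = of_real ((real (Suc CARD('n)) + t) / 2)"
        unfolding z by simp
      moreover have "rGamma (of_real x :: complex) = of_real (inverse (Gamma x))" for x :: real
        by (subst rGamma_complex_of_real) (simp only: rGamma_inverse_Gamma)
      ultimately show ?thesis by (simp only: of_real_mult)
    qed
    have 4: "inverse (Gamma ((t + 1) / 2)) * (pi powr (CARD('n) / 2) * Gamma ((t + 1) / 2) / Gamma ((real (Suc CARD('n)) + t) / 2)) =
      pi powr (CARD('n) / 2) * inverse (Gamma ((real (Suc CARD('n)) + t) / 2))"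
      by (rule cancel_inverse_middle[OF Gamma_half_nonzero[OF t]])
    have "?c z = of_real (inverse (Gamma ((t + 1) / 2))) * of_real (pi powr (CARD('n) / 2) * Gamma ((t + 1) / 2) / Gamma ((real (Suc CARD('n)) + t) / 2))"
      by (rule trans[OF 1 arg_cong2[where f = times, OF 2 refl]])
    also have "\<dots> = of_real (pi powr (CARD('n) / 2) * inverse (Gamma ((real (Suc CARD('n)) + t) / 2)))"
      by (rule trans[OF of_real_mult[symmetric] arg_cong[where f = of_real, OF 4]])
    finally show ?thesis by (rule trans[OF _ 3[symmetric]])
  qed
  \<comment> \<open>The values on a half line, which has the limit point
    \<open>1 - \<alpha>\<close>, determine the entire function.\<close>
  have "?c z - ?g z = 0"
  proof (rule analytic_continuation[of "\<lambda>z. ?c z - ?g z" UNIV "{z. \<exists>t>0. \<alpha> + z = of_real t}" "1 - \<alpha>"])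
    show "(\<lambda>z. ?c z - ?g z) holomorphic_on UNIV"
      by (intro holomorphic_intros V) auto
    show "1 - \<alpha> islimpt {z. \<exists>t>0. \<alpha> + z = of_real t}"
      unfolding islimpt_approachable
    proof (intro allI impI)
      fix e :: real assume "e > 0"
      then show "\<exists>x'\<in>{z. \<exists>t>0. \<alpha> + z = of_real t}. x' \<noteq> 1 - \<alpha> \<and> dist x' (1 - \<alpha>) < e"
        by (intro bexI[of _ "of_real (1 + e / 2) - \<alpha>"])
          (auto simp: dist_norm intro!: exI[of _ "1 + e / 2"])
    qed
    show "?c z - ?g z = 0" if "z \<in> {z. \<exists>t>0. \<alpha> + z = of_real t}" for z
      using that real by auto
  qed auto
  then show ?thesis unfolding G by simp
qed

text \<open>The radial formula for the exponent \<open>\<alpha> + 1\<close> is differentiated in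
  direction \<open>v\<close>. Both sides then carry the factor \<open>\<alpha> + 1 + z\<close>,
  which is nonzero on a half plane.\<close>

lemma Phi_inner_npow:
  fixes Y :: "(real^'n) \<times> real"
  assumes Y: "Y \<noteq> 0"
  shows "Phi \<alpha> (Suc 0) (\<lambda>z X. of_real (v \<bullet> X) * npow (- of_nat (Suc CARD('n)) - (\<alpha> + 1 + z)) X) Y z =
    of_real (pi powr (CARD('n) / 2)) * rGamma ((\<alpha> + 1 + z + of_nat (Suc CARD('n))) / 2) * (of_real (v \<bullet> Y) * npow (\<alpha> + z - 1) Y)"
proof -
  let ?V = "\<lambda>z. npow (- of_nat (Suc CARD('n)) - (\<alpha> + 1 + z)) :: (real^'n) \<times> real \<Rightarrow> complex"
  let ?C = "\<lambda>z. of_real (pi powr (CARD('n) / 2)) * rGamma ((\<alpha> + 1 + z + of_nat (Suc CARD('n))) / 2)"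
  note V = famJ_npow[of "\<alpha> + 1", where 'n = 'n]
  have V1: "famJ \<alpha> (Suc 0) (\<lambda>z X. of_real (v \<bullet> X) * ?V z X)"
    using famJ_inner[OF V, of v] by simp
  have "(\<lambda>z. Phi \<alpha> (Suc 0) (\<lambda>z X. of_real (v \<bullet> X) * ?V z X) Y z) = (\<lambda>z. ?C z * (of_real (v \<bullet> Y) * npow (\<alpha> + z - 1) Y))"
  proof (rule entire_eqI[where \<alpha> = \<alpha> and c = 0])
    fix z assume z: "Re (\<alpha> + z) > 0"
    have "Re (\<alpha> + 1 + z) \<noteq> 0" using z by simp
    then have nz: "\<alpha> + 1 + z \<noteq> 0" by (metis zero_complex.sel(1))
    have "(\<alpha> + 1 + z) * Phi \<alpha> (Suc 0) (\<lambda>z X. of_real (v \<bullet> X) * ?V z X) Y z = ddir (\<lambda>Y. Phi (\<alpha> + 1) 0 ?V Y z) v Y"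
    proof -
      have "m2 0 s = s" for s by (simp add: m2_def m1_def)
      then show ?thesis unfolding ddir_Phi[OF V Y] by (simp only: add_diff_cancel_right')
    qed
    also have "\<dots> = ddir (\<lambda>Y. ?C z * npow (\<alpha> + 1 + z) Y) v Y"
      by (rule ddir_cong[OF _ Y]) (rule Phi_npow)
    also have "\<dots> = (\<alpha> + 1 + z) * (?C z * (of_real (v \<bullet> Y) * npow (\<alpha> + 1 + z - 2) Y))"
      unfolding ddir_cmult[OF smooth_off0_npow Y] ddir_npow[OF Y] by (simp only: mult_ac)
    also have "\<alpha> + 1 + z - 2 = \<alpha> + z - 1" by simp
    finally show "Phi \<alpha> (Suc 0) (\<lambda>z X. of_real (v \<bullet> X) * ?V z X) Y z = ?C z * (of_real (v \<bullet> Y) * npow (\<alpha> + z - 1) Y)"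
      by (rule mult_left_cancel[OF nz, THEN iffD1])
  next
    show "(\<lambda>z. ?C z * (of_real (v \<bullet> Y) * npow (\<alpha> + z - 1) Y)) holomorphic_on UNIV"
      using Y by (auto simp: npow_def intro!: holomorphic_intros)
  qed (rule Phi_holomorphic'[OF V1 Y])
  then show ?thesis by (rule fun_cong)
qed

section \<open>Inversion of theta\<close>

text \<open>The value at 0 depends only on the member \<open>V 0\<close> and not on the way of
  regularizing. The proof follows the construction of families; an entire coefficient
  \<open>g\<close> enters through \<open>g 0\<close>.\<close>

lemma Phi_at_0:
  fixes V :: "complex \<Rightarrow> (real^'n) \<times> real \<Rightarrow> complex"
  assumes "famJ \<alpha> e V" "Y \<noteq> 0"
  shows "Phi \<alpha> e V Y 0 = Phi \<alpha> e (\<lambda>z X. npow (- z) X * V 0 X) Y 0"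
proof -
  let ?\<kappa> = "- of_nat (Suc CARD('n)) - \<alpha>"
  have b: "fam ?\<kappa> e (\<lambda>z X. npow (- z) X * V 0 X)" if "fam ?\<kappa> e V" for V :: "complex \<Rightarrow> (real^'n) \<times> real \<Rightarrow> complex"
    using fam_hom[OF that, of 0] by (intro fam_base fam_smooth[OF that]) simp
  from assms(1) show ?thesis
  proof induction
    case (fam_base V)
    show ?case
      by (rule fun_cong[OF fun_cong[OF Phi_cong]]) (simp add: npow_0)
  next
    case (fam_add V W)
    show ?case
      unfolding Phi_add[OF fam_add(1,2) assms(2)] fam_add.IH ring_distribs
      by (rule Phi_add[OF b[OF fam_add(1)] b[OF fam_add(2)] assms(2), symmetric])
  next
    case (fam_mult V g)
    show ?case
      unfolding Phi_mult[OF fam_mult(1,2) assms(2)] fam_mult.IH mult.left_commute[of _ "g 0"]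
      by (rule Phi_cmult[OF b[OF fam_mult(1)] assms(2), symmetric])
  next
    case (fam_cong V W)
    have "Phi \<alpha> e V = Phi \<alpha> e W"
      by (rule Phi_cong) (rule fam_cong(2))
    moreover have "Phi \<alpha> e (\<lambda>z X. npow (- z) X * V 0 X) = Phi \<alpha> e (\<lambda>z X. npow (- z) X * W 0 X)"
      by (rule Phi_cong) (simp add: fam_cong(2))
    ultimately show ?case using fam_cong.IH by simp
  qed
qed

definition SV :: "complex \<Rightarrow> nat \<Rightarrow> ((real^'n) \<times> real \<Rightarrow> complex) \<Rightarrow> bool" where
  "SV \<nu> e U \<longleftrightarrow> smooth_off0 U \<and> hom (- (of_nat (Suc CARD('n)) / 2) - \<nu>) e U"

lemma SV_add: "SV \<nu> e U \<Longrightarrow> SV \<nu> e W \<Longrightarrow> SV \<nu> e (\<lambda>X. U X + W X)"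
  unfolding SV_def by (auto intro: smooth_off0_add hom_add)

lemma SV_cmult: "SV \<nu> e U \<Longrightarrow> SV \<nu> e (\<lambda>X. c * U X)"
  unfolding SV_def by (auto intro: smooth_off0_cmult hom_cmult)

lemma SV_inner_ddir:
  fixes U :: "(real^'a) \<times> real \<Rightarrow> complex"
  assumes "SV \<nu> e U"
  shows "SV \<nu> e (\<lambda>X. of_real (a \<bullet> X) * ddir U b X)"
  unfolding SV_def
proof
  show "smooth_off0 (\<lambda>X. of_real (a \<bullet> X) * ddir U b X)"
    using assms unfolding SV_def by (intro smooth_off0_mult smooth_off0_inner smooth_off0_ddir) auto
  have "hom (1 + (- (of_nat (Suc CARD('a)) / 2) - \<nu> - 1)) (Suc 0 + Suc e) (\<lambda>X. of_real (a \<bullet> X) * ddir U b X)"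
    using assms unfolding SV_def by (intro hom_mult hom_inner hom_ddir) auto
  then have "hom (- (of_nat (Suc CARD('a)) / 2) - \<nu>) (Suc 0 + Suc e) (\<lambda>X. of_real (a \<bullet> X) * ddir U b X)"
    by (simp only: add.commute[of 1] diff_add_cancel)
  then show "hom (- (of_nat (Suc CARD('a)) / 2) - \<nu>) e (\<lambda>X. of_real (a \<bullet> X) * ddir U b X)"
    by (rule hom_parity) simp
qed

text \<open>On the chart, \<open>npow (- z)\<close> is the regularizing factor
  \<open>(1 + x \<bullet> x) powr (- z / 2)\<close> of \<open>kernel_op\<close>.\<close>

abbreviation (input) homfam :: "((real^'n) \<times> real \<Rightarrow> complex) \<Rightarrow> complex \<Rightarrow> (real^'n) \<times> real \<Rightarrow> complex" where
  "homfam U \<equiv> \<lambda>z X. npow (- z) X * U X"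

lemma SV_fam:
  fixes U :: "(real^'n) \<times> real \<Rightarrow> complex"
  assumes "SV \<nu> e U"
  shows "famJ (- (of_nat (Suc CARD('n)) / 2) + \<nu>) e (homfam U)"
proof -
  have "- of_nat (Suc CARD('n)) - (- (of_nat (Suc CARD('n)) / 2) + \<nu>) = - (of_nat (Suc CARD('n)) / 2) - \<nu>"
    by (simp add: field_simps)
  then show ?thesis using assms unfolding SV_def by (auto simp only: intro: fam_base)
qed

text \<open>\<open>Cnorm\<close> without its denominator, which is left to \<open>nf\<close> (see
  \<open>Cnorm_eq\<close>). For \<open>Re \<nu> = 0\<close> the remaining Gamma argument has
  positive real part, so that no pole occurs.\<close>

definition Cpre :: "nat \<Rightarrow> complex \<Rightarrow> nat \<Rightarrow> complex" where
  "Cpre n \<nu> e = (- \<i>) ^ e * of_real pi powr (- (of_nat n / 2) + \<nu>) * Gamma ((of_nat (Suc n) / 2 - \<nu> + of_nat e) / 2)"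

text \<open>The operator \<open>theta\<close>, on homogeneous extensions to punctured space instead of functions on the
  chart.\<close>

definition Theta :: "complex \<Rightarrow> nat \<Rightarrow> ((real^'n) \<times> real \<Rightarrow> complex) \<Rightarrow> (real^'n) \<times> real \<Rightarrow> complex" where
  "Theta \<nu> e U Y = Cpre CARD('n) \<nu> e * Phi (- (of_nat (Suc CARD('n)) / 2) + \<nu>) e (homfam U) Y 0"

lemma Theta_SV:
  fixes U :: "(real^'n) \<times> real \<Rightarrow> complex"
  assumes "SV \<nu> e U"
  shows "SV (- \<nu>) e (Theta \<nu> e U)"
  unfolding SV_def Theta_def[abs_def]
proof
  have "- (of_nat (Suc CARD('n)) / 2) + \<nu> + 0 = - (of_nat (Suc CARD('n)) / 2) - - \<nu>" by simp
  then show "hom (- (of_nat (Suc CARD('n)) / 2) - - \<nu>) e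
      (\<lambda>Y. Cpre CARD('n) \<nu> e * Phi (- (of_nat (Suc CARD('n)) / 2) + \<nu>) e (homfam U) Y 0)"
    using Phi_hom[OF SV_fam[OF assms], of 0] by (intro hom_cmult) (simp only:)
qed (intro smooth_off0_cmult Phi_smooth SV_fam[OF assms])

lemma Theta_cong: "(\<And>X. X \<noteq> 0 \<Longrightarrow> U X = W X) \<Longrightarrow> Theta \<nu> e U = Theta \<nu> e W"
  unfolding Theta_def[abs_def] using Phi_cong[of "homfam U" "homfam W"] by simp

lemma Theta_add:
  assumes "SV \<nu> e U" "SV \<nu> e W" "Y \<noteq> 0"
  shows "Theta \<nu> e (\<lambda>X. U X + W X) Y = Theta \<nu> e U Y + Theta \<nu> e W Y"
  using Phi_add[OF SV_fam[OF assms(1)] SV_fam[OF assms(2)] assms(3), of 0]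
  by (simp only: Theta_def ring_distribs)

lemma Theta_cmult:
  assumes "SV \<nu> e U" "Y \<noteq> 0"
  shows "Theta \<nu> e (\<lambda>X. c * U X) Y = c * Theta \<nu> e U Y"
  using Phi_cmult[OF SV_fam[OF assms(1)] assms(2), where c = c and z = 0]
  by (simp only: Theta_def mult.left_commute[of _ c])

text \<open>\<open>Phi_inner_ddir\<close> at \<open>z = 0\<close>; by \<open>Phi_at_0\<close> the
  differentiated family may be replaced there by the standard one.\<close>

lemma Theta_inner_ddir:
  fixes U :: "(real^'n) \<times> real \<Rightarrow> complex"
  assumes U: "SV \<nu> e U" and Y: "Y \<noteq> 0"
  shows "Theta \<nu> e (\<lambda>X. of_real (a \<bullet> X) * ddir U b X) Y =
    - (of_real (a \<bullet> b) * Theta \<nu> e U Y + of_real (b \<bullet> Y) * ddir (Theta \<nu> e U) a Y)"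
proof -
  let ?\<alpha> = "- (of_nat (Suc CARD('n)) / 2) + \<nu>"
  note V = SV_fam[OF U]
  have f: "famJ ?\<alpha> e (\<lambda>z X. of_real (a \<bullet> X) * ddir (homfam U z) b X)"
    using famJ_inner[OF famJ_ddir[OF V, of b], of a] famJ_Suc_Suc(1) by (simp only: add_diff_cancel_right')
  have 1: "Phi ?\<alpha> e (\<lambda>z X. of_real (a \<bullet> X) * ddir (homfam U z) b X) Y 0 =
      Phi ?\<alpha> e (homfam (\<lambda>X. of_real (a \<bullet> X) * ddir U b X)) Y 0"
    unfolding Phi_at_0[OF f Y]
  proof (rule fun_cong[OF fun_cong[OF Phi_cong]])
    fix z :: complex and X :: "(real^'n) \<times> real" assume X: "X \<noteq> 0"
    have "ddir (homfam U 0) b X = ddir U b X"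
      by (rule ddir_cong[OF _ X]) (simp add: npow_0)
    then show "npow (- z) X * (of_real (a \<bullet> X) * ddir (homfam U 0) b X) = npow (- z) X * (of_real (a \<bullet> X) * ddir U b X)"
      by simp
  qed
  have 2: "ddir (Theta \<nu> e U) a Y = Cpre CARD('n) \<nu> e * ddir (\<lambda>Y. Phi ?\<alpha> e (homfam U) Y 0) a Y"
    unfolding Theta_def[abs_def] by (rule ddir_cmult[OF Phi_smooth[OF V] Y])
  have 3: "of_real (b \<bullet> Y) * ddir (\<lambda>Y. Phi ?\<alpha> e (homfam U) Y 0) a Y =
     - (of_real (a \<bullet> b) * Phi ?\<alpha> e (homfam U) Y 0 + Phi ?\<alpha> e (homfam (\<lambda>X. of_real (a \<bullet> X) * ddir U b X)) Y 0)"
    using Phi_inner_ddir[OF V Y, of 0 b a] unfolding ddir_Phi[OF V Y] 1 by (simp only: mult_ac)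
  have "Theta \<nu> e (\<lambda>X. of_real (a \<bullet> X) * ddir U b X) Y = - (of_real (a \<bullet> b) * Theta \<nu> e U Y +
     Cpre CARD('n) \<nu> e * (of_real (b \<bullet> Y) * ddir (\<lambda>Y. Phi ?\<alpha> e (homfam U) Y 0) a Y))"
    unfolding 3 Theta_def by (simp add: algebra_simps)
  then show ?thesis unfolding 2 by (simp only: mult.left_commute)
qed

text \<open>The first transform exchanges \<open>a\<close> and \<open>b\<close>, the second
  exchanges them back, and the terms with \<open>a \<bullet> b\<close> cancel. So the composition
  commutes with all these operators.\<close>

lemma Theta_Theta_inner_ddir:
  fixes U :: "(real^'n) \<times> real \<Rightarrow> complex"
  assumes U: "SV \<nu> e U" and Y: "Y \<noteq> 0"
  shows "Theta (- \<nu>) e (Theta \<nu> e (\<lambda>X. of_real (a \<bullet> X) * ddir U b X)) Y =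
    of_real (a \<bullet> Y) * ddir (Theta (- \<nu>) e (Theta \<nu> e U)) b Y"
proof -
  let ?W = "Theta \<nu> e U"
  have W: "SV (- \<nu>) e ?W" by (rule Theta_SV[OF U])
  have "Theta (- \<nu>) e (Theta \<nu> e (\<lambda>X. of_real (a \<bullet> X) * ddir U b X)) =
     Theta (- \<nu>) e (\<lambda>X. (- of_real (a \<bullet> b)) * ?W X + (- 1) * (of_real (b \<bullet> X) * ddir ?W a X))"
    by (rule Theta_cong) (simp add: Theta_inner_ddir[OF U])
  then have "Theta (- \<nu>) e (Theta \<nu> e (\<lambda>X. of_real (a \<bullet> X) * ddir U b X)) Y =
     (- of_real (a \<bullet> b)) * Theta (- \<nu>) e ?W Y + (- 1) * Theta (- \<nu>) e (\<lambda>X. of_real (b \<bullet> X) * ddir ?W a X) Y"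
    by (simp only: Theta_add[OF SV_cmult[OF W] SV_cmult[OF SV_inner_ddir[OF W]] Y] Theta_cmult[OF W Y]
        Theta_cmult[OF SV_inner_ddir[OF W] Y])
  then show ?thesis
    by (simp add: Theta_inner_ddir[OF W Y] inner_commute[of b a])
qed

lemma Theta_pairing:
  fixes U W :: "(real^'n) \<times> real \<Rightarrow> complex"
  assumes "SV \<nu> e U" "SV \<nu> e W"
  shows "chart_int (\<lambda>Y. Theta \<nu> e U Y * W Y) = chart_int (\<lambda>X. U X * Theta \<nu> e W X)"
proof -
  let ?\<alpha> = "- (of_nat (Suc CARD('n)) / 2) + \<nu>"
  let ?C = "Cpre CARD('n) \<nu> e"
  have 1: "chart_int (\<lambda>Y. Theta \<nu> e U Y * W Y) = ?C * chart_int (\<lambda>Y. Phi ?\<alpha> e (homfam U) Y 0 * homfam W 0 Y)"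
    by (simp add: chart_int_def Theta_def npow_0 mult.assoc)
  have 2: "chart_int (\<lambda>X. U X * Theta \<nu> e W X) = ?C * chart_int (\<lambda>X. homfam U 0 X * Phi ?\<alpha> e (homfam W) X 0)"
    by (simp add: chart_int_def Theta_def npow_0 mult.left_commute[of "U _" "Cpre _ _ _"])
  show ?thesis unfolding 1 2 Phi_pairing[OF SV_fam[OF assms(1)] SV_fam[OF assms(2)]] ..
qed

section \<open>Zonal functions\<close>

text \<open>On the unit sphere this is \<open>(v \<bullet> X) ^ k\<close>; the power of the norm
  restores the degree of a smooth vector.\<close>

definition zonal :: "complex \<Rightarrow> (real^'n) \<times> real \<Rightarrow> nat \<Rightarrow> (real^'n) \<times> real \<Rightarrow> complex" where
  "zonal \<nu> v k X = of_real (v \<bullet> X) ^ k * npow (- (of_nat (Suc CARD('n)) / 2) - \<nu> - of_nat k) X"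

lemma hom_power_inner: "hom (of_nat k) k (\<lambda>X. of_real (v \<bullet> X) ^ k)"
proof (induction k)
  case (Suc k)
  show ?case using hom_mult[OF hom_inner Suc] by simp
qed (simp add: hom_def spow_def)

lemma SV_zonal:
  fixes v :: "(real^'n) \<times> real"
  assumes "even k = even e"
  shows "SV \<nu> e (zonal \<nu> v k)"
proof -
  have "hom (of_nat k + (- (of_nat (Suc CARD('n)) / 2) - \<nu> - of_nat k)) (k + 0) (zonal \<nu> v k)"
    unfolding zonal_def[abs_def] by (rule hom_mult[OF hom_power_inner hom_npow])
  then have "hom (- (of_nat (Suc CARD('n)) / 2) - \<nu>) e (zonal \<nu> v k)"
    using assms by (auto intro: hom_parity)
  moreover have "smooth_off0 (zonal \<nu> v k)"
    unfolding zonal_def[abs_def] by (intro smooth_off0_mult smooth_off0_power smooth_off0_inner smooth_off0_npow)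
  ultimately show ?thesis by (simp add: SV_def)
qed

lemma Theta_zonal:
  fixes Y v :: "(real^'n) \<times> real"
  assumes e: "e \<in> {0, 1}" and Y: "Y \<noteq> 0"
  shows "Theta \<nu> e (zonal \<nu> v e) Y = (Cpre CARD('n) \<nu> e * of_real (pi powr (CARD('n) / 2)) *
    rGamma ((of_nat (Suc CARD('n)) / 2 + \<nu> + of_nat e) / 2)) * zonal (- \<nu>) v e Y"
proof -
  let ?d = "of_nat (Suc CARD('n)) :: complex"
  let ?\<alpha> = "- (?d / 2) + \<nu>"
  have o1: "of_nat (Suc 0) = (1 :: complex)" by simp
  have half: "?d = ?d / 2 + ?d / 2" by (simp add: field_simps)
  have np: "npow (- z) X * npow s X = npow t X" if "- z + s = t" for z s t and X :: "(real^'n) \<times> real"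
    using that npow_add by metis
  consider "e = 0" | "e = Suc 0" using e by auto
  then show ?thesis
  proof cases
    case 1
    have "Phi ?\<alpha> 0 (homfam (zonal \<nu> v 0)) = Phi ?\<alpha> 0 (\<lambda>z. npow (- ?d - (?\<alpha> + z)))"
      by (rule Phi_cong) (simp add: zonal_def del: of_nat_Suc, rule np, subst (2) half, simp del: of_nat_Suc)
    then have "Phi ?\<alpha> 0 (homfam (zonal \<nu> v 0)) Y 0 = of_real (pi powr (CARD('n) / 2)) * rGamma ((?\<alpha> + 0 + ?d) / 2) * npow (?\<alpha> + 0) Y"
      by (simp only: Phi_npow[OF Y])
    moreover have "?\<alpha> + 0 + ?d = ?d / 2 + \<nu> + of_nat 0" by (subst (2) half) (simp del: of_nat_Suc)
    ultimately show ?thesis using 1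
      by (simp add: Theta_def zonal_def del: of_nat_Suc)
  next
    case 2
    have "Phi ?\<alpha> (Suc 0) (homfam (zonal \<nu> v (Suc 0))) = Phi ?\<alpha> (Suc 0) (\<lambda>z X. of_real (v \<bullet> X) * npow (- ?d - (?\<alpha> + 1 + z)) X)"
      by (rule Phi_cong) (simp add: zonal_def mult.left_commute del: of_nat_Suc, rule disjI2, rule np, subst (2) half, simp del: of_nat_Suc)
    then have "Phi ?\<alpha> (Suc 0) (homfam (zonal \<nu> v (Suc 0))) Y 0 =
       of_real (pi powr (CARD('n) / 2)) * rGamma ((?\<alpha> + 1 + 0 + ?d) / 2) * (of_real (v \<bullet> Y) * npow (?\<alpha> + 0 - 1) Y)"
      by (simp only: Phi_inner_npow[OF Y])
    moreover have "?\<alpha> + 1 + 0 + ?d = ?d / 2 + \<nu> + of_nat (Suc 0)" by (subst (2) half) (simp del: of_nat_Suc add: of_nat_Suc[of 0])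
    ultimately show ?thesis using 2
      by (simp add: Theta_def zonal_def mult.assoc add.assoc o1 del: of_nat_Suc)
  qed
qed

text \<open>The Gamma factor of each constant cancels against the \<open>rGamma\<close> of the
  other, the powers of \<open>pi\<close> cancel, and the square of \<open>(- \<i>) ^ e\<close> is
  left.\<close>

lemma Cpre_product:
  assumes "Re \<nu> = 0"
  shows "(Cpre n \<nu> e * of_real (pi powr (n / 2)) * rGamma ((of_nat (Suc n) / 2 + \<nu> + of_nat e) / 2)) *
    (Cpre n (- \<nu>) e * of_real (pi powr (n / 2)) * rGamma ((of_nat (Suc n) / 2 + - \<nu> + of_nat e) / 2)) = (- 1) ^ e"
proof -
  define x where "x = (of_nat (Suc n) / 2 + \<nu> + of_nat e) / 2"
  define y where "y = (of_nat (Suc n) / 2 - \<nu> + of_nat e) / 2"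
  have g: "Gamma w * rGamma w = 1" if "Re w > 0" for w
  proof -
    have "w \<notin> \<int>\<^sub>\<le>\<^sub>0" using that by (auto elim!: nonpos_Ints_cases)
    then show ?thesis by (simp add: rGamma_inverse_Gamma Gamma_eq_zero_iff)
  qed
  have "Re x > 0" "Re y > 0" unfolding x_def y_def using assms by (auto intro!: add_pos_nonneg)
  then have gxy: "Gamma x * rGamma x = 1" "Gamma y * rGamma y = 1" by (auto intro: g)
  define P where "P = complex_of_real pi powr (- (of_nat n / 2) + \<nu>)"
  define Q where "Q = complex_of_real pi powr (- (of_nat n / 2) + - \<nu>)"
  define R where "R = complex_of_real (pi powr (n / 2))"
  have R: "R = complex_of_real pi powr (of_nat n / 2)"
    by (simp add: R_def powr_of_real[symmetric])
  have pq: "P * R * (Q * R) = 1"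
  proof -
    have "P * R * (Q * R) = complex_of_real pi powr ((- (of_nat n / 2) + \<nu>) + of_nat n / 2 + ((- (of_nat n / 2) + - \<nu>) + of_nat n / 2))"
      unfolding P_def Q_def R by (simp only: powr_add)
    also have "(- (of_nat n / 2) + \<nu>) + of_nat n / 2 + ((- (of_nat n / 2) + - \<nu>) + of_nat n / 2) = 0" by simp
    finally show ?thesis by simp
  qed
  have c1: "Cpre n \<nu> e = (- \<i>) ^ e * P * Gamma y"
    by (simp only: Cpre_def P_def y_def)
  have c2: "Cpre n (- \<nu>) e = (- \<i>) ^ e * Q * Gamma x"
    by (simp only: Cpre_def Q_def x_def diff_minus_eq_add)
  have y': "(of_nat (Suc n) / 2 + - \<nu> + of_nat e) / 2 = y" by (simp only: y_def diff_conv_add_uminus)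
  have "(- \<i>) ^ e * (- \<i>) ^ e = (- 1) ^ e"
    by (simp flip: power_mult_distrib)
  moreover have "((- \<i>) ^ e * P * Gamma y * R * rGamma x) * ((- \<i>) ^ e * Q * Gamma x * R * rGamma y) =
     ((- \<i>) ^ e * (- \<i>) ^ e) * (P * R * (Q * R)) * (Gamma x * rGamma x) * (Gamma y * rGamma y)"
    by (simp only: mult_ac)
  ultimately show ?thesis
    unfolding c1 c2 x_def[symmetric] y' R_def[symmetric] by (simp only: pq gxy mult_1_right)
qed

text \<open>The operator \<open>v \<bullet> X\<close> times the derivative along \<open>v\<close>
  commutes with the composition and maps the zonal function of power \<open>k\<close> to a
  combination of those of powers \<open>k\<close> and \<open>k + 2\<close>. The coefficient
  \<open>s\<close> of the latter is nonzero for \<open>Re \<nu> = 0\<close>, which gives an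
  induction in steps of two starting from \<open>Theta_zonal\<close>.\<close>

lemma Theta_Theta_zonal:
  fixes v Y :: "(real^'n) \<times> real"
  assumes e: "e \<in> {0, 1}" and \<nu>: "Re \<nu> = 0" and v: "v \<noteq> 0" and "Y \<noteq> 0"
  shows "Theta (- \<nu>) e (Theta \<nu> e (zonal \<nu> v (e + 2 * m))) Y = (- 1) ^ e * zonal \<nu> v (e + 2 * m) Y"
  using assms(4)
proof (induction m arbitrary: Y)
  case 0
  let ?c = "\<lambda>\<nu>. Cpre CARD('n) \<nu> e * of_real (pi powr (CARD('n) / 2)) * rGamma ((of_nat (Suc CARD('n)) / 2 + \<nu> + of_nat e) / 2)"
  have "Theta (- \<nu>) e (Theta \<nu> e (zonal \<nu> v e)) = Theta (- \<nu>) e (\<lambda>X. ?c \<nu> * zonal (- \<nu>) v e X)"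
    by (rule Theta_cong) (rule Theta_zonal[OF e])
  then have "Theta (- \<nu>) e (Theta \<nu> e (zonal \<nu> v e)) Y = ?c \<nu> * (?c (- \<nu>) * zonal (- (- \<nu>)) v e Y)"
    by (simp only: Theta_cmult[OF SV_zonal[OF refl] 0] Theta_zonal[OF e 0])
  also have "\<dots> = (?c \<nu> * ?c (- \<nu>)) * zonal \<nu> v e Y"
    by (simp only: mult.assoc minus_minus)
  finally show ?case unfolding Cpre_product[OF \<nu>] by simp
next
  case (Suc m)
  define k where "k = e + 2 * m"
  define s where "s = - (of_nat (Suc CARD('n)) / 2) - \<nu> - of_nat k"
  define A where "A = of_nat k * complex_of_real (v \<bullet> v)"
  let ?T = "\<lambda>U. Theta (- \<nu>) e (Theta \<nu> e U)"
  have par: "even k = even e" "even (k + 2) = even e" by (auto simp: k_def)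
  note Z = SV_zonal[OF par(1), of \<nu> v] and Z2 = SV_zonal[OF par(2), of \<nu> v]
  have IH: "?T (zonal \<nu> v k) X = (- 1) ^ e * zonal \<nu> v k X" if "X \<noteq> 0" for X
    using Suc.IH[OF that] by (simp only: k_def)
  have dpow: "ddir (\<lambda>X. complex_of_real (v \<bullet> X) ^ k) v X = of_nat k * of_real (v \<bullet> X) ^ (k - 1) * of_real (v \<bullet> v)" for X
    by (rule ddir_eqI) (auto intro!: derivative_eq_intros)
  have step: "of_real (v \<bullet> X) * ddir (zonal \<nu> v k) v X = A * zonal \<nu> v k X + s * zonal \<nu> v (k + 2) X" if X: "X \<noteq> 0" for X
  proof -
    have "ddir (zonal \<nu> v k) v X = of_real (v \<bullet> X) ^ k * (s * of_real (v \<bullet> X) * npow (s - 2) X) +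
       of_nat k * of_real (v \<bullet> X) ^ (k - 1) * of_real (v \<bullet> v) * npow s X"
      unfolding zonal_def[abs_def] s_def[symmetric]
      by (simp only: ddir_mult[OF smooth_off0_power[OF smooth_off0_inner] smooth_off0_npow X] ddir_npow[OF X] dpow)
    \<comment> \<open>For \<open>k = 0\<close> the factor \<open>of_nat k\<close> hides the
      truncated subtraction.\<close>
    moreover have "of_nat k * (complex_of_real (v \<bullet> X) * of_real (v \<bullet> X) ^ (k - 1)) = of_nat k * of_real (v \<bullet> X) ^ k"
      by (cases k) auto
    moreover have "zonal \<nu> v (k + 2) X = of_real (v \<bullet> X) * (of_real (v \<bullet> X) * of_real (v \<bullet> X) ^ k) * npow (s - 2) X"
    proof -
      have "- (of_nat (Suc CARD('n)) / 2) - \<nu> - of_nat (k + 2) = s - 2" by (simp add: s_def)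
      then show ?thesis by (simp only: zonal_def power_add power2_eq_square mult_ac)
    qed
    moreover have "zonal \<nu> v k X = of_real (v \<bullet> X) ^ k * npow s X" by (simp only: zonal_def s_def)
    ultimately show ?thesis
      by (simp add: A_def algebra_simps) (metis (no_types, lifting) mult.assoc mult.commute)
  qed
  have 1: "?T (\<lambda>X. of_real (v \<bullet> X) * ddir (zonal \<nu> v k) v X) Y = A * ?T (zonal \<nu> v k) Y + s * ?T (zonal \<nu> v (k + 2)) Y"
  proof -
    have "Theta \<nu> e (\<lambda>X. of_real (v \<bullet> X) * ddir (zonal \<nu> v k) v X) = Theta \<nu> e (\<lambda>X. A * zonal \<nu> v k X + s * zonal \<nu> v (k + 2) X)"
      by (rule Theta_cong) (rule step)
    moreover have "?T (\<lambda>X. A * zonal \<nu> v k X + s * zonal \<nu> v (k + 2) X) =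
      Theta (- \<nu>) e (\<lambda>X. A * Theta \<nu> e (zonal \<nu> v k) X + s * Theta \<nu> e (zonal \<nu> v (k + 2)) X)"
      by (rule Theta_cong) (simp only: Theta_add[OF SV_cmult[OF Z] SV_cmult[OF Z2]] Theta_cmult[OF Z] Theta_cmult[OF Z2] not_False_eq_True)
    ultimately show ?thesis
      by (simp only: Theta_add[OF SV_cmult[OF Theta_SV[OF Z]] SV_cmult[OF Theta_SV[OF Z2]] Suc.prems]
          Theta_cmult[OF Theta_SV[OF Z] Suc.prems] Theta_cmult[OF Theta_SV[OF Z2] Suc.prems])
  qed
  have 2: "?T (\<lambda>X. of_real (v \<bullet> X) * ddir (zonal \<nu> v k) v X) Y = (- 1) ^ e * (A * zonal \<nu> v k Y + s * zonal \<nu> v (k + 2) Y)"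
  proof -
    have "ddir (?T (zonal \<nu> v k)) v Y = ddir (\<lambda>X. (- 1) ^ e * zonal \<nu> v k X) v Y"
      by (rule ddir_cong[OF _ Suc.prems]) (rule IH)
    also have "\<dots> = (- 1) ^ e * ddir (zonal \<nu> v k) v Y"
      using Z by (intro ddir_cmult[OF _ Suc.prems]) (simp add: SV_def)
    finally have "?T (\<lambda>X. of_real (v \<bullet> X) * ddir (zonal \<nu> v k) v X) Y = (- 1) ^ e * (of_real (v \<bullet> Y) * ddir (zonal \<nu> v k) v Y)"
      unfolding Theta_Theta_inner_ddir[OF Z Suc.prems] by (simp only: mult.left_commute)
    then show ?thesis unfolding step[OF Suc.prems] .
  qed
  have "s * ?T (zonal \<nu> v (k + 2)) Y = s * ((- 1) ^ e * zonal \<nu> v (k + 2) Y)"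
    using 1 2 IH[OF Suc.prems] by (auto simp: algebra_simps)
  moreover have "s \<noteq> 0"
  proof
    assume "s = 0"
    then have "Re s = 0" by simp
    moreover have "Re s < 0"
    proof -
      have "(1 + real CARD('n)) / 2 > 0" by (simp add: add_pos_nonneg)
      moreover have "Re s = - ((1 + real CARD('n)) / 2) - real k" using \<nu> by (simp add: s_def)
      ultimately show ?thesis by linarith
    qed
    ultimately show False by simp
  qed
  ultimately have "?T (zonal \<nu> v (k + 2)) Y = (- 1) ^ e * zonal \<nu> v (k + 2) Y" by simp
  then show ?case by (simp add: k_def add.assoc)
qed

lemma npow_minus_of_nat_double:
  assumes "X \<noteq> 0"
  shows "npow (s - of_nat (2 * m)) X * of_real (X \<bullet> X) ^ m = npow s X"
proof -
  have "npow (of_nat (2 * m)) X = of_real (X \<bullet> X) ^ m"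
    unfolding npow_of_nat[OF assms] power_mult by (simp add: power2_norm_eq_inner flip: of_real_power)
  then have "npow (s - of_nat (2 * m)) X * of_real (X \<bullet> X) ^ m = npow (s - of_nat (2 * m) + of_nat (2 * m)) X"
    by (simp only: npow_add)
  then show ?thesis by simp
qed

lemma Re_of_real_mult_left: "Re (of_real x * z) = x * Re z"
  by simp

lemma npow_nonzero: "X \<noteq> 0 \<Longrightarrow> npow s X \<noteq> 0"
  by (simp add: npow_def)

text \<open>The quotient is the squared cosine of the angle between \<open>v\<close> and
  \<open>X\<close>. It is at most 1, with equality on the line of \<open>v\<close> only; its powers
  are the concentrating weight.\<close>

lemma zonal_add_double:
  fixes v X :: "(real^'n) \<times> real"
  assumes X: "X \<noteq> 0" and v: "v \<noteq> 0"
  shows "zonal \<nu> v (e + 2 * m) X = zonal \<nu> v e X * of_real ((v \<bullet> v) ^ m * ((v \<bullet> X)\<^sup>2 / ((v \<bullet> v) * (X \<bullet> X))) ^ m)"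
proof -
  let ?s = "- (of_nat (Suc CARD('n)) / 2) - \<nu> - of_nat e"
  have n: "complex_of_real (X \<bullet> X) ^ m \<noteq> 0" "v \<bullet> v \<noteq> 0" using X v by auto
  have "- (of_nat (Suc CARD('n)) / 2) - \<nu> - of_nat (e + 2 * m) = ?s - of_nat (2 * m)"
    by (simp only: of_nat_add diff_diff_eq add.assoc)
  then have 1: "zonal \<nu> v (e + 2 * m) X = of_real (v \<bullet> X) ^ e * of_real (((v \<bullet> X)\<^sup>2) ^ m) * npow (?s - of_nat (2 * m)) X"
    by (simp only: zonal_def power_add power_mult of_real_power)
  have 2: "npow (?s - of_nat (2 * m)) X = npow ?s X * of_real (1 / (X \<bullet> X) ^ m)"
    using npow_minus_of_nat_double[OF X, of ?s m] n(1) by (simp add: field_simps del: of_nat_Suc of_nat_add of_nat_mult)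
  have 3: "(v \<bullet> v) ^ m * ((v \<bullet> X)\<^sup>2 / ((v \<bullet> v) * (X \<bullet> X))) ^ m = ((v \<bullet> X)\<^sup>2) ^ m * (1 / (X \<bullet> X) ^ m)"
    using n(2) by (simp add: power_mult_distrib power_divide)
  show ?thesis unfolding 1 2 3 of_real_mult zonal_def[of \<nu> v e] by (simp only: mult_ac)
qed

lemma cauchy_schwarz_quotient:
  fixes v X :: "'a::euclidean_space"
  assumes "v \<noteq> 0" "X \<noteq> 0"
  shows "(v \<bullet> X)\<^sup>2 / ((v \<bullet> v) * (X \<bullet> X)) \<le> 1" "(v \<bullet> X)\<^sup>2 / ((v \<bullet> v) * (X \<bullet> X)) \<ge> 0"
proof -
  have "(v \<bullet> v) * (X \<bullet> X) > 0" using assms by simp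
  then show "(v \<bullet> X)\<^sup>2 / ((v \<bullet> v) * (X \<bullet> X)) \<le> 1" "(v \<bullet> X)\<^sup>2 / ((v \<bullet> v) * (X \<bullet> X)) \<ge> 0"
    using Cauchy_Schwarz_ineq[of v X] by (simp_all add: divide_le_eq)
qed

lemma cauchy_schwarz_quotient_eq_1:
  fixes v X :: "'a::euclidean_space"
  assumes v: "v \<noteq> 0" and X: "norm X = 1" and eq: "(v \<bullet> X)\<^sup>2 / ((v \<bullet> v) * (X \<bullet> X)) = 1"
  obtains t where "t \<noteq> 0" "X = t *\<^sub>R v"
proof -
  have nz: "X \<bullet> X = 1" using X by (simp add: norm_eq_1)
  then have "(v \<bullet> X)\<^sup>2 = (norm v)\<^sup>2" using eq v by (simp add: power2_norm_eq_inner)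
  then have "\<bar>v \<bullet> X\<bar> = norm v * norm X" using X by (metis abs_norm_cancel mult.right_neutral power2_eq_iff_nonneg abs_ge_zero norm_ge_zero power2_abs)
  then have "norm v *\<^sub>R X = norm X *\<^sub>R v \<or> norm v *\<^sub>R X = - (norm X *\<^sub>R v)"
    using norm_cauchy_schwarz_abs_eq[of v X] by simp
  moreover have "X = (1 / norm v) *\<^sub>R (norm v *\<^sub>R X)" using v by simp
  ultimately have "X = (1 / norm v) *\<^sub>R v \<or> X = (- (1 / norm v)) *\<^sub>R v"
    using X by (metis scaleR_one scaleR_minus_left scaleR_minus_right)
  then show thesis using v by (auto intro: that[of "1 / norm v"] that[of "- (1 / norm v)"])
qed

text \<open>Laplace's method: as \<open>m \<rightarrow> \<infinity>\<close> the zonal functions concentrate at \<open>v\<close>.\<close>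

lemma zonal_orthogonal_imp_zero:
  fixes f :: "(real^'n) \<times> real \<Rightarrow> complex"
  assumes f: "continuous_on (- {0}) f" "hom (- (of_nat (Suc CARD('n)) / 2) - \<nu>) e f"
    and v: "snd v \<noteq> 0"
    and orth: "\<And>m. chart_int (\<lambda>X. f X * zonal (- \<nu>) v (e + 2 * m) X) = 0"
  shows "f v = 0"
proof (rule ccontr)
  assume fv: "f v \<noteq> 0"
  have v0: "v \<noteq> 0" using v by auto
  define D where "D = real (Suc CARD('n))"
  define q where "q X = (v \<bullet> X)\<^sup>2 / ((v \<bullet> v) * (X \<bullet> X))" for X
  have q01: "q X \<le> 1" "q X \<ge> 0" if "X \<noteq> 0" for X
    using cauchy_schwarz_quotient[OF v0 that] by (simp_all add: q_def)
  have q_scale: "q (t *\<^sub>R X) = q X" if "t \<noteq> 0" for t X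
    using that by (simp add: q_def power_mult_distrib power2_eq_square)
  have qv: "q v = 1" using v0 by (simp add: q_def power2_eq_square)
  \<comment> \<open>The factor that does not depend on \<open>m\<close>. It is an even density, as
    the degrees of \<open>f\<close> and of the zonal function add up to
    \<open>- n - 1\<close>.\<close>
  define P where "P X = f X * zonal (- \<nu>) v e X" for X
  have cz: "continuous_on (- {0}) (zonal (- \<nu>) v e)"
    using SV_zonal[of e e "- \<nu>" v] unfolding SV_def by (blast intro: smooth_off0_continuous)
  have hz: "hom (- (of_nat (Suc CARD('n)) / 2) - - \<nu>) e (zonal (- \<nu>) v e)"
    using SV_zonal[of e e "- \<nu>" v] unfolding SV_def by blast
  have cP: "continuous_on (- {0}) P" unfolding P_def[abs_def] by (intro continuous_intros f cz)
  have hP: "hom (- of_nat (Suc CARD('n))) (e + e) P"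
  proof -
    have "- (of_nat (Suc CARD('n)) / 2) - \<nu> + (- (of_nat (Suc CARD('n)) / 2) - - \<nu>) = - (of_nat (Suc CARD('n)) :: complex)"
      by (simp add: field_simps)
    then show ?thesis using hom_mult[OF f(2) hz] unfolding P_def[abs_def] by (simp only:)
  qed
  define c where "c = P v"
  have c: "c \<noteq> 0" using fv v0 npow_nonzero[OF v0] by (simp add: c_def P_def zonal_def)
  \<comment> \<open>Multiplied by the conjugate of its value at \<open>v\<close>, the density has
    positive real part near the line of \<open>v\<close>.\<close>
  define r where "r X = Re (P X * cnj c)" for X
  have cr: "continuous_on (- {0}) r" unfolding r_def[abs_def] by (intro continuous_intros cP)
  have r_scale: "r (t *\<^sub>R X) = \<bar>t\<bar> powr (- D) * r X" if "t \<noteq> 0" "X \<noteq> 0" for t X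
  proof -
    have "spow (- of_nat (Suc CARD('n))) (e + e) t = spow (- of_nat (Suc CARD('n))) 0 t"
      by (rule spow_parity) simp
    also have "\<dots> = of_real (\<bar>t\<bar> powr (- D))"
      using that by (simp add: spow_def D_def powr_of_real[symmetric])
    finally have "P (t *\<^sub>R X) = of_real (\<bar>t\<bar> powr (- D)) * P X"
      using homD[OF hP that] by simp
    then show ?thesis by (simp only: r_def mult.assoc Re_of_real_mult_left)
  qed
  obtain M where M: "M \<ge> 0" "\<And>X. X \<noteq> 0 \<Longrightarrow> norm (P X * cnj c) \<le> M * norm X powr (- D)"
  proof -
    have "continuous_on (- {0}) (\<lambda>X. cnj c * P X)" by (intro continuous_intros cP)
    from hom_bound[OF this hom_cmult[OF hP, of "cnj c"]] show ?thesis
      using that by (auto simp: D_def mult.commute)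
  qed
  define \<rho>0 where "\<rho>0 = r ((1 / norm v) *\<^sub>R v)"
  have \<rho>0: "\<rho>0 > 0"
  proof -
    have "r v = (norm c)\<^sup>2" by (simp add: r_def c_def[symmetric] complex_norm_square[symmetric] del: complex_mult_cnj)
    then show ?thesis using c v0 by (simp add: \<rho>0_def r_scale)
  qed
  \<comment> \<open>The bad part of the sphere. It is compact and misses the line of
    \<open>v\<close>, so the squared cosine has a bound \<open>\<rho> < 1\<close> on it.\<close>
  define K where "K = {X \<in> sphere 0 1. r X \<le> \<rho>0 / 2}"
  have sph: "sphere 0 1 \<subseteq> - {0 :: (real^'n) \<times> real}" by auto
  have "compact K"
  proof -
    have "closed (sphere 0 1 \<inter> r -` {..\<rho>0 / 2})"
      by (intro continuous_closed_preimage continuous_on_subset[OF cr sph]) auto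
    moreover have "K = sphere 0 1 \<inter> r -` {..\<rho>0 / 2}" by (auto simp: K_def)
    ultimately show ?thesis using compact_Int_closed[OF compact_sphere[of "0 :: (real^'n) \<times> real" 1], of "r -` {..\<rho>0 / 2}"]
      by (metis compact_Int_closed compact_sphere inf.left_idem)
  qed
  have qK: "q X < 1" if "X \<in> K" for X
  proof (rule ccontr)
    assume "\<not> q X < 1"
    have X: "norm X = 1" "r X \<le> \<rho>0 / 2" "X \<noteq> 0" using that by (auto simp: K_def)
    then have "q X = 1" using q01[of X] \<open>\<not> q X < 1\<close> by simp
    then obtain t where t: "t \<noteq> 0" "X = t *\<^sub>R v"
      using cauchy_schwarz_quotient_eq_1[OF v0 X(1)] unfolding q_def by blast
    have "\<bar>t\<bar> = 1 / norm v" using X(1) t v0 by (simp add: field_simps)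
    then have "r X = \<rho>0" unfolding t(2) \<rho>0_def using t(1) v0 by (simp add: r_scale)
    then show False using X(2) \<rho>0 by simp
  qed
  obtain \<rho> where \<rho>: "0 \<le> \<rho>" "\<rho> < 1" "\<And>X. X \<in> K \<Longrightarrow> q X \<le> \<rho>"
  proof (cases "K = {}")
    case True
    then show ?thesis using that[of 0] by simp
  next
    case False
    have "K \<subseteq> - {0}" by (auto simp: K_def)
    have "continuous_on K q" unfolding q_def[abs_def]
      using v0 by (intro continuous_intros) (auto simp: K_def)
    from continuous_attains_sup[OF \<open>compact K\<close> False this]
    obtain X where "X \<in> K" "\<And>Z. Z \<in> K \<Longrightarrow> q Z \<le> q X" by blast
    then show ?thesis using qK[of X] q01(2)[of X] \<open>K \<subseteq> - {0}\<close> by (intro that[of "q X"]) auto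
  qed
  have big: "r X \<ge> \<rho>0 / 2 * norm X powr (- D)" if X: "X \<noteq> 0" and qX: "q X > \<rho>" for X
  proof -
    let ?X = "(1 / norm X) *\<^sub>R X"
    have "q ?X > \<rho>" using qX X by (simp add: q_scale)
    then have "?X \<notin> K" using \<rho>(3)[of ?X] by auto
    then have "r ?X \<ge> \<rho>0 / 2" using X by (simp add: K_def)
    then have "norm X powr (- D) * (\<rho>0 / 2) \<le> norm X powr (- D) * r ?X"
      by (rule mult_left_mono) simp
    also have "\<dots> = r (norm X *\<^sub>R ?X)" using X by (subst r_scale) auto
    also have "norm X *\<^sub>R ?X = X" using X by simp
    finally show ?thesis by (simp only: mult.commute)
  qed
  define \<rho>' where "\<rho>' = (1 + \<rho>) / 2"
  have \<rho>': "\<rho> < \<rho>'" "\<rho>' < 1" "\<rho>' > 0" using \<rho> by (auto simp: \<rho>'_def)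
  \<comment> \<open>The chart point of the line through \<open>v\<close>; this is where
    \<open>snd v \<noteq> 0\<close> enters.\<close>
  define x0 where "x0 = (1 / snd v) *\<^sub>R fst v"
  have x0: "(x0, 1) = (1 / snd v) *\<^sub>R v" using v by (simp add: x0_def prod_eq_iff)
  have qx0: "q (x0, 1) = 1" unfolding x0 using v qv by (subst q_scale) auto
  have "x \<bullet> x + 1 \<noteq> 0" for x :: "real^'n" using inner_ge_zero[of x] by linarith
  then have cq: "continuous_on UNIV (\<lambda>x. q (x, 1))"
    unfolding q_def using v0 by (intro continuous_intros) auto
  have "open {x. \<rho>' < q (x, 1)}" by (intro open_Collect_less continuous_intros cq)
  moreover have "x0 \<in> {x. \<rho>' < q (x, 1)}" using qx0 \<rho>' by simp
  ultimately obtain \<delta>0 where \<delta>0: "\<delta>0 > 0" "ball x0 \<delta>0 \<subseteq> {x. \<rho>' < q (x, 1)}"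
    using open_contains_ball by blast
  define \<delta> where "\<delta> = min \<delta>0 1"
  have \<delta>: "\<delta> > 0" "\<And>x. x \<in> ball x0 \<delta> \<Longrightarrow> q (x, 1) > \<rho>'" using \<delta>0 by (auto simp: \<delta>_def)
  define w0 where "w0 = (norm (x0, 1::real) + 1) powr (- D)"
  have w0: "w0 \<le> wt x" if "x \<in> ball x0 \<delta>" for x
  proof -
    have "norm (x, 1::real) \<le> norm (x0, 1::real) + norm (x - x0, 0::real)"
      using norm_triangle_ineq[of "(x0, 1::real)" "(x - x0, 0)"] by simp
    also have "norm (x - x0, 0::real) \<le> 1" using that by (simp add: \<delta>_def dist_norm norm_minus_commute)
    finally show ?thesis unfolding w0_def D_def by (intro powr_mono2') auto
  qed
  \<comment> \<open>The integral is 0. Where \<open>q\<close> exceeds \<open>\<rho>\<close> the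
    integrand is nonnegative, and on a ball around \<open>x0\<close> it is at least a constant times
    \<open>\<rho>' ^ m\<close>; elsewhere its modulus is at most \<open>M * \<rho> ^ m\<close> times
    the invariant density. As \<open>\<rho> < \<rho>'\<close>, the resulting inequality fails for
    large \<open>m\<close>.\<close>
  have ineq: "\<rho>0 / 2 * w0 * measure lborel (ball x0 \<delta>) * \<rho>' ^ m \<le> M * (\<integral>x. wt (x::real^'n) \<partial>lborel) * \<rho> ^ m" for m
  proof -
    have P0: "chart_int (\<lambda>X. P X * of_real (q X ^ m)) = 0"
    proof -
      have "chart_int (\<lambda>X. f X * zonal (- \<nu>) v (e + 2 * m) X) = of_real ((v \<bullet> v) ^ m) * chart_int (\<lambda>X. P X * of_real (q X ^ m))"
        unfolding chart_int_def integral_mult_right_zero[symmetric]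
        by (intro Bochner_Integration.integral_cong refl)
          (subst zonal_add_double[OF chart_nonzero v0], simp only: P_def q_def of_real_mult mult_ac)
      then show ?thesis using orth[of m] v0 by simp
    qed
    have iP: "integrable lborel (\<lambda>x::real^'n. P (x, 1) * of_real (q (x, 1) ^ m) * cnj c)"
    proof (rule Bochner_Integration.integrable_bound[where f = "\<lambda>x::real^'n. M * wt x"])
      show "integrable lborel (\<lambda>x::real^'n. M * wt x)" by (intro integrable_mult_right integrable_wt)
      have "(\<lambda>x. P (x, 1)) \<in> borel_measurable borel" by (rule measurable_chart[OF measurable_off0[OF cP]])
      moreover have "(\<lambda>x. q (x, 1)) \<in> borel_measurable borel" by (rule borel_measurable_continuous_onI[OF cq])
      ultimately show "(\<lambda>x. P (x, 1) * of_real (q (x, 1) ^ m) * cnj c) \<in> borel_measurable lborel" by measurable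
      have "norm (P (x, 1) * of_real (q (x, 1) ^ m) * cnj c) \<le> M * wt x" for x :: "real^'n"
      proof -
        have "norm (P (x, 1) * of_real (q (x, 1) ^ m) * cnj c) = norm (P (x, 1) * cnj c) * q (x, 1) ^ m"
          using q01(2)[of "(x, 1)"] by (simp add: norm_mult norm_power)
        also have "\<dots> \<le> (M * wt x) * 1"
          using M(2)[of "(x, 1)"] q01[of "(x, 1)"] M(1) unfolding D_def
          by (intro mult_mono power_le_one) auto
        finally show ?thesis by simp
      qed
      then show "AE x in lborel. norm (P (x, 1) * of_real (q (x, 1) ^ m) * cnj c) \<le> norm (M * wt x)"
        unfolding real_norm_def by (intro AE_I2 order_trans[OF _ abs_ge_self])
    qed
    have re: "Re (P (x, 1) * of_real (q (x, 1) ^ m) * cnj c) = r (x, 1) * q (x, 1) ^ m" for x :: "real^'n"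
    proof -
      have eq: "P (x, 1) * of_real (q (x, 1) ^ m) * cnj c = of_real (q (x, 1) ^ m) * (P (x, 1) * cnj c)" by (simp only: mult_ac)
      show ?thesis unfolding eq Re_of_real_mult_left r_def by (rule mult.commute)
    qed
    have ir: "integrable lborel (\<lambda>x. r (x, 1) * q (x, 1) ^ m)"
      using integrable_Re[OF iP] unfolding re .
    have c0: "(\<integral>x. P (x, 1) * of_real (q (x, 1) ^ m) * cnj c \<partial>lborel) = 0"
      using P0 by (simp add: chart_int_def)
    have r0: "(\<integral>x. r (x, 1) * q (x, 1) ^ m \<partial>lborel) = 0"
      using integral_Re[OF iP] unfolding re c0 by simp
    let ?L = "\<lambda>x::real^'n. (\<rho>0 / 2 * w0 * \<rho>' ^ m) * indicator (ball x0 \<delta>) x - (M * \<rho> ^ m) * wt x"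
    have i1: "integrable lborel (\<lambda>x::real^'n. indicator (ball x0 \<delta>) x :: real)"
      by (intro integrable_real_indicator emeasure_lborel_ball_finite) auto
    have i2: "(\<integral>x. indicator (ball x0 \<delta>) x \<partial>lborel) = measure lborel (ball x0 \<delta>)"
      by simp
    have "(\<integral>x. ?L x \<partial>lborel) \<le> (\<integral>x. r (x, 1) * q (x, 1) ^ m \<partial>lborel)"
    proof (rule integral_mono)
      show "integrable lborel ?L" by (intro Bochner_Integration.integrable_diff integrable_mult_right i1 integrable_wt)
      fix x :: "real^'n"
      have nn: "(M * \<rho> ^ m) * wt x \<ge> 0" using M \<rho> by simp
      have qn: "q (x, 1) ^ m \<ge> 0" using q01(2)[of "(x, 1)"] by simp
      show "?L x \<le> r (x, 1) * q (x, 1) ^ m"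
      proof (cases "q (x, 1) > \<rho>")
        case True
        have b: "r (x, 1) \<ge> \<rho>0 / 2 * wt x" using big[OF _ True] unfolding D_def by simp
        have b0: "\<rho>0 / 2 * wt x \<ge> 0" using \<rho>0 by simp
        show ?thesis
        proof (cases "x \<in> ball x0 \<delta>")
          case True
          have "\<rho>0 / 2 * w0 * \<rho>' ^ m \<le> r (x, 1) * q (x, 1) ^ m"
          proof (rule mult_mono)
            have "\<rho>0 / 2 * w0 \<le> \<rho>0 / 2 * wt x" using w0[OF True] \<rho>0 by (intro mult_left_mono) auto
            then show "\<rho>0 / 2 * w0 \<le> r (x, 1)" using b by simp
            show "\<rho>' ^ m \<le> q (x, 1) ^ m" using \<delta>(2)[OF True] \<rho>' by (intro power_mono) auto
            show "0 \<le> r (x, 1)" using b b0 by simp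
            show "0 \<le> \<rho>' ^ m" using \<rho>' by simp
          qed
          then show ?thesis using True nn by simp
        next
          case False
          have "0 \<le> r (x, 1) * q (x, 1) ^ m" using b b0 qn by (intro mult_nonneg_nonneg) auto
          then show ?thesis using False nn by simp
        qed
      next
        case False
        then have "x \<notin> ball x0 \<delta>" using \<delta>(2)[of x] \<rho>' by force
        moreover have "\<bar>r (x, 1)\<bar> \<le> M * wt x"
          using abs_Re_le_cmod[of "P (x, 1) * cnj c"] M(2)[of "(x, 1)"] unfolding r_def D_def by simp
        then have "\<bar>r (x, 1)\<bar> * q (x, 1) ^ m \<le> (M * wt x) * \<rho> ^ m"
          using False q01(2)[of "(x, 1)"] M by (intro mult_mono power_mono) auto
        then have "- (r (x, 1) * q (x, 1) ^ m) \<le> (M * \<rho> ^ m) * wt x"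
          using abs_ge_minus_self[of "r (x, 1) * q (x, 1) ^ m"] qn by (simp add: abs_mult mult_ac)
        ultimately show ?thesis by simp
      qed
    qed (rule ir)
    also have "(\<integral>x. ?L x \<partial>lborel) = (\<rho>0 / 2 * w0 * \<rho>' ^ m) * measure lborel (ball x0 \<delta>) - (M * \<rho> ^ m) * (\<integral>x. wt (x::real^'n) \<partial>lborel)"
      by (simp only: Bochner_Integration.integral_diff integrable_mult_right i1 integrable_wt integral_mult_right_zero
          i2)
    finally show ?thesis unfolding r0 by (simp add: mult_ac)
  qed
  define B1 where "B1 = \<rho>0 / 2 * w0 * measure lborel (ball x0 \<delta>)"
  define B2 where "B2 = M * (\<integral>x. wt (x::real^'n) \<partial>lborel)"
  have B1: "B1 > 0"
  proof -
    have "w0 > 0" by (simp add: w0_def add_nonneg_eq_0_iff)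
    moreover have "measure lborel (ball x0 \<delta>) > 0" using \<delta> by (rule_tac content_ball_pos)
    ultimately show ?thesis using \<rho>0 by (simp add: B1_def)
  qed
  have B2: "B2 \<ge> 0" unfolding B2_def using M by (intro mult_nonneg_nonneg integral_nonneg_AE) auto
  have "\<rho> / \<rho>' < 1" using \<rho>' by simp
  then obtain m where m: "(\<rho> / \<rho>') ^ m < B1 / (B2 + 1)"
    using real_arch_pow_inv[of "B1 / (B2 + 1)" "\<rho> / \<rho>'"] B1 B2 by auto
  have "B1 * \<rho>' ^ m \<le> B2 * \<rho> ^ m" using ineq[of m] by (simp only: B1_def B2_def)
  then have "B1 \<le> B2 * (\<rho> / \<rho>') ^ m" using \<rho>' by (simp add: power_divide field_simps)
  also have "\<dots> \<le> (B2 + 1) * (\<rho> / \<rho>') ^ m" using \<rho> \<rho>' by (intro mult_right_mono) auto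
  also have "\<dots> < (B2 + 1) * (B1 / (B2 + 1))" using m B2 by (intro mult_strict_left_mono) auto
  also have "\<dots> = B1" using B2 by simp
  finally show False by simp
qed

lemma SV_product_integrable:
  fixes U W :: "(real^'n) \<times> real \<Rightarrow> complex"
  assumes U: "SV \<nu> e U" and W: "SV (- \<nu>) e W"
  shows "integrable lborel (\<lambda>x. U (x, 1) * W (x, 1))"
proof -
  have c: "continuous_on (- {0}) (\<lambda>X. U X * W X)"
    using U W unfolding SV_def by (intro continuous_intros smooth_off0_continuous) auto
  have "- (of_nat (Suc CARD('n)) / 2) - \<nu> + (- (of_nat (Suc CARD('n)) / 2) - - \<nu>) = - (of_nat (Suc CARD('n)) :: complex)"
    by (simp add: field_simps)
  then have "hom (- of_nat (Suc CARD('n))) (e + e) (\<lambda>X. U X * W X)"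
    using hom_mult[OF conjunct2[OF U[unfolded SV_def]] conjunct2[OF W[unfolded SV_def]]] by (simp only:)
  from hom_bound[OF c this] obtain M where M: "\<And>X. X \<noteq> 0 \<Longrightarrow> norm (U X * W X) \<le> M * norm X powr Re (- of_nat (Suc CARD('n)))"
    by blast
  have "Re (- of_nat (Suc CARD('n))) = - real (Suc CARD('n))" by simp
  from chart_integrable(1)[OF measurable_off0[OF c] M[unfolded this]] show ?thesis .
qed

text \<open>By \<open>Theta_pairing\<close> both transforms can be moved to a zonal function, where
  the composition is known. So the difference of the two sides is orthogonal to all zonal functions
  around \<open>v\<close> of the right parity and vanishes at \<open>v\<close>.\<close>

lemma Theta_inversion:
  fixes U :: "(real^'n) \<times> real \<Rightarrow> complex"
  assumes U: "SV \<nu> e U" and e: "e \<in> {0, 1}" and \<nu>: "Re \<nu> = 0" and Y: "Y \<noteq> 0"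
  shows "Theta (- \<nu>) e (Theta \<nu> e U) Y = (- 1) ^ e * U Y"
proof -
  let ?T = "Theta (- \<nu>) e (Theta \<nu> e U)"
  define f where "f X = ?T X + (- ((- 1) ^ e)) * U X" for X
  have T: "SV \<nu> e ?T" using Theta_SV[OF Theta_SV[OF U]] by simp
  have f: "SV \<nu> e f" unfolding f_def[abs_def] by (intro SV_add T SV_cmult U)
  have cf: "continuous_on (- {0}) f" and hf: "hom (- (of_nat (Suc CARD('n)) / 2) - \<nu>) e f"
    using f unfolding SV_def by (auto intro: smooth_off0_continuous)
  have z: "f v = 0" if v: "snd v \<noteq> 0" for v
  proof (rule zonal_orthogonal_imp_zero[OF cf hf v])
    fix m
    let ?W = "zonal (- \<nu>) v (e + 2 * m)"
    have v0: "v \<noteq> 0" using v by auto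
    have W: "SV (- \<nu>) e ?W" by (rule SV_zonal) simp
    have TW: "SV \<nu> e (Theta (- \<nu>) e ?W)" using Theta_SV[OF W] by simp
    have WW: "Theta \<nu> e (Theta (- \<nu>) e ?W) X = (- 1) ^ e * ?W X" if "X \<noteq> 0" for X
      using Theta_Theta_zonal[OF e, of "- \<nu>" v X m] \<nu> v0 that by simp
    have "chart_int (\<lambda>X. ?T X * ?W X) = chart_int (\<lambda>X. Theta \<nu> e U X * Theta (- \<nu>) e ?W X)"
      by (rule Theta_pairing[OF Theta_SV[OF U] W])
    also have "\<dots> = chart_int (\<lambda>X. U X * Theta \<nu> e (Theta (- \<nu>) e ?W) X)"
      by (rule Theta_pairing[OF U TW])
    also have "\<dots> = chart_int (\<lambda>X. (- 1) ^ e * (U X * ?W X))"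
      unfolding chart_int_def by (simp add: WW mult.left_commute)
    finally have 1: "chart_int (\<lambda>X. ?T X * ?W X) = (- 1) ^ e * chart_int (\<lambda>X. U X * ?W X)"
      unfolding chart_int_def by simp
    have "chart_int (\<lambda>X. f X * ?W X) = chart_int (\<lambda>X. ?T X * ?W X) + (- ((- 1) ^ e)) * chart_int (\<lambda>X. U X * ?W X)"
      unfolding chart_int_def f_def distrib_right mult.assoc
      by (subst Bochner_Integration.integral_add)
        (auto intro!: SV_product_integrable[OF T W] integrable_mult_right SV_product_integrable[OF U W])
    then show "chart_int (\<lambda>X. f X * ?W X) = 0" unfolding 1 by simp
  qed
  have "f Y = 0"
  proof (cases "snd Y = 0")
    \<comment> \<open>The points at infinity of the chart are reached by continuity.\<close>
    case True
    have "((\<lambda>t. f (fst Y, t)) \<longlongrightarrow> f (fst Y, 0)) (at 0)"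
    proof -
      have "isCont f Y" using cf Y by (simp add: continuous_on_eq_continuous_at open_Compl)
      moreover have "Y = (fst Y, 0)" using True by (simp add: prod_eq_iff)
      ultimately have "isCont f (fst Y, 0)" by simp
      moreover have "((\<lambda>t. (fst Y, t)) \<longlongrightarrow> (fst Y, 0)) (at 0)" by (intro tendsto_intros)
      ultimately show ?thesis by (rule isCont_tendsto_compose)
    qed
    moreover have "((\<lambda>t. f (fst Y, t)) \<longlongrightarrow> 0) (at (0::real))"
      by (rule tendsto_eventually) (auto simp: eventually_at_filter z)
    ultimately have "f (fst Y, 0) = 0" by (rule tendsto_unique[rotated]) simp
    then show ?thesis using True by (metis prod.collapse)
  qed (rule z)
  then show ?thesis by (simp add: f_def add_eq_0_iff)
qed

section \<open>Operators with rational symbols\<close>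

text \<open>At a pole a nicely meromorphic function has the value 0, which is also the convention of
  \<open>remove_sings\<close>.\<close>

lemma remove_sings_nicely:
  assumes "f nicely_meromorphic_on UNIV"
  shows "remove_sings f z = f z"
proof -
  from assms have "(is_pole f z \<and> f z = 0) \<or> f \<midarrow>z\<rightarrow> f z"
    by (auto simp: nicely_meromorphic_on_def)
  then show ?thesis
    using remove_sings_at_pole[of f z] remove_sings_eqI[of f "f z" z] by auto
qed

text \<open>Two meromorphic functions that agree on a half plane agree off a sparse set, and the
  normal form settles the remaining values. \<open>F\<close> may have arbitrary values at isolated
  points, hence \<open>remove_sings\<close>.\<close>

lemma mero_cont_eq:
  assumes F: "F meromorphic_on UNIV" and an: "\<And>z. Re z > c \<Longrightarrow> F analytic_on {z}"
    and eq: "\<And>z. Re z > c \<Longrightarrow> F z = f z"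
  shows "mero_cont f = remove_sings F"
  unfolding mero_cont_def
proof (rule the_equality)
  have r: "remove_sings F z = f z" if "Re z > c" for z
    using an[OF that] eq[OF that] by simp
  show "remove_sings F nicely_meromorphic_on UNIV \<and> (\<exists>c. \<forall>z. Re z > c \<longrightarrow> remove_sings F z = f z)"
    using remove_sings_nicely_meromorphic[OF F] r by blast
  fix G assume "G nicely_meromorphic_on UNIV \<and> (\<exists>c. \<forall>z. Re z > c \<longrightarrow> G z = f z)"
  then obtain c' where G: "G nicely_meromorphic_on UNIV" "\<And>z. Re z > c' \<Longrightarrow> G z = f z" by blast
  let ?H = "\<lambda>z. G z - F z"
  have H: "?H meromorphic_on UNIV"
    using G(1) F by (intro meromorphic_on_diff) (auto simp: nicely_meromorphic_on_def)
  have H0: "?H z = 0" if "Re z > max c c'" for z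
    using that G(2)[of z] eq[of z] by simp
  have "(\<forall>\<^sub>\<approx>z\<in>UNIV. ?H z = 0) \<or> (\<forall>\<^sub>\<approx>z\<in>UNIV. ?H z \<noteq> 0)"
    by (rule meromorphic_imp_constant_or_avoid[OF H]) auto
  then have ev: "\<forall>\<^sub>\<approx>z\<in>UNIV. ?H z = 0"
  proof
    assume *: "\<forall>\<^sub>\<approx>z\<in>UNIV. ?H z \<noteq> 0"
    define z0 where "z0 = complex_of_real (max c c' + 1)"
    have "\<forall>\<^sub>F z in at z0. ?H z \<noteq> 0"
      using eventually_cosparse_imp_eventually_at[OF *, of z0 UNIV] by simp
    moreover have "\<forall>\<^sub>F z in at z0. z \<in> {z. Re z > max c c'}"
      by (rule eventually_at_in_open')
        (auto simp: z0_def open_halfspace_Re_gt max_def)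
    ultimately have "\<forall>\<^sub>F z in at z0. False"
      by eventually_elim (use H0 in auto)
    then show ?thesis by simp
  qed
  show "G = remove_sings F"
  proof
    fix z
    have "\<forall>\<^sub>F w in at z. ?H w = 0"
      using eventually_cosparse_imp_eventually_at[OF ev, of z UNIV] by simp
    then have "\<forall>\<^sub>F w in at z. G w = F w" by eventually_elim simp
    then have "remove_sings G z = remove_sings F z" by (rule remove_sings_cong) simp
    then show "G z = remove_sings F z" using remove_sings_nicely[OF G(1)] by simp
  qed
qed

section \<open>Complex linear forms and derivatives\<close>

definition re_vec :: "(complex^'n) \<times> complex \<Rightarrow> (real^'n) \<times> real" where
  "re_vec a = ((\<chi> i. Re (vec_nth (fst a) i)), Re (snd a))"

definition im_vec :: "(complex^'n) \<times> complex \<Rightarrow> (real^'n) \<times> real" where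
  "im_vec a = ((\<chi> i. Im (vec_nth (fst a) i)), Im (snd a))"

text \<open>\<open>lin\<close> extended from the chart to a linear form on the whole space
  (\<open>lin_eq_cl\<close>). Real and imaginary parts are kept apart because the directions of
  \<open>ddir\<close> are real vectors.\<close>

definition cl :: "(complex^'n) \<times> complex \<Rightarrow> (real^'n) \<times> real \<Rightarrow> complex" where
  "cl a X = of_real (re_vec a \<bullet> X) + \<i> * of_real (im_vec a \<bullet> X)"

lemma lin_eq_cl: "lin a s = cl a (s, 1)"
proof -
  have "(\<Sum>i\<in>UNIV. vec_nth (fst a) i * of_real (vec_nth s i)) =
     of_real (\<Sum>i\<in>UNIV. Re (vec_nth (fst a) i) * vec_nth s i) + \<i> * of_real (\<Sum>i\<in>UNIV. Im (vec_nth (fst a) i) * vec_nth s i)"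
    by (simp add: complex_eq_iff)
  then show ?thesis
    by (simp add: lin_def cl_def re_vec_def im_vec_def inner_Pair inner_vec_def complex_eq_iff)
qed

lemma bilin_eq_cl: "bilin a b = cl a (re_vec b) + \<i> * cl a (im_vec b)"
  by (simp add: bilin_def cl_def re_vec_def im_vec_def inner_Pair inner_vec_def complex_eq_iff
      sum_subtractf sum.distrib algebra_simps)

lemma bilin_commute: "bilin a b = bilin b a"
  by (simp add: bilin_def mult.commute)

text \<open>Complex linear in the direction, not conjugate linear, to match
  \<open>bilin\<close>.\<close>

definition cdir :: "((real^'n) \<times> real \<Rightarrow> complex) \<Rightarrow> (complex^'n) \<times> complex \<Rightarrow> (real^'n) \<times> real \<Rightarrow> complex" where
  "cdir V a X = ddir V (re_vec a) X + \<i> * ddir V (im_vec a) X"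

definition cdirs :: "(complex^'n) \<times> complex \<Rightarrow> nat \<Rightarrow> ((real^'n) \<times> real \<Rightarrow> complex) \<Rightarrow> (real^'n) \<times> real \<Rightarrow> complex" where
  "cdirs a p V = ((\<lambda>V. cdir V a) ^^ p) V"

lemma cdirs_0 [simp]: "cdirs a 0 V = V"
  by (simp add: cdirs_def)

lemma cdirs_Suc: "cdirs a (Suc p) V = cdir (cdirs a p V) a"
  by (simp add: cdirs_def)

lemma smooth_off0_cl: "smooth_off0 (cl a)"
  unfolding cl_def[abs_def] by (intro smooth_off0_add smooth_off0_cmult smooth_off0_inner)

lemma smooth_off0_cdir: "smooth_off0 V \<Longrightarrow> smooth_off0 (cdir V a)"
  unfolding cdir_def[abs_def] by (intro smooth_off0_add smooth_off0_cmult smooth_off0_ddir)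

lemma smooth_off0_cdirs: "smooth_off0 V \<Longrightarrow> smooth_off0 (cdirs a p V)"
  by (induction p) (auto simp: cdirs_Suc smooth_off0_cdir)

lemma cdir_cong: "(\<And>X. X \<noteq> 0 \<Longrightarrow> V X = W X) \<Longrightarrow> X \<noteq> 0 \<Longrightarrow> cdir V a X = cdir W a X"
  unfolding cdir_def using ddir_cong[of V W X] by simp

lemma cdirs_cong:
  assumes "\<And>X. X \<noteq> 0 \<Longrightarrow> V X = W X" "X \<noteq> 0"
  shows "cdirs a p V X = cdirs a p W X"
  using assms(2)
proof (induction p arbitrary: X)
  case (Suc p)
  show ?case unfolding cdirs_Suc by (rule cdir_cong[OF Suc.IH Suc.prems])
qed (use assms in simp)

lemma cdir_cmult: "smooth_off0 V \<Longrightarrow> X \<noteq> 0 \<Longrightarrow> cdir (\<lambda>X. c * V X) a X = c * cdir V a X"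
  unfolding cdir_def by (simp add: ddir_cmult algebra_simps)

lemma cdirs_cmult:
  assumes "smooth_off0 V" "X \<noteq> 0"
  shows "cdirs a p (\<lambda>X. c * V X) X = c * cdirs a p V X"
  using assms(2)
proof (induction p arbitrary: X)
  case (Suc p)
  have "cdirs a (Suc p) (\<lambda>X. c * V X) X = cdir (\<lambda>X. c * cdirs a p V X) a X"
    unfolding cdirs_Suc by (rule cdir_cong[OF Suc.IH Suc.prems])
  then show ?case
    by (simp add: cdirs_Suc cdir_cmult[OF smooth_off0_cdirs[OF assms(1)] Suc.prems])
qed simp

lemma cdir_mult:
  "smooth_off0 V \<Longrightarrow> smooth_off0 W \<Longrightarrow> X \<noteq> 0 \<Longrightarrow>
    cdir (\<lambda>X. V X * W X) a X = V X * cdir W a X + cdir V a X * W X"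
  unfolding cdir_def by (simp add: ddir_mult algebra_simps)

lemma cdir_cl: "X \<noteq> 0 \<Longrightarrow> cdir (cl a) b X = bilin a b"
proof -
  assume X: "X \<noteq> 0"
  have "ddir (cl a) v X = cl a v" for v
    unfolding cl_def[abs_def]
    by (simp add: ddir_add[OF smooth_off0_inner smooth_off0_cmult[OF smooth_off0_inner] X]
        ddir_cmult[OF smooth_off0_inner X] ddir_inner)
  then show ?thesis by (simp add: cdir_def bilin_eq_cl)
qed

lemma cdir_cl_power:
  assumes "bilin a b = 0" "X \<noteq> 0"
  shows "cdir (\<lambda>X. cl a X ^ p) b X = 0"
  using assms(2)
proof (induction p arbitrary: X)
  case 0
  show ?case by (simp add: cdir_def ddir_const)
next
  case (Suc p)
  then show ?case
    using cdir_mult[OF smooth_off0_cl smooth_off0_power[OF smooth_off0_cl] Suc.prems] cdir_cl[OF Suc.prems] assms(1)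
    by simp
qed

definition Mop :: "(complex^'n) \<times> complex \<Rightarrow> (complex^'n) \<times> complex \<Rightarrow>
    ((real^'n) \<times> real \<Rightarrow> complex) \<Rightarrow> (real^'n) \<times> real \<Rightarrow> complex" where
  "Mop a b W X = cl a X * cdir W b X"

text \<open>Because \<open>bilin a b = 0\<close>, the form \<open>cl a\<close> is constant along
  \<open>b\<close>, and all its factors can be collected in front of the derivatives.\<close>

lemma Mop_funpow:
  assumes ab: "bilin a b = 0" and W: "smooth_off0 W" and "X \<noteq> 0"
  shows "(Mop a b ^^ p) W X = cl a X ^ p * cdirs b p W X"
  using assms(3)
proof (induction p arbitrary: X)
  case (Suc p)
  have "cdir ((Mop a b ^^ p) W) b X = cdir (\<lambda>X. cl a X ^ p * cdirs b p W X) b X"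
    by (rule cdir_cong[OF Suc.IH Suc.prems])
  also have "\<dots> = cl a X ^ p * cdirs b (Suc p) W X"
    by (simp add: cdir_mult[OF smooth_off0_power[OF smooth_off0_cl] smooth_off0_cdirs[OF W] Suc.prems]
        cdir_cl_power[OF ab Suc.prems] cdirs_Suc)
  finally have eq: "cdir ((Mop a b ^^ p) W) b X = cl a X ^ p * cdirs b (Suc p) W X" .
  have "(Mop a b ^^ Suc p) W X = cl a X * cdir ((Mop a b ^^ p) W) b X"
    by (simp only: funpow.simps comp_def Mop_def[of a b "(Mop a b ^^ p) W" X])
  then show ?case unfolding eq by (simp only: power_Suc mult.assoc)
qed simp

lemma Mop_expand:
  "Mop a b W X = (of_real (re_vec a \<bullet> X) * ddir W (re_vec b) X + \<i> * (of_real (re_vec a \<bullet> X) * ddir W (im_vec b) X)) +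
    (\<i> * (of_real (im_vec a \<bullet> X) * ddir W (re_vec b) X) + (- 1) * (of_real (im_vec a \<bullet> X) * ddir W (im_vec b) X))"
proof -
  have "(A + \<i> * B) * (C + \<i> * E) = (A * C + \<i> * (A * E)) + (\<i> * (B * C) + (\<i> * \<i>) * (B * E))" for A B C E :: complex
    by (simp only: algebra_simps)
  then show ?thesis unfolding Mop_def cl_def cdir_def by simp
qed

lemma SV_Mop: "SV \<nu> e W \<Longrightarrow> SV \<nu> e (Mop a b W)"
  unfolding Mop_expand[abs_def] by (intro SV_add SV_cmult SV_inner_ddir)

lemma SV_Mop_funpow: "SV \<nu> e W \<Longrightarrow> SV \<nu> e ((Mop a b ^^ p) W)"
  by (induction p) (auto intro: SV_Mop)

text \<open>\<open>Theta_inner_ddir\<close> holds for real directions, so \<open>Mop_expand\<close>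
  splits the operator into four real ones. Reassembled, the terms without derivative have the
  coefficient \<open>bilin a b\<close> and vanish.\<close>

lemma Theta_Mop:
  assumes W: "SV \<nu> e W" and ab: "bilin a b = 0" and Y: "Y \<noteq> 0"
  shows "Theta \<nu> e (Mop a b W) Y = - Mop b a (Theta \<nu> e W) Y"
proof -
  let ?T = "Theta \<nu> e W"
  note S = SV_inner_ddir[OF W]
  have "Theta \<nu> e (Mop a b W) Y =
    (Theta \<nu> e (\<lambda>X. of_real (re_vec a \<bullet> X) * ddir W (re_vec b) X) Y + \<i> * Theta \<nu> e (\<lambda>X. of_real (re_vec a \<bullet> X) * ddir W (im_vec b) X) Y) +
    (\<i> * Theta \<nu> e (\<lambda>X. of_real (im_vec a \<bullet> X) * ddir W (re_vec b) X) Y + (- 1) * Theta \<nu> e (\<lambda>X. of_real (im_vec a \<bullet> X) * ddir W (im_vec b) X) Y)"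
    unfolding Mop_expand[abs_def]
    by (simp only: Theta_add[OF SV_add[OF S SV_cmult[OF S]] SV_add[OF SV_cmult[OF S] SV_cmult[OF S]] Y]
        Theta_add[OF S SV_cmult[OF S] Y] Theta_add[OF SV_cmult[OF S] SV_cmult[OF S] Y] Theta_cmult[OF S Y])
  also have "\<dots> = - (bilin a b * ?T Y + Mop b a ?T Y)"
  proof -
    have ii: "\<i> * (\<i> * z) = - z" for z by (simp flip: mult.assoc)
    show ?thesis
      unfolding Theta_inner_ddir[OF W Y] bilin_eq_cl Mop_def cl_def cdir_def
      by (simp add: algebra_simps ii)
  qed
  finally show ?thesis by (simp add: ab)
qed

lemma Mop_cong: "(\<And>X. X \<noteq> 0 \<Longrightarrow> V X = W X) \<Longrightarrow> X \<noteq> 0 \<Longrightarrow> Mop a b V X = Mop a b W X"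
  unfolding Mop_def using cdir_cong by metis

lemma Theta_Mop_funpow:
  assumes W: "SV \<nu> e W" and ab: "bilin a b = 0" and "Y \<noteq> 0"
  shows "Theta \<nu> e ((Mop a b ^^ p) W) Y = (- 1) ^ p * (Mop b a ^^ p) (Theta \<nu> e W) Y"
  using assms(3)
proof (induction p arbitrary: Y)
  case (Suc p)
  have sm: "smooth_off0 ((Mop b a ^^ p) (Theta \<nu> e W))"
    using SV_Mop_funpow[OF Theta_SV[OF W]] by (simp add: SV_def)
  have "Theta \<nu> e ((Mop a b ^^ Suc p) W) Y = - Mop b a (Theta \<nu> e ((Mop a b ^^ p) W)) Y"
    using Theta_Mop[OF SV_Mop_funpow[OF W] ab Suc.prems] by simp
  also have "Mop b a (Theta \<nu> e ((Mop a b ^^ p) W)) Y = Mop b a (\<lambda>X. (- 1) ^ p * (Mop b a ^^ p) (Theta \<nu> e W) X) Y"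
    by (rule Mop_cong[OF Suc.IH Suc.prems])
  also have "\<dots> = (- 1) ^ p * (Mop b a ^^ Suc p) (Theta \<nu> e W) Y"
    by (simp add: Mop_def cdir_cmult[OF sm Suc.prems])
  finally show ?case by simp
qed simp

lemma famJ_cl:
  fixes V :: "complex \<Rightarrow> (real^'n) \<times> real \<Rightarrow> complex"
  assumes "famJ \<alpha> e V"
  shows "famJ (\<alpha> - 1) (Suc e) (\<lambda>z X. cl a X * V z X)"
proof -
  have "famJ (\<alpha> - 1) (Suc e) (\<lambda>z X. of_real (re_vec a \<bullet> X) * V z X + \<i> * (of_real (im_vec a \<bullet> X) * V z X))"
    by (intro fam_add fam_cmult famJ_inner assms)
  then show ?thesis by (rule fam_cong) (simp add: cl_def algebra_simps)
qed

lemma cdir_Phi: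
  fixes V :: "complex \<Rightarrow> (real^'n) \<times> real \<Rightarrow> complex"
  assumes V: "famJ \<alpha> e V" and Y: "Y \<noteq> 0"
  shows "cdir (\<lambda>Y. Phi \<alpha> e V Y z) a Y = m2 e (\<alpha> + z) * Phi (\<alpha> - 1) (Suc e) (\<lambda>z X. cl a X * V z X) Y z"
proof -
  have "Phi (\<alpha> - 1) (Suc e) (\<lambda>z X. cl a X * V z X) =
    Phi (\<alpha> - 1) (Suc e) (\<lambda>z X. of_real (re_vec a \<bullet> X) * V z X + \<i> * (of_real (im_vec a \<bullet> X) * V z X))"
    by (rule Phi_cong) (simp add: cl_def algebra_simps)
  then show ?thesis
    unfolding cdir_def ddir_Phi[OF V Y]
    by (simp only: Phi_add[OF famJ_inner[OF V] fam_cmult[OF famJ_inner[OF V]] Y]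
        Phi_cmult[OF famJ_inner[OF V] Y] distrib_left mult.left_commute[of \<i> "m2 e (\<alpha> + z)"])
qed

lemma famJ_cl_power:
  fixes V :: "complex \<Rightarrow> (real^'n) \<times> real \<Rightarrow> complex"
  assumes "famJ \<alpha> e V"
  shows "famJ (\<alpha> - of_nat p) (e + p) (\<lambda>z X. cl a X ^ p * V z X)"
proof (induction p)
  case (Suc p)
  have "\<alpha> - of_nat (Suc p) = \<alpha> - of_nat p - 1" by simp
  then show ?case using famJ_cl[OF Suc, of a] by (simp only: add_Suc_right power_Suc mult.assoc)
qed (use assms in simp)

text \<open>Each derivative brings down one linear form under the transform and lowers the exponent
  by one. This is how the numerator and the denominator of the symbol arise together.\<close>

lemma cdirs_Phi:
  fixes V :: "complex \<Rightarrow> (real^'n) \<times> real \<Rightarrow> complex"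
  assumes V: "famJ \<alpha> e V" and "Y \<noteq> 0"
  shows "cdirs a p (\<lambda>Y. Phi \<alpha> e V Y z) Y =
    (\<Prod>j<p. m2 (e + j) (\<alpha> + z - of_nat j)) * Phi (\<alpha> - of_nat p) (e + p) (\<lambda>z X. cl a X ^ p * V z X) Y z"
  using assms(2)
proof (induction p arbitrary: Y)
  case (Suc p)
  let ?c = "\<Prod>j<p. m2 (e + j) (\<alpha> + z - of_nat j)"
  note Vp = famJ_cl_power[OF V, of p a]
  have eq: "\<alpha> - of_nat (Suc p) = \<alpha> - of_nat p - 1" "\<alpha> - of_nat p + z = \<alpha> + z - of_nat p" by simp_all
  have "cdirs a (Suc p) (\<lambda>Y. Phi \<alpha> e V Y z) Y = cdir (\<lambda>Y. ?c * Phi (\<alpha> - of_nat p) (e + p) (\<lambda>z X. cl a X ^ p * V z X) Y z) a Y"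
    unfolding cdirs_Suc by (rule cdir_cong[OF Suc.IH Suc.prems])
  also have "\<dots> = ?c * (m2 (e + p) (\<alpha> - of_nat p + z) * Phi (\<alpha> - of_nat p - 1) (Suc (e + p)) (\<lambda>z X. cl a X * (cl a X ^ p * V z X)) Y z)"
    unfolding cdir_cmult[OF Phi_smooth[OF Vp] Suc.prems] cdir_Phi[OF Vp Suc.prems] ..
  finally show ?case
    unfolding eq by (simp only: prod.lessThan_Suc add_Suc_right power_Suc mult.assoc)
qed simp

text \<open>By \<open>m2_nf\<close> the product telescopes: undoing the normalization leaves the
  falling product \<open>\<beta> (\<beta> - 1) \<dots> (\<beta> - p + 1)\<close> of a power
  differentiated \<open>p\<close> times.\<close>

lemma m2_prod_nf:
  "(\<Prod>j<p. m2 (e + j) (\<beta> - of_nat j)) * nf (e + p) (\<beta> - of_nat p) = (\<Prod>j<p. \<beta> - of_nat j) * nf e \<beta>"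
proof (induction p)
  case (Suc p)
  have "\<beta> - of_nat (Suc p) = \<beta> - of_nat p - 1" by simp
  then have "(\<Prod>j<Suc p. m2 (e + j) (\<beta> - of_nat j)) * nf (e + Suc p) (\<beta> - of_nat (Suc p)) =
    (\<Prod>j<p. m2 (e + j) (\<beta> - of_nat j)) * (m2 (e + p) (\<beta> - of_nat p) * nf (Suc (e + p)) (\<beta> - of_nat p - 1))"
    by (simp only: prod.lessThan_Suc mult.assoc add_Suc_right)
  also have "\<dots> = (\<beta> - of_nat p) * ((\<Prod>j<p. m2 (e + j) (\<beta> - of_nat j)) * nf (e + p) (\<beta> - of_nat p))"
    unfolding m2_nf by (simp only: mult.left_commute)
  also have "\<dots> = (\<Prod>j<Suc p. \<beta> - of_nat j) * nf e \<beta>"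
    unfolding Suc by (simp only: prod.lessThan_Suc mult_ac)
  finally show ?case .
qed simp

text \<open>At \<open>t = 0\<close> both sides are 0, so no exceptional set appears in the
  integrals.\<close>

lemma spow_diff_power: "spow \<alpha> e t / of_real t ^ p = spow (\<alpha> - of_nat p) (e + p) t"
proof (cases "t = 0")
  case False
  have "spow (of_nat p) p t = of_real t ^ p"
  proof (induction p)
    case (Suc p)
    show ?case using spow_add[of 1 "of_nat p" "Suc 0" p t] Suc by (simp add: spow_one)
  qed (use False in \<open>simp add: spow_def\<close>)
  then have "spow \<alpha> (e + p + p) t = spow (\<alpha> - of_nat p) (e + p) t * of_real t ^ p"
    using spow_add[of "\<alpha> - of_nat p" "of_nat p" "e + p" p t] by simp
  moreover have "spow \<alpha> (e + p + p) t = spow \<alpha> e t" by (rule spow_parity) presburger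
  ultimately show ?thesis using False by (simp add: field_simps)
qed simp

section \<open>Evaluation of the kernel operators\<close>

text \<open>The denominator of the symbol lowers the exponent of the kernel by \<open>p\<close> and
  shifts its parity by \<open>p\<close>; the factor with \<open>b\<close> depends on
  \<open>y\<close> only and leaves the integral.\<close>

lemma kernel_integrand:
  fixes x y :: "real^'n"
  assumes "\<alpha> = - (of_nat (Suc CARD('n)) / 2) + \<nu>"
  shows "(cl a (x, 1) * cl b (y, 1) / of_real (1 + x \<bullet> y)) ^ p * spow (- (of_nat (CARD('n) + 1) / 2) + \<nu> + z) e (1 + x \<bullet> y) *
      of_real (1 + x \<bullet> x) powr (- z / 2) * U (x, 1) =
    cl b (y, 1) ^ p * (spow (\<alpha> - of_nat p + z) (e + p) ((x, 1::real) \<bullet> (y, 1)) * (cl a (x, 1) ^ p * homfam U z (x, 1)))"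
proof -
  have ip: "(x, 1::real) \<bullet> (y, 1) = 1 + x \<bullet> y" by (simp add: inner_Pair add.commute)
  have pos: "1 + x \<bullet> x > 0" using inner_ge_zero[of x] by linarith
  have np: "of_real (1 + x \<bullet> x) powr (- z / 2) = npow (- z) (x, 1::real)"
  proof -
    have "npow (- z) (x, 1::real) = of_real (sqrt (1 + x \<bullet> x)) powr (- z)"
      by (simp only: npow_def norm_chart)
    also have "\<dots> = exp (- z * of_real (ln (sqrt (1 + x \<bullet> x))))"
      using pos by (simp add: powr_def Ln_of_real del: of_real_add of_real_1)
    also have "ln (sqrt (1 + x \<bullet> x)) = ln (1 + x \<bullet> x) / 2"
      using pos by (simp add: ln_sqrt)
    also have "exp (- z * of_real (ln (1 + x \<bullet> x) / 2)) = of_real (1 + x \<bullet> x) powr (- z / 2)"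
      using pos by (simp add: powr_def Ln_of_real del: of_real_add of_real_1)
    finally show ?thesis ..
  qed
  have ex: "- (of_nat (CARD('n) + 1) / 2) + \<nu> + z = \<alpha> + z" by (simp add: assms)
  have ex2: "\<alpha> + z - of_nat p = \<alpha> - of_nat p + z" by simp
  have "(cl a (x, 1) * cl b (y, 1) / of_real (1 + x \<bullet> y)) ^ p * spow (\<alpha> + z) e (1 + x \<bullet> y) =
     cl a (x, 1) ^ p * cl b (y, 1) ^ p * (spow (\<alpha> + z) e (1 + x \<bullet> y) / of_real (1 + x \<bullet> y) ^ p)"
    by (simp add: power_divide power_mult_distrib del: of_real_add of_real_1)
  then have eq: "(cl a (x, 1) * cl b (y, 1) / of_real (1 + x \<bullet> y)) ^ p * spow (\<alpha> + z) e (1 + x \<bullet> y) =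
     cl a (x, 1) ^ p * cl b (y, 1) ^ p * spow (\<alpha> - of_nat p + z) (e + p) ((x, 1::real) \<bullet> (y, 1))"
    unfolding spow_diff_power ex2 ip .
  show ?thesis unfolding ex np eq by (simp only: mult_ac)
qed

lemma Cnorm_eq:
  assumes "e \<in> {0, 1}"
  shows "Cnorm n \<nu> e = Cpre n \<nu> e * nf e (- (of_nat (Suc n) / 2) + \<nu>)"
proof -
  have "e mod 2 = e" using assms by auto
  moreover have "of_nat (1 + n) / 4 - \<nu> / 2 + of_nat e / 2 = (of_nat (Suc n) / 2 - \<nu> + of_nat e) / 2"
    by (simp add: field_simps)
  moreover have "(1 - of_nat n) / 4 + \<nu> / 2 + of_nat e / 2 = (- (of_nat (Suc n) / 2) + \<nu> + 1 + of_nat e) / 2"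
    by (simp add: field_simps)
  ultimately show ?thesis
    unfolding Cnorm_def Cpre_def nf_def by (simp only: rGamma_inverse_Gamma divide_inverse)
qed

lemma tendsto_Cpre:
  assumes "Re \<nu> = 0"
  shows "((\<lambda>z. Cpre n (\<nu> + z) e) \<longlongrightarrow> Cpre n \<nu> e) (at 0)"
proof -
  have "Re ((of_nat (Suc n) / 2 - (\<nu> + 0) + of_nat e) / 2) > 0"
    using assms by (auto intro!: add_pos_nonneg)
  then have "(of_nat (Suc n) / 2 - (\<nu> + 0) + of_nat e) / 2 \<notin> \<int>\<^sub>\<le>\<^sub>0"
    by (metis nonpos_Ints_cases Re_complex_of_real of_int_le_0_iff of_real_of_int_eq not_less)
  then have "((\<lambda>z. (- \<i>) ^ e * exp ((- (of_nat n / 2) + (\<nu> + z)) * Ln (of_real pi)) * Gamma ((of_nat (Suc n) / 2 - (\<nu> + z) + of_nat e) / 2)) \<longlongrightarrow>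
     (- \<i>) ^ e * exp ((- (of_nat n / 2) + (\<nu> + 0)) * Ln (of_real pi)) * Gamma ((of_nat (Suc n) / 2 - (\<nu> + 0) + of_nat e) / 2)) (at 0)"
    by (intro tendsto_intros) auto
  then show ?thesis by (simp add: Cpre_def powr_def del: of_nat_Suc)
qed

lemma nf_nonzero:
  assumes "Re \<beta> > 0"
  shows "nf e \<beta> \<noteq> 0"
proof -
  have "Re ((\<beta> + 1 + of_nat (e mod 2)) / 2) > 0" using assms by (auto intro!: add_pos_nonneg)
  then have "(\<beta> + 1 + of_nat (e mod 2)) / 2 \<notin> \<int>\<^sub>\<le>\<^sub>0"
    by (metis nonpos_Ints_cases Re_complex_of_real of_int_le_0_iff of_real_of_int_eq not_less)
  then show ?thesis by (simp add: nf_def rGamma_eq_zero_iff)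
qed

text \<open>Far to the right the integral is \<open>J\<close> at exponent
  \<open>\<alpha> - p + z\<close>, which \<open>cdirs_Phi\<close> expresses by derivatives of the
  transform without symbol. The continuation to \<open>z = 0\<close> is then a quotient of entire
  functions.\<close>

lemma kernel_op_eq:
  fixes U :: "(real^'n) \<times> real \<Rightarrow> complex" and y :: "real^'n"
  assumes U: "SV \<nu> e U" and e: "e \<in> {0, 1}" and \<nu>: "Re \<nu> = 0"
  shows "kernel_op \<nu> e (\<lambda>x y. (cl a (x, 1) * cl b (y, 1) / of_real (1 + x \<bullet> y)) ^ p) (\<lambda>s. U (s, 1)) y =
    cl b (y, 1) ^ p * cdirs a p (Theta \<nu> e U) (y, 1) / (\<Prod>j<p. - (of_nat (Suc CARD('n)) / 2) + \<nu> - of_nat j)"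
proof -
  define \<alpha> where "\<alpha> = - (of_nat (Suc CARD('n)) / 2) + \<nu>"
  let ?Y = "(y, 1::real)"
  let ?V = "homfam U"
  let ?Vp = "\<lambda>z X. cl a X ^ p * homfam U z X"
  have V: "famJ \<alpha> e ?V" unfolding \<alpha>_def by (rule SV_fam[OF U])
  have Vp: "famJ (\<alpha> - of_nat p) (e + p) ?Vp" by (rule famJ_cl_power[OF V])
  define P where "P z = (\<Prod>j<p. \<alpha> + z - of_nat j)" for z
  define \<Psi> where "\<Psi> z = (\<Prod>j<p. m2 (e + j) (\<alpha> + z - of_nat j)) * Phi (\<alpha> - of_nat p) (e + p) ?Vp ?Y z" for z
  define B where "B = cl b ?Y ^ p"
  have hP: "P holomorphic_on S" "\<Psi> holomorphic_on S" for S
    unfolding P_def[abs_def] \<Psi>_def[abs_def] by (intro holomorphic_intros Vp chart_nonzero)+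
  \<comment> \<open>The factor \<open>nf\<close> in the denominator may vanish at
    \<open>z = 0\<close>, so that \<open>F\<close> may have a pole there. It cancels against the
    same factor of \<open>Cnorm\<close> before the limit is taken.\<close>
  define F where "F z = B * \<Psi> z / (nf e (\<alpha> + z) * P z)" for z
  have Pnz: "P z \<noteq> 0" if "Re (\<alpha> + z) > real p" for z
  proof -
    have "\<alpha> + z - of_nat j \<noteq> 0" if "j < p" for j
    proof
      assume "\<alpha> + z - of_nat j = 0"
      then have "Re (\<alpha> + z) = real j" by simp
      then show False using \<open>Re (\<alpha> + z) > real p\<close> that by simp
    qed
    then show ?thesis by (simp add: P_def)
  qed
  \<comment> \<open>All factors have negative real part, since
    \<open>Re \<alpha> = - (n + 1) / 2\<close>.\<close>
  have P0: "P 0 \<noteq> 0"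
  proof -
    have "\<alpha> + 0 - of_nat j \<noteq> 0" for j
    proof
      assume "\<alpha> + 0 - of_nat j = 0"
      then have "Re \<alpha> = real j" by simp
      moreover have "Re \<alpha> = - ((1 + real CARD('n)) / 2)" using \<nu> by (simp add: \<alpha>_def)
      moreover have "(1 + real CARD('n)) / 2 > 0" by (simp add: add_pos_nonneg)
      ultimately show False by linarith
    qed
    then show ?thesis by (simp add: P_def)
  qed
  let ?f = "\<lambda>z. \<integral>x. (cl a (x, 1) * cl b (y, 1) / of_real (1 + x \<bullet> y)) ^ p * spow (- (of_nat (CARD('n) + 1) / 2) + \<nu> + z) e (1 + x \<bullet> y) *
       of_real (1 + x \<bullet> x) powr (- z / 2) * U (x, 1) \<partial>lborel"
  have f: "?f z = B * J (\<alpha> - of_nat p + z) (e + p) (?Vp z) ?Y" for z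
    unfolding J_def chart_int_def B_def integral_mult_right_zero[symmetric]
    by (intro Bochner_Integration.integral_cong refl kernel_integrand[OF \<alpha>_def])
  have Ff: "F z = ?f z" if z: "Re z > real p - Re \<alpha>" for z
  proof -
    have r: "Re (\<alpha> + z) > real p" "Re (\<alpha> - of_nat p + z) > 0" using z by auto
    have eq: "\<alpha> - of_nat p + z = \<alpha> + z - of_nat p" by simp
    have n: "nf e (\<alpha> + z) \<noteq> 0" using r by (intro nf_nonzero) (meson le_less_trans of_nat_0_le_iff)
    have "\<Psi> z = ((\<Prod>j<p. m2 (e + j) (\<alpha> + z - of_nat j)) * nf (e + p) (\<alpha> + z - of_nat p)) * J (\<alpha> - of_nat p + z) (e + p) (?Vp z) ?Y"
      unfolding \<Psi>_def Phi_eq_J[OF Vp chart_nonzero r(2)] unfolding eq by (simp only: mult.assoc)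
    also have "\<dots> = (nf e (\<alpha> + z) * P z) * J (\<alpha> - of_nat p + z) (e + p) (?Vp z) ?Y"
      unfolding m2_prod_nf P_def by (simp only: mult_ac)
    finally show ?thesis unfolding f F_def using n Pnz[OF r(1)] by simp
  qed
  have an: "F analytic_on {z}" if z: "Re z > real p - Re \<alpha>" for z
  proof -
    let ?S = "{z. Re (\<alpha> + z) > real p}"
    have "nf e (\<alpha> + w) \<noteq> 0" if "w \<in> ?S" for w
      by (rule nf_nonzero, rule le_less_trans[OF of_nat_0_le_iff[of p]]) (use that in blast)
    then have "F holomorphic_on ?S"
      unfolding F_def[abs_def] using Pnz by (intro holomorphic_intros hP) auto
    moreover have "z \<in> ?S" using z by simp
    ultimately show ?thesis using open_half_plane analytic_at by blast
  qed
  have ent: "g analytic_on UNIV" if "g holomorphic_on UNIV" for g :: "complex \<Rightarrow> complex"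
    using that analytic_on_open by blast
  have mer: "F meromorphic_on UNIV"
    unfolding F_def[abs_def]
    by (intro meromorphic_on_divide analytic_on_imp_meromorphic_on ent holomorphic_intros hP)
  have mc: "mero_cont ?f = remove_sings F"
    by (rule mero_cont_eq[OF mer an Ff])
  have ev1: "\<forall>\<^sub>F z in at 0. remove_sings F z = F z"
    by (intro eventually_remove_sings_eq_at meromorphic_on_isolated_singularity meromorphic_on_subset[OF mer]) auto
  \<comment> \<open>The entire function is not identically zero, as the value at exponent 1 shows,
    so its zeros are isolated.\<close>
  have ev2: "\<forall>\<^sub>F z in at 0. nf e (\<alpha> + z) \<noteq> 0 \<and> z \<in> UNIV"
    by (rule non_zero_neighbour_alt[of _ _ _ "1 - \<alpha>"]) (auto intro!: holomorphic_intros nf_nonzero)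
  have "((\<lambda>z. Cpre CARD('n) (\<nu> + z) e * (B * \<Psi> z / P z)) \<longlongrightarrow> Cpre CARD('n) \<nu> e * (B * \<Psi> 0 / P 0)) (at 0)"
  proof (intro tendsto_intros tendsto_Cpre \<nu> P0)
    have "isCont \<Psi> 0" "isCont P 0"
      using hP[of UNIV] by (auto intro!: continuous_on_interior holomorphic_on_imp_continuous_on)
    then show "\<Psi> \<midarrow>0\<rightarrow> \<Psi> 0" "P \<midarrow>0\<rightarrow> P 0" by (simp_all add: isCont_def)
  qed
  moreover have "\<forall>\<^sub>F z in at 0. Cpre CARD('n) (\<nu> + z) e * (B * \<Psi> z / P z) = Cnorm CARD('n) (\<nu> + z) e * mero_cont ?f z"
    using ev1 ev2
  proof eventually_elim
    case (elim z)
    have "- (of_nat (Suc CARD('n)) / 2) + (\<nu> + z) = \<alpha> + z" by (simp add: \<alpha>_def)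
    then have "Cnorm CARD('n) (\<nu> + z) e = Cpre CARD('n) (\<nu> + z) e * nf e (\<alpha> + z)"
      using Cnorm_eq[OF e, of "CARD('n)" "\<nu> + z"] by (simp only:)
    then show ?case using elim unfolding mc by (simp add: F_def)
  qed
  ultimately have "((\<lambda>z. Cnorm CARD('n) (\<nu> + z) e * mero_cont ?f z) \<longlongrightarrow> Cpre CARD('n) \<nu> e * (B * \<Psi> 0 / P 0)) (at 0)"
    by (rule Lim_transform_eventually)
  then have "kernel_op \<nu> e (\<lambda>x y. (cl a (x, 1) * cl b (y, 1) / of_real (1 + x \<bullet> y)) ^ p) (\<lambda>s. U (s, 1)) y =
      Cpre CARD('n) \<nu> e * (B * \<Psi> 0 / P 0)"
    unfolding kernel_op_def by (rule tendsto_Lim[OF at_neq_bot])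
  also have "\<dots> = B * (Cpre CARD('n) \<nu> e * \<Psi> 0) / P 0"
    by (simp only: mult.left_commute times_divide_eq_right)
  also have "Cpre CARD('n) \<nu> e * \<Psi> 0 = cdirs a p (Theta \<nu> e U) ?Y"
    unfolding Theta_def[abs_def] \<alpha>_def[symmetric] \<Psi>_def
    by (simp only: cdirs_cmult[OF Phi_smooth[OF V] chart_nonzero] cdirs_Phi[OF V chart_nonzero])
  also have "P 0 = (\<Prod>j<p. - (of_nat (Suc CARD('n)) / 2) + \<nu> - of_nat j)"
    by (simp only: P_def \<alpha>_def add_0_right)
  finally show ?thesis by (simp only: B_def)
qed

section \<open>The quotient of Gamma factors\<close>

text \<open>Raising \<open>\<rho>\<close> by one flips the parity \<open>\<eta>\<close> as well, so
  that two of the four Gamma arguments are unchanged and the other two move by a full 1. The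
  functional equation extracts the quotient; \<open>Im \<mu> \<noteq> 0\<close> excludes
  poles.\<close>

lemma G_gamma_step:
  fixes \<mu> :: complex and n p :: nat
  assumes "Im \<mu> \<noteq> 0" "\<eta> \<in> {0, 1 :: nat}"
  defines "g \<equiv> \<lambda>\<eta> \<rho>. (Gamma ((- of_nat n + \<mu> - \<rho> + \<eta>) / 2) / Gamma ((of_nat n + 1 - \<mu> + \<rho> + \<eta>) / 2)) *
     (Gamma ((\<mu> + \<rho> + \<eta>) / 2) / Gamma ((1 - \<mu> - \<rho> + \<eta>) / 2))"
  shows "g (of_nat (1 - \<eta>)) (of_nat (Suc p)) = (\<mu> + of_nat p) / (of_nat n + 1 - \<mu> + of_nat p) * g (of_nat \<eta>) (of_nat p)"
proof -
  have G: "Gamma (z + 1) = z * Gamma z" if "Im z \<noteq> 0" for z :: complex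
    by (rule Gamma_plus1) (use that nonpos_Ints_subset_Ints complex_is_Int_iff in blast)
  let ?x = "(of_nat n + 1 - \<mu> + of_nat p) / 2" and ?y = "(\<mu> + of_nat p) / 2"
  have nz: "?x \<noteq> 0" "?y \<noteq> 0"
    using assms(1) by (auto simp: complex_eq_iff)
  have Gx: "Gamma (?x + 1) = ?x * Gamma ?x" "Gamma (?y + 1) = ?y * Gamma ?y"
    "Gamma (- ?x + 1) = - ?x * Gamma (- ?x)" "Gamma (- ?y + 1) = - ?y * Gamma (- ?y)"
    using assms(1) by (intro G; simp)+
  have q: "(\<mu> + of_nat p) / (of_nat n + 1 - \<mu> + of_nat p) = ?y / ?x"
  proof -
    have "u / v = (u / 2) / (v / 2)" for u v :: complex by simp
    then show ?thesis .
  qed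
  show ?thesis
  proof (cases "\<eta> = 0")
    case True
    have "g (of_nat (1 - \<eta>)) (of_nat (Suc p)) =
        (Gamma ((- of_nat n + \<mu> - of_nat p) / 2) / Gamma (?x + 1)) * (Gamma (?y + 1) / Gamma ((1 - \<mu> - of_nat p) / 2))"
      unfolding g_def True by (intro arg_cong2[where f = times] arg_cong2[where f = "(/)"] arg_cong[where f = Gamma])
        (simp_all add: field_simps)
    moreover have "g (of_nat \<eta>) (of_nat p) =
        (Gamma ((- of_nat n + \<mu> - of_nat p) / 2) / Gamma ?x) * (Gamma ?y / Gamma ((1 - \<mu> - of_nat p) / 2))"
      unfolding g_def True by simp
    moreover have "A / (x * B) * (y * C / D) = y / x * (A / B * (C / D))" for A B C D x y :: complex
      by (simp add: mult_ac)
    ultimately show ?thesis unfolding q Gx by metis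
  next
    case False
    then have eta: "\<eta> = 1" using assms(2) by simp
    have "g (of_nat (1 - \<eta>)) (of_nat (Suc p)) =
        (Gamma (- ?x) / Gamma ((of_nat n + 2 - \<mu> + of_nat p) / 2)) * (Gamma ((\<mu> + of_nat p + 1) / 2) / Gamma (- ?y))"
      unfolding g_def eta by (intro arg_cong2[where f = times] arg_cong2[where f = "(/)"] arg_cong[where f = Gamma])
        (simp_all add: field_simps)
    moreover have "g (of_nat \<eta>) (of_nat p) =
        (Gamma (- ?x + 1) / Gamma ((of_nat n + 2 - \<mu> + of_nat p) / 2)) * (Gamma ((\<mu> + of_nat p + 1) / 2) / Gamma (- ?y + 1))"
      unfolding g_def eta by (intro arg_cong2[where f = times] arg_cong2[where f = "(/)"] arg_cong[where f = Gamma])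
        (simp_all add: field_simps)
    moreover have "A / B * (C / D) = y / x * ((- x * A) / B * (C / (- y * D)))" if "x \<noteq> 0" "y \<noteq> 0" for A B C D x y :: complex
      using that by simp
    ultimately show ?thesis unfolding q Gx using nz by metis
  qed
qed

text \<open>For \<open>p = 0\<close> the Gamma factors cancel in pairs, none of them being 0. Every
  further step multiplies by the quotient of \<open>G_gamma_step\<close> and, through
  \<open>(- 1) ^ \<delta>\<close>, by a sign.\<close>

lemma G_gamma_eq_prod:
  fixes \<mu> :: complex
  assumes \<mu>: "Im \<mu> \<noteq> 0" and e: "e \<in> {0, 1}"
  shows "G_gamma n \<mu> e (of_nat p) (p mod 2) = (- 1) ^ p * (\<Prod>j<p. (\<mu> + of_nat j) / (of_nat n + 1 - \<mu> + of_nat j))"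
proof (induction p)
  case 0
  have nz: "Gamma z \<noteq> 0" if "Im z \<noteq> 0" for z :: complex
    using that nonpos_Ints_subset_Ints complex_is_Int_iff by (subst Gamma_eq_zero_iff) blast
  have "Gamma ((of_nat n + 1 - \<mu> + of_nat e) / 2) \<noteq> 0" "Gamma ((- of_nat n + \<mu> + of_nat e) / 2) \<noteq> 0"
    "Gamma ((1 - \<mu> + of_nat e) / 2) \<noteq> 0" "Gamma ((\<mu> + of_nat e) / 2) \<noteq> 0"
    using \<mu> by (intro nz; simp)+
  then show ?case by (simp add: G_gamma_def Let_def)
next
  case (Suc p)
  define \<eta> where "\<eta> = (e + p) mod 2"
  have eta: "\<eta> \<in> {0, 1}" unfolding \<eta>_def by auto
  have h: "\<bar>int e - int (p mod 2)\<bar> = int \<eta>" "\<bar>int e - int (Suc p mod 2)\<bar> = int (1 - \<eta>)"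
    using e unfolding \<eta>_def by (auto simp: mod_Suc; presburger)+
  have "of_int \<bar>int e - int (p mod 2)\<bar> = (of_nat \<eta> :: complex)" "of_int \<bar>int e - int (Suc p mod 2)\<bar> = (of_nat (1 - \<eta>) :: complex)"
    unfolding h by (simp_all only: of_int_of_nat_eq)
  moreover have "(- 1 :: complex) ^ (Suc p mod 2) = - ((- 1) ^ (p mod 2))"
    by (cases "even p") (auto simp: mod_Suc parity_cases even_iff_mod_2_eq_zero odd_iff_mod_2_eq_one)
  moreover have regroup: "s * A * B * C * D = s * (A * C) * (B * D)" for s A B C D :: complex
    by (simp only: mult_ac)
  ultimately have "G_gamma n \<mu> e (of_nat (Suc p)) (Suc p mod 2) =
     - ((\<mu> + of_nat p) / (of_nat n + 1 - \<mu> + of_nat p)) * G_gamma n \<mu> e (of_nat p) (p mod 2)"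
    using G_gamma_step[OF \<mu> eta, of n p] unfolding G_gamma_def Let_def regroup
    by (simp only: mult_minus_left mult_minus_right mult_ac)
  then show ?case unfolding Suc by (simp only: prod.lessThan_Suc power_Suc mult_ac mult_minus_left mult_minus_right mult_1)
qed

text \<open>The product is continuous at every real \<open>lam\<close>, its denominators having
  negative real part, while the Gamma quotient is compared with it only for
  \<open>t \<noteq> 0\<close>, where \<open>Im \<mu> \<noteq> 0\<close>.\<close>

lemma G_eq_prod:
  assumes e: "e \<in> {0, 1}" and \<delta>: "\<delta> = p mod 2"
  shows "G n lam e (of_nat p) \<delta> = (- 1) ^ p *
    (\<Prod>j<p. (- (of_nat (Suc n) / 2) + - (\<i> * of_real lam) - of_nat j) / (- (of_nat (Suc n) / 2) + \<i> * of_real lam - of_nat j))"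
proof -
  define r :: "nat \<Rightarrow> real \<Rightarrow> complex" where
    "r j t = (- (of_nat (Suc n) / 2) + - (\<i> * of_real t) - of_nat j) / (- (of_nat (Suc n) / 2) + \<i> * of_real t - of_nat j)" for j t
  have r: "(of_nat (n + 1) / 2 + \<i> * of_real t + of_nat j) / (of_nat n + 1 - (of_nat (n + 1) / 2 + \<i> * of_real t) + of_nat j) = r j t" for j t
  proof -
    have "of_nat n + 1 - (of_nat (n + 1) / 2 + \<i> * of_real t) + of_nat j = - (- (of_nat (Suc n) / 2) + \<i> * of_real t - of_nat j)"
      by (simp add: field_simps)
    moreover have "of_nat (n + 1) / 2 + \<i> * of_real t + of_nat j = - (- (of_nat (Suc n) / 2) + - (\<i> * of_real t) - of_nat j)"
      by (simp add: field_simps)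
    ultimately show ?thesis unfolding r_def by (simp only: minus_divide_divide)
  qed
  have nz: "- (of_nat (Suc n) / 2) + \<i> * of_real lam - of_nat j \<noteq> 0" for j
  proof
    assume "- (of_nat (Suc n) / 2) + \<i> * of_real lam - of_nat j = 0"
    then have "- (real (Suc n) / 2) - real j = 0" by (simp add: complex_eq_iff)
    moreover have "real (Suc n) / 2 > 0" "real j \<ge> 0" by simp_all
    ultimately show False by linarith
  qed
  have "(r j \<longlongrightarrow> r j lam) (at lam)" for j
    unfolding r_def by (intro tendsto_intros nz)
  then have "((\<lambda>t. (- 1) ^ p * (\<Prod>j<p. r j t)) \<longlongrightarrow> (- 1) ^ p * (\<Prod>j<p. r j lam)) (at lam)"
    by (intro tendsto_intros)
  moreover have "\<forall>\<^sub>F t in at lam. (- 1) ^ p * (\<Prod>j<p. r j t) = G_gamma n (of_nat (n + 1) / 2 + \<i> * of_real t) e (of_nat p) \<delta>"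
  proof -
    have "\<forall>\<^sub>F t in at lam. t \<noteq> 0" 
    \<comment> \<open>The filter \<open>at lam\<close> leaves out \<open>lam\<close> itself, which
      settles the case \<open>lam = 0\<close>.\<close>
    proof (cases "lam = 0")
      case True
      then show ?thesis by (simp add: eventually_neq_at_within)
    next
      case False
      then show ?thesis by (intro tendsto_imp_eventually_ne[OF tendsto_ident_at])
    qed
    then show ?thesis
    proof eventually_elim
      case (elim t)
      have "Im (of_nat (n + 1) / 2 + \<i> * of_real t) \<noteq> 0" using elim by simp
      from G_gamma_eq_prod[OF this e, of n p] show ?case unfolding r \<delta> ..
    qed
  qed
  ultimately have "((\<lambda>t. G_gamma n (of_nat (n + 1) / 2 + \<i> * of_real t) e (of_nat p) \<delta>) \<longlongrightarrow> (- 1) ^ p * (\<Prod>j<p. r j lam)) (at lam)"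
    by (rule Lim_transform_eventually)
  then show ?thesis unfolding G_def r_def[symmetric] by (rule tendsto_Lim[OF at_neq_bot])
qed

section \<open>Smooth vectors and the two calculi\<close>

lemma smooth_vectors_iff:
  fixes u :: "real^'n \<Rightarrow> complex"
  shows "u \<in> smooth_vectors \<nu> e \<longleftrightarrow> (\<exists>U. SV \<nu> e U \<and> u = (\<lambda>s. U (s, 1)))"
  unfolding smooth_vectors_def SV_def smooth_off0_def hom_def Suc_eq_plus1 fun_eq_iff by blast

lemma kernel_op_one:
  fixes U :: "(real^'n) \<times> real \<Rightarrow> complex"
  assumes "SV \<nu> e U" "e \<in> {0, 1}" "Re \<nu> = 0"
  shows "kernel_op \<nu> e (\<lambda>x y. 1) (\<lambda>s. U (s, 1)) y = Theta \<nu> e U (y, 1)"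
  using kernel_op_eq[OF assms, where p = 0 and y = y]
  by (simp only: power_0 cdirs_0 mult_1 lessThan_0 prod.empty div_by_1)

lemma theta_eq:
  fixes U :: "(real^'n) \<times> real \<Rightarrow> complex"
  assumes "SV (\<i> * of_real lam) e U" "e \<in> {0, 1}"
  shows "theta lam e (\<lambda>s. U (s, 1)) = (\<lambda>y. Theta (\<i> * of_real lam) e U (y, 1))"
  unfolding theta_def using kernel_op_one[OF assms] by auto

lemma chart_point_nonzero: "(s :: real^'n, 1 :: real) \<noteq> 0"
  by (simp add: zero_prod_def)

text \<open>\<open>Theta_inversion\<close> provides an explicit left inverse. Injectivity is what
  determines the value of \<open>inv_into\<close> in \<open>Op_vee\<close>.\<close>

lemma inj_on_theta:
  assumes e: "e \<in> {0, 1}"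
  shows "inj_on (theta lam e) (smooth_vectors (\<i> * of_real lam) e :: (real^'n \<Rightarrow> complex) set)"
proof (rule inj_on_inverseI[where g = "\<lambda>v s. (- 1) ^ e * kernel_op (- (\<i> * of_real lam)) e (\<lambda>_ _. 1) v s"])
  fix u :: "real^'n \<Rightarrow> complex"
  assume "u \<in> smooth_vectors (\<i> * of_real lam) e"
  then obtain U where U: "SV (\<i> * of_real lam) e U" and u: "u = (\<lambda>s. U (s, 1))"
    unfolding smooth_vectors_iff by blast
  have "(- 1) ^ e * kernel_op (- (\<i> * of_real lam)) e (\<lambda>_ _. 1) (theta lam e u) s = u s" for s
    unfolding u theta_eq[OF U e]
    using kernel_op_one[OF Theta_SV[OF U] e, of s] Theta_inversion[OF U e _ chart_point_nonzero, of s]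
    by (simp flip: mult.assoc power_mult_distrib)
  then show "(\<lambda>s. (- 1) ^ e * kernel_op (- (\<i> * of_real lam)) e (\<lambda>_ _. 1) (theta lam e u) s) = u" by blast
qed

theorem corollary5p4:
  fixes a b :: "(complex^'n) \<times> complex"
    and lam :: real and \<epsilon> \<delta> p :: nat
    and u :: "real^'n \<Rightarrow> complex"
  assumes "\<epsilon> \<in> {0, 1}"
    and "bilin a b = 0"
    and "\<delta> \<in> {0, 1}" and "\<delta> mod 2 = p mod 2"
    and "u \<in> smooth_vectors (\<i> * of_real lam) \<epsilon>"
  shows "Op_vee lam \<epsilon> (\<lambda>s \<sigma>. phi a b s \<sigma> ^ p) u =
    (\<lambda>s. G CARD('n) lam \<epsilon> (of_nat p) \<delta> * Op lam \<epsilon> (\<lambda>s \<sigma>. phi a b s \<sigma> ^ p) u s)"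
proof -
  define \<nu> where "\<nu> = \<i> * complex_of_real lam"
  note e = assms(1) and ab = assms(2)
  have ba: "bilin b a = 0" using ab by (simp add: bilin_commute)
  have re: "Re \<nu> = 0" "Re (- \<nu>) = 0" by (simp_all add: \<nu>_def)
  obtain U where U: "SV \<nu> \<epsilon> U" and u: "u = (\<lambda>s. U (s, 1))"
    using assms(5) unfolding smooth_vectors_iff \<nu>_def by blast
  let ?T = "Theta \<nu> \<epsilon> U"
  have T: "SV (- \<nu>) \<epsilon> ?T" by (rule Theta_SV[OF U])
  have smU: "smooth_off0 U" and smT: "smooth_off0 ?T" using U T by (simp_all add: SV_def)
  \<comment> \<open>The falling product of the kernel exponent; it is nonzero at imaginary
    arguments, because every factor has negative real part there.\<close>
  define Q :: "complex \<Rightarrow> complex" where "Q \<nu> = (\<Prod>j<p. - (of_nat (Suc CARD('n)) / 2) + \<nu> - of_nat j)" for \<nu>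
  have Qnz: "Q z \<noteq> 0" if "Re z = 0" for z
  proof -
    have "- (of_nat (Suc CARD('n)) / 2) + z - of_nat j \<noteq> 0" for j
    proof
      assume "- (of_nat (Suc CARD('n)) / 2) + z - of_nat j = 0"
      then have "Re (- (of_nat (Suc CARD('n)) / 2) + z - of_nat j) = 0" by (simp only: zero_complex.sel)
      then have "- (real (Suc CARD('n)) / 2) - real j = 0" using that by simp
      moreover have "real (Suc CARD('n)) / 2 > 0" "real j \<ge> 0" by simp_all
      ultimately show False by linarith
    qed
    then show ?thesis by (simp add: Q_def)
  qed
  have phi1: "(\<lambda>s \<sigma>. phi a b s \<sigma> ^ p) = (\<lambda>x y. (cl a (x, 1) * cl b (y, 1) / of_real (1 + x \<bullet> y)) ^ p)"
    unfolding phi_def lin_eq_cl ..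
  \<comment> \<open>\<open>Op\<close> integrates over the second variable of the symbol, so
    \<open>a\<close> and \<open>b\<close> change roles.\<close>
  have phi2: "(\<lambda>\<sigma> s. phi a b s \<sigma> ^ p) = (\<lambda>x y. (cl b (x, 1) * cl a (y, 1) / of_real (1 + x \<bullet> y)) ^ p)"
    unfolding phi_def lin_eq_cl by (simp only: inner_commute mult.commute)
  have K: "kernel_op \<nu> \<epsilon> (\<lambda>s \<sigma>. phi a b s \<sigma> ^ p) u y = cl b (y, 1) ^ p * cdirs a p ?T (y, 1) / Q \<nu>" for y
    unfolding phi1 u Q_def by (rule kernel_op_eq[OF U e re(1)])
  have Op: "Op lam \<epsilon> (\<lambda>s \<sigma>. phi a b s \<sigma> ^ p) u s = cl a (s, 1) ^ p * cdirs b p U (s, 1) / Q (- \<nu>)" for s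
  proof -
    have "Op lam \<epsilon> (\<lambda>s \<sigma>. phi a b s \<sigma> ^ p) u s =
        (- 1) ^ \<epsilon> * (cl a (s, 1) ^ p * cdirs b p (Theta (- \<nu>) \<epsilon> ?T) (s, 1) / Q (- \<nu>))"
      unfolding Op_def u theta_eq[OF U[unfolded \<nu>_def] e] phi2 Q_def \<nu>_def[symmetric]
      by (simp only: kernel_op_eq[OF T e re(2)])
    \<comment> \<open>By inversion the derivatives fall on \<open>U\<close> itself, up to the sign
      that \<open>Op\<close> compensates.\<close>
    also have "cdirs b p (Theta (- \<nu>) \<epsilon> ?T) (s, 1) = cdirs b p (\<lambda>X. (- 1) ^ \<epsilon> * U X) (s, 1)"
      by (rule cdirs_cong[OF Theta_inversion[OF U e re(1)] chart_point_nonzero])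
    also have "\<dots> = (- 1) ^ \<epsilon> * cdirs b p U (s, 1)"
      by (rule cdirs_cmult[OF smU chart_point_nonzero])
    also have "(- 1) ^ \<epsilon> * (cl a (s, 1) ^ p * ((- 1) ^ \<epsilon> * cdirs b p U (s, 1)) / Q (- \<nu>)) =
        ((- 1) ^ \<epsilon> * (- 1) ^ \<epsilon>) * (cl a (s, 1) ^ p * cdirs b p U (s, 1) / Q (- \<nu>))"
      by (simp only: mult_ac times_divide_eq_right)
    also have "(- 1) ^ \<epsilon> * (- 1) ^ \<epsilon> = (1 :: complex)" by (simp flip: power_mult_distrib)
    finally show ?thesis by (simp only: mult_1)
  qed
  define g where "g = G CARD('n) lam \<epsilon> (of_nat p) \<delta>"
  have "\<delta> = p mod 2" using assms(3,4) by auto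
  then have g: "g = (- 1) ^ p * (Q (- \<nu>) / Q \<nu>)"
    unfolding g_def G_eq_prod[OF e] Q_def \<nu>_def prod_dividef by (simp only: G_eq_prod[OF e] prod_dividef)
  \<comment> \<open>The inverse of \<open>theta\<close> is not computed: \<open>E\<close> extends
    the right side of the claim, and it suffices that its transform is the kernel integral of the
    antistandard calculus.\<close>
  define E where "E = (\<lambda>X. (g / Q (- \<nu>)) * (Mop a b ^^ p) U X)"
  define w where "w = (\<lambda>s. g * Op lam \<epsilon> (\<lambda>s \<sigma>. phi a b s \<sigma> ^ p) u s)"
  have SE: "SV \<nu> \<epsilon> E" unfolding E_def by (intro SV_cmult SV_Mop_funpow U)
  have w: "w = (\<lambda>s. E (s, 1))"
    unfolding w_def E_def Op Mop_funpow[OF ab smU chart_point_nonzero] by (simp only: times_divide_eq_left times_divide_eq_right)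
  have "theta lam \<epsilon> w y = kernel_op \<nu> \<epsilon> (\<lambda>s \<sigma>. phi a b s \<sigma> ^ p) u y" for y
  proof -
    have "theta lam \<epsilon> w y = Theta \<nu> \<epsilon> E (y, 1)"
      unfolding w theta_eq[OF SE[unfolded \<nu>_def] e] \<nu>_def ..
    also have "\<dots> = g / Q (- \<nu>) * ((- 1) ^ p * (cl b (y, 1) ^ p * cdirs a p ?T (y, 1)))"
      unfolding E_def Theta_cmult[OF SV_Mop_funpow[OF U] chart_point_nonzero]
        Theta_Mop_funpow[OF U ab chart_point_nonzero] Mop_funpow[OF ba smT chart_point_nonzero] ..
    \<comment> \<open>The quotient \<open>g / Q (- \<nu>)\<close> is
      \<open>(- 1) ^ p / Q \<nu>\<close>; its sign cancels the one from moving \<open>Theta\<close>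
      past the \<open>p\<close> operators.\<close>
    also have "\<dots> = ((- 1) ^ p * (- 1) ^ p) * (cl b (y, 1) ^ p * cdirs a p ?T (y, 1) / Q \<nu>)"
      unfolding g using Qnz[OF re(2)] by simp
    also have "(- 1) ^ p * (- 1) ^ p = (1 :: complex)" by (simp flip: power_mult_distrib)
    finally show ?thesis by (simp only: K mult_1)
  qed
  then have th: "kernel_op \<nu> \<epsilon> (\<lambda>s \<sigma>. phi a b s \<sigma> ^ p) u = theta lam \<epsilon> w" by auto
  have "w \<in> smooth_vectors \<nu> \<epsilon>" unfolding smooth_vectors_iff using SE w by blast
  then have "inv_into (smooth_vectors \<nu> \<epsilon>) (theta lam \<epsilon>) (theta lam \<epsilon> w) = w"
    by (intro inv_into_f_f inj_on_theta[OF e, of lam, folded \<nu>_def])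
  then have "Op_vee lam \<epsilon> (\<lambda>s \<sigma>. phi a b s \<sigma> ^ p) u = w"
    unfolding Op_vee_def \<nu>_def[symmetric] th .
  then show ?thesis unfolding w_def g_def .
qed

end
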